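(* Let $(X_0,X_1)$ and $(Y_0,Y_1)$ be two compatible couples of complex Banach spaces, let $X,Y$ be complex Banach spaces, let $m\in\mathbb{N}$ and let $0<\theta<1$. (1) If $P\in\mathcal{P}(^mX,(Y_0,Y_1))$ and $P:X\to Y_0$ is compact, then $P:X\to[Y_0,Y_1]_\theta$ is compact. (2) If $P\in\mathcal{P}(^m(X_0,X_1),Y)$ and $P:X_0\to Y$ is compact, then $P:[X_0,X_1]_\theta\to Y$ is compact.
   Context: All Banach spaces are over $\mathbb{C}$. A pair $(X_0,X_1)$ of Banach spaces is a compatible couple if both are (continuously embedded) subspaces of a common topological vector space. Then $X_0\cap X_1$ carries the norm $\max\{\|x\|_{X_0},\|x\|_{X_1}\}$ and $X_0+X_1$ the norm $\inf\{\|x_0\|_{X_0}+\|x_1\|_{X_1}: x=x_0+x_1,\ x_i\in X_i\}$; both are Banach spaces. $\mathcal{P}(^m(X_0,X_1),(Y_0,Y_1))$ is the space of $m$-homogeneous polynomials $P:X_0+X_1\to Y_0+Y_1$ such that $P:X_0+X_1\to Y_0+Y_1$ is continuous, and $P(X_j)\subseteq Y_j$ with $P:X_j\to Y_j$ continuous for $j=0,1$. A single Banach space $X$ (or $Y$) in place of a couple stands for the couple $(X,X)$ (or $(Y,Y)$): thus $P\in\mathcal{P}(^mX,(Y_0,Y_1))$ means that $P$ is an $m$-homogeneous polynomial on $X$ with values in $Y_0\cap Y_1$, continuous into $Y_0$ and into $Y_1$; and $P\in\mathcal{P}(^m(X_0,X_1),Y)$ means that $P:X_0+X_1\to Y$ is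 a continuous $m$-homogeneous polynomial (hence continuous on $X_0$ and on $X_1$). A polynomial $P:X\to Y$ between Banach spaces is compact if every $x\in X$ has a ball $B(x,r_x)$, $r_x>0$, with $P(B(x,r_x))$ relatively compact in $Y$; for a homogeneous polynomial this is equivalent to the image of the unit ball being relatively compact. Let $\mathbb{L}=\{z\in\mathbb{C}:1<|z|<e\}$. $\mathcal{F}\{X_0,X_1\}$ is the space of functions $\phi:\overline{\mathbb{L}}\to X_0+X_1$ that are continuous on $\overline{\mathbb{L}}$, holomorphic on $\mathbb{L}$, and such that for $j=0,1$ the restriction of $\phi$ to $\{|z|=e^j\}$ takes values in $X_j$ and is continuous into $X_j$, with norm $\|\phi\|_{\mathcal{F}\{X_0,X_1\}}=\max_{t\in[0,2\pi]}\max\{\|\phi(e^{it})\|_{X_0},\|\phi(e^{1+it})\|_{X_1}\}$. Calderón's complex interpolation space is $[X_0,X_1]_\theta=\{\phi(e^\theta):\phi\in\mathcal{F}\{X_0,X_1\}\}$ with norm $\|x\|_{[X_0,X_1]_\theta}=\inf\{\|\phi\|_{\mathcal{F}\{X_0,X_1\}}:\phi(e^\theta)=x\}$. *)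

theory Defs
  imports "HOL-Analysis.Analysis"
begin

class complex_vector = ab_group_add +
  fixes scaleC :: "complex \<Rightarrow> 'a \<Rightarrow> 'a"  (infixr \<open>*\<^sub>C\<close> 75)
  assumes scaleC_add_right: "a *\<^sub>C (x + y) = a *\<^sub>C x + a *\<^sub>C y"
    and scaleC_add_left: "(a + b) *\<^sub>C x = a *\<^sub>C x + b *\<^sub>C x"
    and scaleC_scaleC: "a *\<^sub>C b *\<^sub>C x = (a * b) *\<^sub>C x"
    and scaleC_one: "1 *\<^sub>C x = x"

global_interpretation cvec: vector_space "scaleC :: complex \<Rightarrow> 'a::complex_vector \<Rightarrow> 'a"
  by standard (simp_all add: scaleC_add_right scaleC_add_left scaleC_scaleC scaleC_one)

instantiation complex :: complex_vector
begin

definition scaleC_complex :: "complex \<Rightarrow> complex \<Rightarrow> complex"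
  where "scaleC_complex a x = a * x"

instance
  by standard (simp_all add: scaleC_complex_def algebra_simps)

end

text \<open>
  The spaces of a couple, their sum and the interpolation spaces are linear subspaces of one
  vector space carrying different norms. A space is therefore a pair of a carrier and a norm
  function; the values of the norm outside the carrier are irrelevant.
\<close>

record 'a nspace =
  pts :: "'a set"
  nrm :: "'a \<Rightarrow> real"

text \<open>
  The locale \<^locale>\<open>Metric_space\<close> requires its distance to be nonnegative and symmetric on the
  whole type, hence the value 0 off the carrier.
\<close>

definition ndist :: "('a::complex_vector) nspace \<Rightarrow> 'a \<Rightarrow> 'a \<Rightarrow> real"
  where "ndist X x y = (if x \<in> pts X \<and> y \<in> pts X then nrm X (x - y) else 0)"

abbreviation ntop :: "('a::complex_vector) nspace \<Rightarrow> 'a topology"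
  where "ntop X \<equiv> Metric_space.mtopology (pts X) (ndist X)"

abbreviation nball :: "('a::complex_vector) nspace \<Rightarrow> 'a \<Rightarrow> real \<Rightarrow> 'a set"
  where "nball X \<equiv> Metric_space.mball (pts X) (ndist X)"

definition complex_normed_space :: "('a::complex_vector) nspace \<Rightarrow> bool"
  where "complex_normed_space X \<longleftrightarrow>
    cvec.subspace (pts X) \<and>
    (\<forall>x\<in>pts X. 0 \<le> nrm X x \<and> (nrm X x = 0 \<longleftrightarrow> x = 0)) \<and>
    (\<forall>x\<in>pts X. \<forall>y\<in>pts X. nrm X (x + y) \<le> nrm X x + nrm X y) \<and>
    (\<forall>c. \<forall>x\<in>pts X. nrm X (c *\<^sub>C x) = cmod c * nrm X x)"

definition complex_banach_space :: "('a::complex_vector) nspace \<Rightarrow> bool"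
  where "complex_banach_space X \<longleftrightarrow>
    complex_normed_space X \<and> Metric_space.mcomplete (pts X) (ndist X)"

lemma Metric_space_ndist:
  assumes "complex_normed_space X"
  shows "Metric_space (pts X) (ndist X)"
proof -
  have sub: "cvec.subspace (pts X)"
    and pos: "\<And>x. x \<in> pts X \<Longrightarrow> 0 \<le> nrm X x"
    and zero: "\<And>x. x \<in> pts X \<Longrightarrow> nrm X x = 0 \<longleftrightarrow> x = 0"
    and add: "\<And>x y. x \<in> pts X \<Longrightarrow> y \<in> pts X \<Longrightarrow> nrm X (x + y) \<le> nrm X x + nrm X y"
    and scale: "\<And>c x. x \<in> pts X \<Longrightarrow> nrm X (c *\<^sub>C x) = cmod c * nrm X x"
    using assms by (simp_all add: complex_normed_space_def)
  have diff: "x - y \<in> pts X" if "x \<in> pts X" "y \<in> pts X" for x y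
    using sub that by (rule cvec.subspace_diff)
  have comm: "nrm X (x - y) = nrm X (y - x)" if "x \<in> pts X" "y \<in> pts X" for x y
    using scale[OF diff[OF that(2,1)], of "- 1"] by simp
  have tri: "nrm X (x - z) \<le> nrm X (x - y) + nrm X (y - z)"
    if "x \<in> pts X" "y \<in> pts X" "z \<in> pts X" for x y z
    using add[OF diff[OF that(1,2)] diff[OF that(2,3)]] by simp
  show ?thesis
  proof (rule Metric_space.intro)
    show "0 \<le> ndist X x y" for x y
      by (simp add: ndist_def pos diff)
    show "ndist X x y = ndist X y x" for x y
      using comm by (simp add: ndist_def)
    show "ndist X x y = 0 \<longleftrightarrow> x = y" if "x \<in> pts X" "y \<in> pts X" for x y
      using that by (simp add: ndist_def zero diff)
    show "ndist X x z \<le> ndist X x y + ndist X y z"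
      if "x \<in> pts X" "y \<in> pts X" "z \<in> pts X" for x y z
      using that tri by (simp add: ndist_def)
  qed
qed

definition complex_tvs :: "('a::complex_vector) topology \<Rightarrow> bool"
  where "complex_tvs T \<longleftrightarrow>
    cvec.subspace (topspace T) \<and>
    continuous_map (prod_topology T T) T (\<lambda>(x, y). x + y) \<and>
    continuous_map (prod_topology euclidean T) T (\<lambda>(c, x). c *\<^sub>C x)"

text \<open>
  Topological vector spaces are Hausdorff here; otherwise the gauge on the sum below need not be
  a norm.
\<close>

definition compatible_couple :: "('a::complex_vector) nspace \<Rightarrow> 'a nspace \<Rightarrow> bool"
  where "compatible_couple X0 X1 \<longleftrightarrow>
    complex_banach_space X0 \<and> complex_banach_space X1 \<and>
    (\<exists>T. complex_tvs T \<and> Hausdorff_space T \<and>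
         continuous_map (ntop X0) T (\<lambda>x. x) \<and> continuous_map (ntop X1) T (\<lambda>x. x))"

definition sum_space :: "('a::complex_vector) nspace \<Rightarrow> 'a nspace \<Rightarrow> 'a nspace"
  where "sum_space X0 X1 =
    \<lparr>pts = {x0 + x1 | x0 x1. x0 \<in> pts X0 \<and> x1 \<in> pts X1},
     nrm = (\<lambda>x. Inf {nrm X0 x0 + nrm X1 x1 | x0 x1.
                       x0 \<in> pts X0 \<and> x1 \<in> pts X1 \<and> x = x0 + x1})\<rparr>"

text \<open>The \<open>m\<close>-tuples of elements of \<open>V\<close> are the extensional functions on \<open>{..<m}\<close>.\<close>

definition multilinear_map ::
    "nat \<Rightarrow> ('a::complex_vector) set \<Rightarrow> ('b::complex_vector) set \<Rightarrow> ((nat \<Rightarrow> 'a) \<Rightarrow> 'b) \<Rightarrow> bool"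
  where "multilinear_map m V W A \<longleftrightarrow>
    (\<forall>x \<in> {..<m} \<rightarrow>\<^sub>E V.
       A x \<in> W \<and>
       (\<forall>i<m. (\<forall>u\<in>V. \<forall>v\<in>V. A (x(i := u + v)) = A (x(i := u)) + A (x(i := v))) \<and>
              (\<forall>c. \<forall>u\<in>V. A (x(i := c *\<^sub>C u)) = c *\<^sub>C A (x(i := u)))))"

definition homogeneous_polynomial ::
    "nat \<Rightarrow> ('a::complex_vector) set \<Rightarrow> ('b::complex_vector) set \<Rightarrow> ('a \<Rightarrow> 'b) \<Rightarrow> bool"
  where "homogeneous_polynomial m V W P \<longleftrightarrow>
    (\<exists>A. multilinear_map m V W A \<and> (\<forall>x\<in>V. P x = A (\<lambda>i\<in>{..<m}. x)))"

text \<open>The inclusions of \<open>P\<close>-images are part of \<^const>\<open>continuous_map\<close>; a single space \<open>X\<close> is the couple \<open>X X\<close>.\<close>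

definition couple_polynomials ::
    "nat \<Rightarrow> ('a::complex_vector) nspace \<Rightarrow> 'a nspace \<Rightarrow>
      ('b::complex_vector) nspace \<Rightarrow> 'b nspace \<Rightarrow> ('a \<Rightarrow> 'b) set"
  where "couple_polynomials m X0 X1 Y0 Y1 =
    {P. homogeneous_polynomial m (pts (sum_space X0 X1)) (pts (sum_space Y0 Y1)) P \<and>
        continuous_map (ntop (sum_space X0 X1)) (ntop (sum_space Y0 Y1)) P \<and>
        continuous_map (ntop X0) (ntop Y0) P \<and>
        continuous_map (ntop X1) (ntop Y1) P}"

definition compact_homogeneous_polynomial ::
    "nat \<Rightarrow> ('a::complex_vector) nspace \<Rightarrow> ('b::complex_vector) nspace \<Rightarrow> ('a \<Rightarrow> 'b) \<Rightarrow> bool"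
  where "compact_homogeneous_polynomial m X Y P \<longleftrightarrow>
    homogeneous_polynomial m (pts X) (pts Y) P \<and>
    (\<forall>x\<in>pts X. \<exists>r>0. compactin (ntop Y) (ntop Y closure_of (P ` nball X x r)))"

definition annulus :: "complex set"
  where "annulus = {z. 1 < cmod z \<and> cmod z < exp 1}"

definition nspace_holomorphic_on ::
    "('a::complex_vector) nspace \<Rightarrow> (complex \<Rightarrow> 'a) \<Rightarrow> complex set \<Rightarrow> bool"
  where "nspace_holomorphic_on X \<phi> S \<longleftrightarrow>
    (\<forall>z\<in>S. \<exists>l. limitin (ntop X) (\<lambda>w. inverse (w - z) *\<^sub>C (\<phi> w - \<phi> z)) l (at z within S))"

definition calderon_functions ::
    "('a::complex_vector) nspace \<Rightarrow> 'a nspace \<Rightarrow> (complex \<Rightarrow> 'a) set"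
  where "calderon_functions X0 X1 =
    {\<phi>. continuous_map (top_of_set (closure annulus)) (ntop (sum_space X0 X1)) \<phi> \<and>
         nspace_holomorphic_on (sum_space X0 X1) \<phi> annulus \<and>
         continuous_map (top_of_set {z. cmod z = 1}) (ntop X0) \<phi> \<and>
         continuous_map (top_of_set {z. cmod z = exp 1}) (ntop X1) \<phi>}"

definition calderon_norm ::
    "('a::complex_vector) nspace \<Rightarrow> 'a nspace \<Rightarrow> (complex \<Rightarrow> 'a) \<Rightarrow> real"
  where "calderon_norm X0 X1 \<phi> =
    (SUP t\<in>{0..2 * pi}. max (nrm X0 (\<phi> (exp (\<i> * of_real t))))
                              (nrm X1 (\<phi> (exp (1 + \<i> * of_real t)))))"

definition calderon_space ::
    "('a::complex_vector) nspace \<Rightarrow> 'a nspace \<Rightarrow> real \<Rightarrow> 'a nspace"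
  where "calderon_space X0 X1 \<theta> =
    \<lparr>pts = {\<phi> (exp (of_real \<theta>)) | \<phi>. \<phi> \<in> calderon_functions X0 X1},
     nrm = (\<lambda>x. Inf {calderon_norm X0 X1 \<phi> | \<phi>.
                       \<phi> \<in> calderon_functions X0 X1 \<and> \<phi> (exp (of_real \<theta>)) = x})\<rparr>"

end

theory Submission
  imports Defs "HOL-Complex_Analysis.Complex_Analysis"
begin

text \<open>
  Write \<open>X\<^sub>\<theta>\<close> for the interpolation space. The two halves rest on two dual estimates, both obtained by
  multiplying with a power of \<open>exp \<theta> / z\<close>, which is 1 at \<open>exp \<theta>\<close> and has constant modulus on each of the
  two boundary circles.
  
  The upper estimate is for vectors in both spaces: testing with the function \<open>(exp \<theta> / z) ^ n y\<close> gives
  \<open>\<parallel>y\<parallel>\<^sub>\<theta> \<le> max (exp (n \<theta>) \<parallel>y\<parallel>\<^sub>0) (exp (- n (1 - \<theta>)) \<parallel>y\<parallel>\<^sub>1)\<close>. With \<open>n\<close> large it shows that vectors bounded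
  in \<open>Y1\<close> and small in \<open>Y0\<close> are small in \<open>Y\<^sub>\<theta>\<close>. Near any point \<open>P\<close> is bounded in \<open>Y1\<close>, so finite nets for
  its values in \<open>Y0\<close> are finite nets in \<open>Y\<^sub>\<theta>\<close>, and completeness of \<open>Y\<^sub>\<theta>\<close> makes the image relatively
  compact. This is \<open>compact_into_calderon_space\<close>.
  
  The lower estimate, \<open>K_functional_le_calderon_norm\<close>, says that a vector \<open>x\<close> with \<open>\<parallel>x\<parallel>\<^sub>\<theta> < R\<close> splits as
  \<open>u + v\<close> with \<open>exp (- n \<theta>) \<parallel>u\<parallel>\<^sub>0 + exp (n (1 - \<theta>)) \<parallel>v\<parallel>\<^sub>1 < R\<close>. The infimum of the left side over all
  splittings is a seminorm on the sum; a Hahn-Banach functional \<open>f\<close> that norms \<open>x\<close> turns the claim into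
  the maximum principle for the scalar function \<open>(exp \<theta> / z) ^ n f (\<phi> z)\<close>. With \<open>n\<close> large, \<open>v\<close> is as small
  as desired while \<open>u\<close> stays bounded in \<open>X0\<close>. As \<open>P\<close> is uniformly continuous on bounded sets of the sum,
  \<open>P x\<close> is close to \<open>P u\<close>, which lies in a relatively compact set. This is
  \<open>compact_from_calderon_space\<close>.
  
  Two further points carry weight. That \<open>X\<^sub>\<theta>\<close> is a Banach space needs the maximum principle for
  definiteness and, for completeness, that uniform limits of holomorphic functions are holomorphic; both
  follow from scalar complex analysis through norming functionals. And \<open>polarization\<close> represents
  \<open>P\<close> by a multilinear map built from values of \<open>P\<close> alone. It is what makes \<open>P\<close> a homogeneous
  polynomial into \<open>Y\<^sub>\<theta>\<close>, and what makes it uniformly continuous on bounded sets.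
\<close>

section \<open>The Hahn-Banach theorem for complex seminorms\<close>

definition seminorm_on :: "('a::complex_vector) set \<Rightarrow> ('a \<Rightarrow> real) \<Rightarrow> bool"
  where "seminorm_on V p \<longleftrightarrow>
    cvec.subspace V \<and> (\<forall>x\<in>V. 0 \<le> p x) \<and>
    (\<forall>x\<in>V. \<forall>y\<in>V. p (x + y) \<le> p x + p y) \<and>
    (\<forall>c. \<forall>x\<in>V. p (c *\<^sub>C x) = cmod c * p x)"

lemma complex_normed_space_iff_seminorm_on:
  "complex_normed_space X \<longleftrightarrow>
    seminorm_on (pts X) (nrm X) \<and> (\<forall>x\<in>pts X. nrm X x = 0 \<longrightarrow> x = 0)"
proof -
  have "nrm X 0 = 0" if "seminorm_on (pts X) (nrm X)"
  proof -
    have "0 \<in> pts X" using that by (simp add: seminorm_on_def cvec.subspace_0)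
    then have "nrm X (0 *\<^sub>C 0) = cmod 0 * nrm X 0"
      using that unfolding seminorm_on_def by blast
    then show ?thesis by simp
  qed
  then show ?thesis
    unfolding complex_normed_space_def by (auto simp: seminorm_on_def)
qed

definition sublinear_on :: "('a::complex_vector) set \<Rightarrow> ('a \<Rightarrow> real) \<Rightarrow> bool"
  where "sublinear_on V q \<longleftrightarrow>
    (\<forall>x\<in>V. \<forall>y\<in>V. q (x + y) \<le> q x + q y) \<and>
    (\<forall>x\<in>V. \<forall>t\<ge>0. q (of_real t *\<^sub>C x) = t * q x)"

lemma sublinear_onI:
  assumes V: "cvec.subspace V"
    and add: "\<And>x y. x \<in> V \<Longrightarrow> y \<in> V \<Longrightarrow> q (x + y) \<le> q x + q y"
    and scale: "\<And>x t. x \<in> V \<Longrightarrow> 0 < t \<Longrightarrow> q (of_real t *\<^sub>C x) \<le> t * q x"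
    and zero: "q 0 = 0"
  shows "sublinear_on V q"
proof -
  have "q (of_real t *\<^sub>C x) = t * q x" if x: "x \<in> V" and t: "0 \<le> t" for x and t :: real
  proof (cases "t = 0")
    case False
    with t have t: "0 < t" by simp
    have "q (of_real (inverse t) *\<^sub>C of_real t *\<^sub>C x) \<le> inverse t * q (of_real t *\<^sub>C x)"
      by (rule scale) (use V x t in \<open>auto intro: cvec.subspace_scale\<close>)
    then have "t * q x \<le> q (of_real t *\<^sub>C x)"
      using t by (simp add: scaleC_scaleC scaleC_one field_simps flip: of_real_mult)
    with scale[OF x t] show ?thesis by simp
  qed (simp add: zero)
  with add show ?thesis by (simp add: sublinear_on_def)
qed

lemma sublinear_on_zero:
  assumes "cvec.subspace V" "sublinear_on V q"
  shows "q 0 = 0"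
proof -
  have "q (of_real 0 *\<^sub>C 0) = 0 * q 0"
    using assms unfolding sublinear_on_def by (meson cvec.subspace_0 order_refl)
  then show ?thesis by simp
qed

lemma sublinear_on_minus:
  assumes "cvec.subspace V" "sublinear_on V q" "x \<in> V"
  shows "- q (- x) \<le> q x"
proof -
  have "q (x + (- x)) \<le> q x + q (- x)"
    using assms cvec.subspace_neg[of V x] unfolding sublinear_on_def by blast
  then show ?thesis using sublinear_on_zero[OF assms(1,2)] by simp
qed

text \<open>
  The functional \<open>r x = inf {q (x + t y) - t q y | t \<ge> 0}\<close> is sublinear because the parameters \<open>t\<close> of
  two points can be added. The last two bounds are its members \<open>t = 0\<close> and \<open>t = 1\<close>. The second
  says that a sublinear functional which cannot be lowered is additive, and that a functional can be
  forced to be extremal in a prescribed direction.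
\<close>
lemma sublinear_on_tilt:
  assumes V: "cvec.subspace V" and q: "sublinear_on V q" and y: "y \<in> V"
  obtains r where "sublinear_on V r" "\<And>x. x \<in> V \<Longrightarrow> r x \<le> q x"
    "\<And>x. x \<notin> V \<Longrightarrow> r x = 0" "\<And>x. x \<in> V \<Longrightarrow> r x \<le> q (x + y) - q y"
proof -
  define g where "g x t = q (x + of_real t *\<^sub>C y) - t * q y" for x and t :: real
  define r where "r x = (if x \<in> V then INF t\<in>{0..}. g x t else 0)" for x
  have sub: "q (a + b) \<le> q a + q b" if "a \<in> V" "b \<in> V" for a b
    using q that by (simp add: sublinear_on_def)
  have hom: "q (of_real t *\<^sub>C a) = t * q a" if "a \<in> V" "0 \<le> t" for a t
    using q that by (simp add: sublinear_on_def)
  have ty: "of_real t *\<^sub>C y \<in> V" for t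
    using V y by (rule cvec.subspace_scale)
  have below: "- q (- x) \<le> g x t" if "x \<in> V" "0 \<le> t" for x t
  proof -
    have "q ((x + of_real t *\<^sub>C y) + (- x)) \<le> q (x + of_real t *\<^sub>C y) + q (- x)"
      using that ty[of t] V by (intro sub) (auto intro: cvec.subspace_add cvec.subspace_neg)
    then show ?thesis using hom[OF y that(2)] by (simp add: g_def)
  qed
  have bdd: "bdd_below (g x ` {0..})" if "x \<in> V" for x
    using below[OF that] by (intro bdd_belowI[of _ "- q (- x)"]) auto
  have le: "r x \<le> g x t" if "x \<in> V" "0 \<le> t" for x t
    using bdd[OF that(1)] that by (auto simp: r_def intro: cINF_lower)
  have ge: "c \<le> r x" if "x \<in> V" "\<And>t. 0 \<le> t \<Longrightarrow> c \<le> g x t" for c x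
    using that by (auto simp: r_def intro!: cINF_greatest)
  have "sublinear_on V r"
  proof (rule sublinear_onI[OF V])
    fix x1 x2 assume x: "x1 \<in> V" "x2 \<in> V"
    have x12: "x1 + x2 \<in> V" using V x by (rule cvec.subspace_add)
    have *: "r (x1 + x2) \<le> g x1 s + g x2 t" if "0 \<le> s" "0 \<le> t" for s t
    proof -
      have "g (x1 + x2) (s + t) = q ((x1 + of_real s *\<^sub>C y) + (x2 + of_real t *\<^sub>C y)) - (s + t) * q y"
        by (simp add: g_def scaleC_add_left algebra_simps)
      also have "\<dots> \<le> g x1 s + g x2 t"
        using sub[of "x1 + of_real s *\<^sub>C y" "x2 + of_real t *\<^sub>C y"] x ty V
        by (simp add: g_def cvec.subspace_add algebra_simps)
      finally show ?thesis using le[OF x12, of "s + t"] that by simp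
    qed
    have "r (x1 + x2) - g x1 s \<le> r x2" if "0 \<le> s" for s
      by (rule ge) (use * x that in \<open>auto simp: algebra_simps\<close>)
    then have "r (x1 + x2) - r x2 \<le> r x1"
      by (intro ge) (use x in \<open>auto simp: algebra_simps\<close>)
    then show "r (x1 + x2) \<le> r x1 + r x2" by simp
  next
    fix x t assume x: "x \<in> V" and t: "(0::real) < t"
    have "r (of_real t *\<^sub>C x) / t \<le> r x"
    proof (rule ge[OF x])
      fix s :: real assume s: "0 \<le> s"
      have eq: "of_real t *\<^sub>C x + of_real (t * s) *\<^sub>C y = of_real t *\<^sub>C (x + of_real s *\<^sub>C y)"
        by (simp add: scaleC_add_right scaleC_scaleC)
      have "r (of_real t *\<^sub>C x) \<le> g (of_real t *\<^sub>C x) (t * s)"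
        using V x s t by (intro le) (auto intro: cvec.subspace_scale)
      also have "\<dots> = t * g x s"
        using hom[of "x + of_real s *\<^sub>C y" t] x ty V t
        unfolding g_def eq by (simp add: cvec.subspace_add algebra_simps)
      finally show "r (of_real t *\<^sub>C x) / t \<le> g x s" using t by (simp add: field_simps)
    qed
    then show "r (of_real t *\<^sub>C x) \<le> t * r x" using t by (simp add: field_simps)
  next
    have V0: "0 \<in> V" using V by (rule cvec.subspace_0)
    have "g 0 t = 0" if "0 \<le> t" for t
      using hom[OF y that] by (simp add: g_def)
    then show "r 0 = 0"
      using le[OF V0, of 0] ge[OF V0, of 0] by fastforce
  qed
  moreover have "r x \<le> q x" if "x \<in> V" for x
    using le[OF that, of 0] by (simp add: g_def)
  moreover have "r x \<le> q (x + y) - q y" if "x \<in> V" for x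
    using le[OF that, of 1] by (simp add: g_def scaleC_one)
  ultimately show thesis
    by (intro that[of r]) (auto simp: r_def)
qed

text \<open>
  Zorn's lemma, where the lower bound of a chain is the pointwise infimum. It is finite since
  \<open>q x \<ge> - q (- x) \<ge> - p (- x)\<close> for each member \<open>q\<close>. Fixing the value 0 off \<open>V\<close> makes functionals
  equal as soon as they agree on \<open>V\<close>, so that the pointwise order is antisymmetric.
\<close>
lemma minimal_sublinear_below:
  assumes V: "cvec.subspace V" and p: "sublinear_on V p"
  obtains q where "sublinear_on V q" "\<And>x. x \<in> V \<Longrightarrow> q x \<le> p x" "\<And>x. x \<notin> V \<Longrightarrow> q x = 0"
    "\<forall>r. sublinear_on V r \<longrightarrow> (\<forall>x\<in>V. r x \<le> q x) \<longrightarrow> (\<forall>x\<in>V. r x = q x)"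
proof -
  define A where "A = {q. sublinear_on V q \<and> (\<forall>x\<in>V. q x \<le> p x) \<and> (\<forall>x. x \<notin> V \<longrightarrow> q x = 0)}"
  define P where "P q r \<longleftrightarrow> (\<forall>x. r x \<le> q x)" for q r :: "'a \<Rightarrow> real"
  define p' where "p' x = (if x \<in> V then p x else 0)" for x
  have p'A: "p' \<in> A"
    using p V unfolding A_def sublinear_on_def
    by (auto simp: p'_def cvec.subspace_add cvec.subspace_scale)
  have "\<exists>m\<in>A. \<forall>a\<in>A. P m a \<longrightarrow> a = m"
  proof (rule predicate_Zorn)
    show "partial_order_on A (relation_of P A)"
      unfolding partial_order_on_def preorder_on_def refl_on_def trans_def antisym_def relation_of_def P_def
      by (auto intro!: ext intro: order_trans antisym)
  next
    fix C assume C: "C \<in> Chains (relation_of P A)"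
    have CA: "C \<subseteq> A" using C unfolding Chains_def relation_of_def by auto
    have tot: "P a b \<or> P b a" if "a \<in> C" "b \<in> C" for a b
      using C that unfolding Chains_def relation_of_def by auto
    show "\<exists>u\<in>A. \<forall>a\<in>C. P a u"
    proof (cases "C = {}")
      case True then show ?thesis using p'A by auto
    next
      case False
      define u where "u x = (if x \<in> V then INF q\<in>C. q x else 0)" for x
      have below: "- p (- x) \<le> q x" if "q \<in> C" "x \<in> V" for q x
      proof -
        have "q \<in> A" using CA that by auto
        then have "- q (- x) \<le> q x" "q (- x) \<le> p (- x)"
          using sublinear_on_minus[OF V _ that(2)] V that(2)
          by (auto simp: A_def cvec.subspace_neg)
        then show ?thesis by simp
      qed
      have le: "u x \<le> q x" if "q \<in> C" "x \<in> V" for q x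
        using that below by (auto simp: u_def intro!: cINF_lower bdd_belowI[of _ "- p (- x)"])
      have ge: "c \<le> u x" if "x \<in> V" "\<And>q. q \<in> C \<Longrightarrow> c \<le> q x" for c x
        using that False by (auto simp: u_def intro!: cINF_greatest)
      have sl: "sublinear_on V q" if "q \<in> C" for q using CA that by (auto simp: A_def)
      have "sublinear_on V u"
      proof (rule sublinear_onI[OF V])
        fix x y assume xy: "x \<in> V" "y \<in> V"
        have *: "u (x + y) \<le> a x + b y" if ab: "a \<in> C" "b \<in> C" for a b
        proof -
          obtain c where c: "c \<in> C" "\<And>z. c z \<le> a z" "\<And>z. c z \<le> b z"
            using tot[OF ab] ab unfolding P_def by fastforce
          have "u (x + y) \<le> c (x + y)" using le[OF c(1)] V xy by (simp add: cvec.subspace_add)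
          also have "\<dots> \<le> c x + c y" using sl[OF c(1)] xy by (simp add: sublinear_on_def)
          also have "\<dots> \<le> a x + b y" using c(2,3) by (intro add_mono)
          finally show ?thesis .
        qed
        have "u (x + y) - a x \<le> u y" if "a \<in> C" for a
        proof (rule ge[OF xy(2)])
          show "u (x + y) - a x \<le> b y" if "b \<in> C" for b
            using *[OF \<open>a \<in> C\<close> that] by simp
        qed
        then have "u (x + y) - u y \<le> u x"
          using xy by (intro ge) (auto simp: algebra_simps)
        then show "u (x + y) \<le> u x + u y" by simp
      next
        fix x t assume x: "x \<in> V" and t: "(0::real) < t"
        have "u (of_real t *\<^sub>C x) / t \<le> u x"
        proof (rule ge[OF x])
          fix q assume q: "q \<in> C"
          have "u (of_real t *\<^sub>C x) \<le> q (of_real t *\<^sub>C x)"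
            using le[OF q] V x by (simp add: cvec.subspace_scale)
          also have "\<dots> = t * q x" using sl[OF q] x t by (simp add: sublinear_on_def)
          finally show "u (of_real t *\<^sub>C x) / t \<le> q x" using t by (simp add: field_simps)
        qed
        then show "u (of_real t *\<^sub>C x) \<le> t * u x" using t by (simp add: field_simps)
      next
        have "q 0 = 0" if "q \<in> C" for q using sublinear_on_zero[OF V sl[OF that]] .
        then have "(INF q\<in>C. q 0) = (INF q\<in>C. (0::real))" by (intro INF_cong) auto
        then show "u 0 = 0" using False V by (simp add: u_def cvec.subspace_0)
      qed
      moreover have "u x \<le> p x" if "x \<in> V" for x
      proof -
        obtain q where "q \<in> C" using False by auto
        then show ?thesis using le[of q x] CA that unfolding A_def by force
      qed
      ultimately have "u \<in> A" by (auto simp: A_def u_def)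
      moreover have "P a u" if "a \<in> C" for a
        using le[OF that] CA that by (auto simp: P_def A_def u_def)
      ultimately show ?thesis by blast
    qed
  qed
  then obtain q where q: "q \<in> A" and min: "\<And>a. a \<in> A \<Longrightarrow> P q a \<Longrightarrow> a = q" by blast
  show thesis
  proof (rule that[of q])
    have "r x = q x" if r: "sublinear_on V r" "\<forall>x\<in>V. r x \<le> q x" and x: "x \<in> V" for r x
    proof -
    define r' where "r' x = (if x \<in> V then r x else 0)" for x
    have "sublinear_on V r'"
      using r(1) V unfolding sublinear_on_def
      by (auto simp: r'_def cvec.subspace_add cvec.subspace_scale)
    then have "r' \<in> A" "P q r'"
      using q r(2) by (force simp: A_def P_def r'_def)+
    then have "r' = q" by (rule min)
    then have "r' x = q x" by simp
    then show "r x = q x" using x by (simp add: r'_def)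
    qed
    then show "\<forall>r. sublinear_on V r \<longrightarrow> (\<forall>x\<in>V. r x \<le> q x) \<longrightarrow> (\<forall>x\<in>V. r x = q x)" by blast
  qed (use q in \<open>auto simp: A_def\<close>)
qed

definition linear_functional_on :: "('a::complex_vector) set \<Rightarrow> ('a \<Rightarrow> complex) \<Rightarrow> bool"
  where "linear_functional_on V f \<longleftrightarrow>
    (\<forall>x\<in>V. \<forall>y\<in>V. f (x + y) = f x + f y) \<and> (\<forall>c. \<forall>x\<in>V. f (c *\<^sub>C x) = c * f x)"

text \<open>
  No functional has to be extended: a minimal sublinear functional below \<open>p\<close> is already real linear
  on all of \<open>V\<close>, by tilting it in any direction. Tilting \<open>p\<close> in the direction \<open>x0\<close> before
  minimizing pins the value at \<open>x0\<close>. The complex functional is recovered from its real part \<open>u\<close>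
  as \<open>u x - \<i> u (\<i> x)\<close>, and rotating \<open>x\<close> until the value is real and positive bounds its modulus.
\<close>
theorem Hahn_Banach_norming_functional:
  assumes p: "seminorm_on V p" and x0: "x0 \<in> V"
  obtains f where "linear_functional_on V f" "\<And>x. x \<in> V \<Longrightarrow> cmod (f x) \<le> p x" "cmod (f x0) = p x0"
proof -
  have V: "cvec.subspace V" using p by (simp add: seminorm_on_def)
  note subV = cvec.subspace_add[OF V] cvec.subspace_neg[OF V] cvec.subspace_scale[OF V]
  have ps: "p (c *\<^sub>C x) = cmod c * p x" if "x \<in> V" for c x
    using p that by (simp add: seminorm_on_def)
  have sp: "sublinear_on V p"
    using p by (auto simp: seminorm_on_def sublinear_on_def)
  obtain q0 where q0: "sublinear_on V q0" "\<And>x. x \<in> V \<Longrightarrow> q0 x \<le> p x"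
      "\<And>x. x \<in> V \<Longrightarrow> q0 x \<le> p (x + x0) - p x0"
    by (rule sublinear_on_tilt[OF V sp x0]) (rule that; assumption)
  obtain u where u: "sublinear_on V u" "\<And>x. x \<in> V \<Longrightarrow> u x \<le> q0 x"
      and min: "\<forall>r. sublinear_on V r \<longrightarrow> (\<forall>x\<in>V. r x \<le> u x) \<longrightarrow> (\<forall>x\<in>V. r x = u x)"
    by (rule minimal_sublinear_below[OF V q0(1)]) (rule that; assumption)
  have up: "u x \<le> p x" if "x \<in> V" for x using u(2) q0(2) that by force
  have uadd: "u (x + y) = u x + u y" if xy: "x \<in> V" "y \<in> V" for x y
  proof -
    obtain r where r: "sublinear_on V r" "\<And>x. x \<in> V \<Longrightarrow> r x \<le> u x"
        "\<And>x. x \<in> V \<Longrightarrow> r x \<le> u (x + y) - u y"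
      by (rule sublinear_on_tilt[OF V u(1) xy(2)]) (rule that; assumption)
    have "u x \<le> u (x + y) - u y" using min r(1,2) r(3)[OF xy(1)] xy(1) by metis
    then show ?thesis using u(1) xy unfolding sublinear_on_def by force
  qed
  have u0: "u 0 = 0" using V u(1) by (rule sublinear_on_zero)
  have uneg: "u (- x) = - u x" if "x \<in> V" for x
    using uadd[of x "- x"] that u0 subV by simp
  have uscale: "u (of_real t *\<^sub>C x) = t * u x" if x: "x \<in> V" for x and t :: real
  proof (cases "0 \<le> t")
    case True then show ?thesis using u(1) x by (simp add: sublinear_on_def)
  next
    case False
    then have "0 \<le> - t" by simp
    then have "u (of_real (- t) *\<^sub>C x) = (- t) * u x"
      using u(1) x unfolding sublinear_on_def by blast
    moreover have "of_real (- t) *\<^sub>C x = - (of_real t *\<^sub>C x)" by simp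
    ultimately show ?thesis using uneg[of "of_real t *\<^sub>C x"] subV x by simp
  qed
  define f where "f x = complex_of_real (u x) - \<i> * complex_of_real (u (\<i> *\<^sub>C x))" for x
  have fadd: "f (x + y) = f x + f y" if "x \<in> V" "y \<in> V" for x y
    using uadd that subV by (simp add: f_def scaleC_add_right algebra_simps)
  have fscale: "f (c *\<^sub>C x) = c * f x" if x: "x \<in> V" for c x
  proof -
    have ixV: "\<i> *\<^sub>C x \<in> V" using subV x by blast
    have "c *\<^sub>C x = of_real (Re c) *\<^sub>C x + of_real (Im c) *\<^sub>C \<i> *\<^sub>C x"
      unfolding scaleC_scaleC scaleC_add_left[symmetric] by (simp add: complex_eq mult.commute)
    then have 1: "u (c *\<^sub>C x) = Re c * u x + Im c * u (\<i> *\<^sub>C x)"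
      using uadd[of "of_real (Re c) *\<^sub>C x" "of_real (Im c) *\<^sub>C \<i> *\<^sub>C x"]
        uscale[OF x, of "Re c"] uscale[OF ixV, of "Im c"] x ixV subV by metis
    have "\<i> *\<^sub>C c *\<^sub>C x = of_real (Re c) *\<^sub>C \<i> *\<^sub>C x + of_real (- Im c) *\<^sub>C x"
      unfolding scaleC_scaleC scaleC_add_left[symmetric]
      by (rule arg_cong[where f = "\<lambda>a. a *\<^sub>C x"]) (simp add: complex_eq_iff)
    then have 2: "u (\<i> *\<^sub>C c *\<^sub>C x) = Re c * u (\<i> *\<^sub>C x) + (- Im c) * u x"
      using uadd[of "of_real (Re c) *\<^sub>C \<i> *\<^sub>C x" "of_real (- Im c) *\<^sub>C x"]
        uscale[OF x, of "- Im c"] uscale[OF ixV, of "Re c"] x ixV subV by metis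
    show ?thesis unfolding f_def 1 2 by (simp add: complex_eq_iff)
  qed
  have bound: "cmod (f x) \<le> p x" if x: "x \<in> V" for x
  proof (cases "f x = 0")
    case True then show ?thesis using p x by (simp add: seminorm_on_def)
  next
    case False
    \<comment> \<open>the rotation that makes the value real and nonnegative\<close>
    define c where "c = cnj (f x) / of_real (cmod (f x))"
    have c: "cmod c = 1" using False by (simp add: c_def norm_divide)
    have "f (c *\<^sub>C x) = of_real (cmod (f x))"
      using False by (simp add: fscale[OF x] c_def complex_norm_square[symmetric] mult.commute power2_eq_square)
    then have "cmod (f x) = u (c *\<^sub>C x)"
      by (simp add: f_def complex_eq_iff)
    also have "\<dots> \<le> p (c *\<^sub>C x)" using x subV by (intro up) auto
    finally show ?thesis by (simp add: ps[OF x] c)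
  qed
  have "p 0 = 0" using V sp by (rule sublinear_on_zero)
  then have "u (- x0) \<le> - p x0"
    using u(2)[of "- x0"] q0(3)[of "- x0"] x0 subV by simp
  then have "p x0 \<le> Re (f x0)" using uneg[OF x0] by (simp add: f_def)
  also have "\<dots> \<le> cmod (f x0)" by (rule complex_Re_le_cmod)
  finally have "cmod (f x0) = p x0" using bound[OF x0] by simp
  then show thesis using that[of f] fadd fscale bound by (auto simp: linear_functional_on_def)
qed

section \<open>Normed spaces given by a carrier and a norm\<close>

lemma
  assumes X: "complex_normed_space X"
  shows nspace_subspace: "cvec.subspace (pts X)"
    and nrm_nonneg: "x \<in> pts X \<Longrightarrow> 0 \<le> nrm X x"
    and nrm_eq_0: "x \<in> pts X \<Longrightarrow> nrm X x = 0 \<longleftrightarrow> x = 0"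
    and nrm_add: "x \<in> pts X \<Longrightarrow> y \<in> pts X \<Longrightarrow> nrm X (x + y) \<le> nrm X x + nrm X y"
    and nrm_scale: "x \<in> pts X \<Longrightarrow> nrm X (c *\<^sub>C x) = cmod c * nrm X x"
    and nspace_zero: "0 \<in> pts X"
    and nspace_add: "x \<in> pts X \<Longrightarrow> y \<in> pts X \<Longrightarrow> x + y \<in> pts X"
    and nspace_diff: "x \<in> pts X \<Longrightarrow> y \<in> pts X \<Longrightarrow> x - y \<in> pts X"
    and nspace_scale: "x \<in> pts X \<Longrightarrow> c *\<^sub>C x \<in> pts X"
  using X by (auto simp: complex_normed_space_def
      intro: cvec.subspace_0 cvec.subspace_add cvec.subspace_diff cvec.subspace_scale)

lemma nspace_sum:
  assumes "complex_normed_space X" "\<And>i. i \<in> I \<Longrightarrow> u i \<in> pts X"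
  shows "sum u I \<in> pts X"
  using cvec.subspace_sum[OF nspace_subspace[OF assms(1)], of I u] assms(2) .

lemma nrm_zero: "complex_normed_space X \<Longrightarrow> nrm X 0 = 0"
  using nrm_eq_0[of X 0] nspace_zero[of X] by simp

lemma nrm_minus_commute:
  assumes X: "complex_normed_space X" and "x \<in> pts X" "y \<in> pts X"
  shows "nrm X (x - y) = nrm X (y - x)"
  using nrm_scale[OF X nspace_diff[OF X assms(2,3)], of "- 1"] by simp

lemma nrm_diff_triangle:
  assumes X: "complex_normed_space X" and "x \<in> pts X" "y \<in> pts X" "z \<in> pts X"
  shows "nrm X (x - z) \<le> nrm X (x - y) + nrm X (y - z)"
  using nrm_add[OF X nspace_diff[OF X assms(2,3)] nspace_diff[OF X assms(3,4)]] by simp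

lemma nrm_diff_le:
  assumes X: "complex_normed_space X" and "x \<in> pts X" "y \<in> pts X"
  shows "nrm X (x - y) \<le> nrm X x + nrm X y"
  using nrm_diff_triangle[OF X assms(2) nspace_zero[OF X] assms(3)]
    nrm_minus_commute[OF X nspace_zero[OF X] assms(3)] by simp

lemma nrm_sum:
  assumes X: "complex_normed_space X" and "\<And>i. i \<in> I \<Longrightarrow> u i \<in> pts X"
  shows "nrm X (sum u I) \<le> (\<Sum>i\<in>I. nrm X (u i))"
  using assms(2)
proof (induction I rule: infinite_finite_induct)
  case (insert i I)
  then have "nrm X (u i + sum u I) \<le> nrm X (u i) + nrm X (sum u I)"
    using X by (intro nrm_add nspace_sum) auto
  with insert show ?case by fastforce
qed (simp_all add: nrm_zero X)

lemma banach_imp_normed: "complex_banach_space X \<Longrightarrow> complex_normed_space X"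
  by (simp add: complex_banach_space_def)

lemma limitin_ntop:
  assumes X: "complex_normed_space X"
  shows "limitin (ntop X) g l F \<longleftrightarrow>
    l \<in> pts X \<and> (\<forall>\<epsilon>>0. \<forall>\<^sub>F w in F. g w \<in> pts X \<and> nrm X (g w - l) < \<epsilon>)"
proof -
  have "l \<in> pts X \<Longrightarrow> (g w \<in> pts X \<and> ndist X (g w) l < e) = (g w \<in> pts X \<and> nrm X (g w - l) < e)" for w e
    by (auto simp: ndist_def)
  then show ?thesis
    unfolding Metric_space.limitin_metric[OF Metric_space_ndist[OF X]] by (auto cong: conj_cong)
qed

lemma in_nball:
  assumes X: "complex_normed_space X"
  shows "y \<in> nball X x r \<longleftrightarrow> x \<in> pts X \<and> y \<in> pts X \<and> nrm X (y - x) < r"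
  using nrm_minus_commute[OF X]
  by (auto simp: Metric_space.in_mball[OF Metric_space_ndist[OF X]] ndist_def)

lemma topspace_ntop: "complex_normed_space X \<Longrightarrow> topspace (ntop X) = pts X"
  by (rule Metric_space.topspace_mtopology[OF Metric_space_ndist])

lemma continuous_map_ntop_ntop:
  assumes X: "complex_normed_space X" and Y: "complex_normed_space Y"
  shows "continuous_map (ntop X) (ntop Y) f \<longleftrightarrow> f \<in> pts X \<rightarrow> pts Y \<and>
    (\<forall>x\<in>pts X. \<forall>\<epsilon>>0. \<exists>\<delta>>0. \<forall>y\<in>pts X. nrm X (y - x) < \<delta> \<longrightarrow> nrm Y (f y - f x) < \<epsilon>)"
proof -
  have *: "f ` pts X \<subseteq> pts Y \<Longrightarrow> x \<in> pts X \<Longrightarrow>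
      (y \<in> pts X \<and> ndist X x y < d \<longrightarrow> ndist Y (f x) (f y) < e) =
      (y \<in> pts X \<longrightarrow> nrm X (y - x) < d \<longrightarrow> nrm Y (f y - f x) < e)" for x y d e
    using nrm_minus_commute[OF X, of x y] nrm_minus_commute[OF Y, of "f x" "f y"]
    by (auto simp: ndist_def image_subset_iff)
  show ?thesis
    unfolding Metric_space.metric_continuous_map[OF Metric_space_ndist[OF X] Metric_space_ndist[OF Y]]
    using * by (simp add: Ball_def image_subset_iff_funcset cong: conj_cong)
qed

lemma continuous_map_top_of_set_ntop:
  fixes S :: "'b::metric_space set"
  assumes X: "complex_normed_space X"
  shows "continuous_map (top_of_set S) (ntop X) f \<longleftrightarrow> f \<in> S \<rightarrow> pts X \<and>
    (\<forall>z\<in>S. \<forall>\<epsilon>>0. \<exists>\<delta>>0. \<forall>w\<in>S. dist w z < \<delta> \<longrightarrow> nrm X (f w - f z) < \<epsilon>)"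
proof
  assume L: "continuous_map (top_of_set S) (ntop X) f"
  then have fS: "f \<in> S \<rightarrow> pts X"
    using continuous_map_funspace topspace_ntop[OF X] by fastforce
  have "\<exists>\<delta>>0. \<forall>w\<in>S. dist w z < \<delta> \<longrightarrow> nrm X (f w - f z) < \<epsilon>" if z: "z \<in> S" "\<epsilon> > 0" for z \<epsilon>
  proof -
    obtain U where U: "openin (top_of_set S) U" "z \<in> U" "\<forall>y\<in>U. f y \<in> nball X (f z) \<epsilon>"
      using L z unfolding Metric_space.continuous_map_to_metric[OF Metric_space_ndist[OF X]]
      by (metis topspace_euclidean_subtopology)
    then obtain \<delta> where "\<delta> > 0" "\<forall>w\<in>S. dist w z < \<delta> \<longrightarrow> w \<in> U"
      by (metis openin_euclidean_subtopology_iff)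
    then show ?thesis using U(3) by (auto simp: in_nball[OF X])
  qed
  with fS show "f \<in> S \<rightarrow> pts X \<and>
    (\<forall>z\<in>S. \<forall>\<epsilon>>0. \<exists>\<delta>>0. \<forall>w\<in>S. dist w z < \<delta> \<longrightarrow> nrm X (f w - f z) < \<epsilon>)" by blast
next
  assume R: "f \<in> S \<rightarrow> pts X \<and>
    (\<forall>z\<in>S. \<forall>\<epsilon>>0. \<exists>\<delta>>0. \<forall>w\<in>S. dist w z < \<delta> \<longrightarrow> nrm X (f w - f z) < \<epsilon>)"
  show "continuous_map (top_of_set S) (ntop X) f"
    unfolding Metric_space.continuous_map_to_metric[OF Metric_space_ndist[OF X]]
  proof (intro ballI allI impI)
    fix z and \<epsilon> :: real assume z: "z \<in> topspace (top_of_set S)" and e: "\<epsilon> > 0"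
    then obtain \<delta> where d: "\<delta> > 0" "\<forall>w\<in>S. dist w z < \<delta> \<longrightarrow> nrm X (f w - f z) < \<epsilon>"
      using R unfolding topspace_euclidean_subtopology by blast
    have "openin (top_of_set S) (S \<inter> ball z \<delta>)" by (intro openin_open_Int open_ball)
    moreover have "\<forall>y\<in>S \<inter> ball z \<delta>. f y \<in> nball X (f z) \<epsilon>"
      using d R z by (auto simp: in_nball[OF X] dist_commute Pi_iff)
    ultimately show "\<exists>U. openin (top_of_set S) U \<and> z \<in> U \<and> (\<forall>y\<in>U. f y \<in> nball X (f z) \<epsilon>)"
      using z d(1) by (intro exI[of _ "S \<inter> ball z \<delta>"]) auto
  qed
qed

lemma nrm_partial_sums_diff:
  assumes X: "complex_normed_space X" and u: "\<And>k. u k \<in> pts X"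
    and le: "\<And>k. nrm X (u k) \<le> C * (1/2) ^ k" and "n \<le> m"
  shows "nrm X (sum u {..<m} - sum u {..<n}) \<le> 2 * C * (1/2) ^ n"
proof -
  have C: "0 \<le> C" using le[of 0] nrm_nonneg[OF X u[of 0]] by simp
  have "sum u {..<m} - sum u {..<n} = sum u {n..<m}"
    using \<open>n \<le> m\<close> by (metis ivl_disj_un_one(2) lessThan_atLeast0 sum_diff_nat_ivl zero_le)
  then have "nrm X (sum u {..<m} - sum u {..<n}) \<le> (\<Sum>k=n..<m. nrm X (u k))"
    using nrm_sum[OF X, of "{n..<m}" u] u by simp
  also have "\<dots> \<le> (\<Sum>k=n..<m. C * (1/2) ^ k)" by (intro sum_mono le)
  also have "\<dots> = 2 * C * ((1/2) ^ n - (1/2) ^ m)"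
    using \<open>n \<le> m\<close> by (induction m rule: dec_induct) (auto simp: algebra_simps)
  also have "\<dots> \<le> 2 * C * (1/2) ^ n" using C by (simp add: algebra_simps)
  finally show ?thesis .
qed

lemma half_power_eventually_less:
  assumes "(0::real) < e"
  obtains N where "\<And>n. N \<le> n \<Longrightarrow> C * (1/2) ^ n < e"
proof -
  have "(\<lambda>n. C * (1/2::real) ^ n) \<longlonglongrightarrow> C * 0"
    by (intro tendsto_intros LIMSEQ_power_zero) simp
  then have "\<forall>\<^sub>F n in sequentially. C * (1/2) ^ n < e"
    using assms by (intro order_tendstoD) auto
  then show thesis using that by (auto simp: eventually_sequentially)
qed

lemma geometric_series_converges:
  assumes X: "complex_banach_space X" and u: "\<And>k. u k \<in> pts X"
    and le: "\<And>k. nrm X (u k) \<le> C * (1/2) ^ k"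
  obtains l where "l \<in> pts X" "\<And>n. nrm X (l - sum u {..<n}) \<le> 2 * C * (1/2) ^ n"
proof -
  have nX: "complex_normed_space X" using X by (rule banach_imp_normed)
  interpret Metric_space "pts X" "ndist X" by (rule Metric_space_ndist[OF nX])
  define S where "S n = sum u {..<n}" for n
  have S: "S n \<in> pts X" for n unfolding S_def by (rule nspace_sum[OF nX]) (use u in auto)
  note diff = nrm_partial_sums_diff[OF nX u le, folded S_def]
  have "MCauchy S"
    unfolding MCauchy_def
  proof (intro conjI allI impI)
    fix e :: real assume "0 < e"
    then obtain N where N: "\<And>n. N \<le> n \<Longrightarrow> 2 * C * (1/2) ^ n < e"
      using half_power_eventually_less by blast
    have *: "ndist X (S m) (S n) < e" if "N \<le> n" "n \<le> m" for n m
      using diff[OF that(2)] N[OF that(1)] S by (simp add: ndist_def)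
    then have "ndist X (S m) (S n) < e" if "N \<le> n" "N \<le> m" for n m
      using that commute[of "S n" "S m"] *[of m n] by (cases "n \<le> m") auto
    then show "\<exists>N. \<forall>n n'. N \<le> n \<longrightarrow> N \<le> n' \<longrightarrow> ndist X (S n) (S n') < e" by blast
  qed (use S in auto)
  then obtain l where l: "limitin (ntop X) S l sequentially"
    using X unfolding complex_banach_space_def mcomplete_def by blast
  then have lX: "l \<in> pts X" by (simp add: limitin_ntop[OF nX])
  have "nrm X (l - S n) \<le> 2 * C * (1/2) ^ n" for n
  proof (rule field_le_epsilon)
    fix e :: real assume "0 < e"
    then obtain N where N: "\<And>m. N \<le> m \<Longrightarrow> nrm X (S m - l) < e"
      using l unfolding limitin_ntop[OF nX] eventually_sequentially by blast
    have "nrm X (l - S n) \<le> nrm X (l - S (max N n)) + nrm X (S (max N n) - S n)"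
      by (intro nrm_diff_triangle nX S lX)
    also have "\<dots> \<le> e + 2 * C * (1/2) ^ n"
      using N[of "max N n"] diff[of n "max N n"] nrm_minus_commute[OF nX lX S[of "max N n"]] by simp
    finally show "nrm X (l - S n) \<le> 2 * C * (1/2) ^ n + e" by simp
  qed
  then show thesis using that lX by (simp add: S_def)
qed

section \<open>Quotient norms, sums of spaces and the K-functional\<close>

definition quotient_norm :: "'v set \<Rightarrow> ('v \<Rightarrow> 'a) \<Rightarrow> ('v \<Rightarrow> real) \<Rightarrow> 'a \<Rightarrow> real"
  where "quotient_norm V \<pi> N x = Inf {N a | a. a \<in> V \<and> \<pi> a = x}"

lemma quotient_norm_le:
  assumes "\<And>a. a \<in> V \<Longrightarrow> 0 \<le> N a" "a \<in> V" "\<pi> a = x"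
  shows "quotient_norm V \<pi> N x \<le> N a"
  unfolding quotient_norm_def using assms by (intro cInf_lower bdd_belowI[of _ 0]) auto

lemma quotient_norm_ge:
  assumes "x \<in> \<pi> ` V" "\<And>a. a \<in> V \<Longrightarrow> \<pi> a = x \<Longrightarrow> c \<le> N a"
  shows "c \<le> quotient_norm V \<pi> N x"
  unfolding quotient_norm_def using assms by (intro cInf_greatest) auto

lemma quotient_norm_less:
  assumes "x \<in> \<pi> ` V" "quotient_norm V \<pi> N x < c"
  obtains a where "a \<in> V" "\<pi> a = x" "N a < c"
  using cInf_lessD[of "{N a | a. a \<in> V \<and> \<pi> a = x}" c] assms by (auto simp: quotient_norm_def)

lemma seminorm_on_quotient:
  fixes \<pi> :: "'v \<Rightarrow> 'a::complex_vector"
  assumes ne: "V \<noteq> {}" and nonneg: "\<And>a. a \<in> V \<Longrightarrow> 0 \<le> N a"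
    and add: "\<And>a b. a \<in> V \<Longrightarrow> b \<in> V \<Longrightarrow> \<exists>c\<in>V. \<pi> c = \<pi> a + \<pi> b \<and> N c \<le> N a + N b"
    and scale: "\<And>t a. a \<in> V \<Longrightarrow> \<exists>b\<in>V. \<pi> b = t *\<^sub>C \<pi> a \<and> N b \<le> cmod t * N a"
  shows "seminorm_on (\<pi> ` V) (quotient_norm V \<pi> N)"
proof -
  let ?q = "quotient_norm V \<pi> N"
  note le = quotient_norm_le[of V N, OF nonneg]
  have sub: "cvec.subspace (\<pi> ` V)"
  proof (rule cvec.subspaceI)
    obtain a where a: "a \<in> V" using ne by auto
    then obtain b where "b \<in> V" "\<pi> b = 0 *\<^sub>C \<pi> a" using scale by blast
    then show "0 \<in> \<pi> ` V" by force
  next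
    fix x y assume "x \<in> \<pi> ` V" "y \<in> \<pi> ` V"
    then obtain a b where "a \<in> V" "b \<in> V" "x = \<pi> a" "y = \<pi> b" by blast
    then show "x + y \<in> \<pi> ` V" using add[of a b] by (metis imageI)
  next
    fix c x assume "x \<in> \<pi> ` V"
    then obtain a where "a \<in> V" "x = \<pi> a" by blast
    then show "c *\<^sub>C x \<in> \<pi> ` V" using scale[of a c] by (metis imageI)
  qed
  have q0: "0 \<le> ?q x" if "x \<in> \<pi> ` V" for x
    using that nonneg by (intro quotient_norm_ge) auto
  have qadd: "?q (x + y) \<le> ?q x + ?q y" if "x \<in> \<pi> ` V" "y \<in> \<pi> ` V" for x y
  proof -
    have *: "?q (x + y) \<le> N a + N b" if ab: "a \<in> V" "\<pi> a = x" "b \<in> V" "\<pi> b = y" for a b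
    proof -
      obtain c where "c \<in> V" "\<pi> c = \<pi> a + \<pi> b" "N c \<le> N a + N b" using add ab by blast
      then show ?thesis using le[of c \<pi> "x + y"] ab by simp
    qed
    have "?q (x + y) - N a \<le> ?q y" if "a \<in> V" "\<pi> a = x" for a
      using *[OF that] \<open>y \<in> \<pi> ` V\<close> by (intro quotient_norm_ge) (auto simp: diff_le_eq add.commute)
    then have "?q (x + y) - ?q y \<le> ?q x"
      using \<open>x \<in> \<pi> ` V\<close> by (intro quotient_norm_ge) (auto simp: diff_le_eq add.commute)
    then show ?thesis by simp
  qed
  have qs: "?q (c *\<^sub>C x) \<le> cmod c * ?q x" if x: "x \<in> \<pi> ` V" for c x
  proof -
    have *: "?q (c *\<^sub>C x) \<le> cmod c * N a" if a: "a \<in> V" "\<pi> a = x" for a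
    proof -
      obtain b where "b \<in> V" "\<pi> b = c *\<^sub>C \<pi> a" "N b \<le> cmod c * N a" using scale a by blast
      then show ?thesis using le[of b \<pi> "c *\<^sub>C x"] a by simp
    qed
    show ?thesis
    proof (cases "c = 0")
      case True
      then show ?thesis using * x by auto
    next
      case False
      then have "?q (c *\<^sub>C x) / cmod c \<le> ?q x"
        using x * by (intro quotient_norm_ge) (auto simp: divide_le_eq mult.commute)
      then show ?thesis using False by (simp add: divide_le_eq mult.commute)
    qed
  qed
  have qs': "?q (c *\<^sub>C x) = cmod c * ?q x" if x: "x \<in> \<pi> ` V" for c x
  proof (cases "c = 0")
    case True
    then show ?thesis using qs[OF x, of 0] q0[OF cvec.subspace_0[OF sub]] by simp
  next
    case False
    have cx: "c *\<^sub>C x \<in> \<pi> ` V" using sub x by (rule cvec.subspace_scale)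
    have "?q (inverse c *\<^sub>C c *\<^sub>C x) \<le> cmod (inverse c) * ?q (c *\<^sub>C x)"
      by (rule qs[OF cx])
    then have "cmod c * ?q x \<le> ?q (c *\<^sub>C x)"
      using False by (simp add: scaleC_scaleC scaleC_one norm_divide field_simps)
    with qs[OF x, of c] show ?thesis by simp
  qed
  show ?thesis unfolding seminorm_on_def using sub q0 qadd qs' by blast
qed

text \<open>
  Both the sum of a couple and the interpolation spaces are quotients of a complete space, and their
  completeness has the same reason: a Cauchy sequence is thinned until consecutive differences are
  below \<open>2 ^ (-k)\<close>, the differences are lifted to elements of the same size, and the lifts are
  summed upstairs. Hence only series with geometrically small terms have to converge in \<open>V\<close>.
\<close>
lemma complex_banach_space_quotient:
  fixes \<pi> :: "'v \<Rightarrow> 'a::complex_vector"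
  assumes sem: "seminorm_on (\<pi> ` V) (quotient_norm V \<pi> N)"
    and N_nonneg: "\<And>a. a \<in> V \<Longrightarrow> 0 \<le> N a"
    and definite: "\<And>x. (\<And>\<epsilon>. 0 < \<epsilon> \<Longrightarrow> \<exists>a\<in>V. \<pi> a = x \<and> N a < \<epsilon>) \<Longrightarrow> x = 0"
    and complete: "\<And>a. (\<And>k. a k \<in> V) \<Longrightarrow> (\<And>k. N (a k) \<le> (1/2) ^ k) \<Longrightarrow>
      \<exists>s\<in>V. \<exists>C. \<forall>n. \<exists>b\<in>V. \<pi> b = \<pi> s - (\<Sum>k<n. \<pi> (a k)) \<and> N b \<le> C * (1/2) ^ n"
  shows "complex_banach_space \<lparr>pts = \<pi> ` V, nrm = quotient_norm V \<pi> N\<rparr>"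
    (is "complex_banach_space ?Q")
proof -
  have "x = 0" if "x \<in> \<pi> ` V" "quotient_norm V \<pi> N x = 0" for x
    using that quotient_norm_less[of x \<pi> V N] by (intro definite) metis
  with sem have nQ: "complex_normed_space ?Q"
    by (simp add: complex_normed_space_iff_seminorm_on)
  interpret Metric_space "pts ?Q" "ndist ?Q" by (rule Metric_space_ndist[OF nQ])
  have "\<exists>x. limitin mtopology \<sigma> x sequentially" if \<sigma>: "MCauchy \<sigma>" for \<sigma>
  proof -
    have \<sigma>Q: "\<sigma> n \<in> pts ?Q" for n using \<sigma> unfolding MCauchy_def by blast
    have "\<forall>k. \<exists>M. \<forall>n n'. M \<le> n \<longrightarrow> M \<le> n' \<longrightarrow> ndist ?Q (\<sigma> n) (\<sigma> n') < (1/2) ^ k"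
      using \<sigma> unfolding MCauchy_def by simp
    then obtain M where M: "\<And>k n n'. M k \<le> n \<Longrightarrow> M k \<le> n' \<Longrightarrow> ndist ?Q (\<sigma> n) (\<sigma> n') < (1/2) ^ k"
      by metis
    \<comment> \<open>the summand \<open>k\<close> makes \<open>r\<close> strictly increasing, the sum makes it dominate \<open>M\<close>\<close>
    define r where "r k = (\<Sum>j\<le>k. M j) + k" for k
    have rS: "r k < r (Suc k)" and rM: "M k \<le> r k" for k
      by (auto simp: r_def intro: trans_le_add1 member_le_sum)
    then have r: "strict_mono r" by (simp add: strict_mono_Suc_iff)
    have "\<exists>a\<in>V. \<pi> a = \<sigma> (r (Suc k)) - \<sigma> (r k) \<and> N a < (1/2) ^ k" for k
    proof -
      have "ndist ?Q (\<sigma> (r (Suc k))) (\<sigma> (r k)) < (1/2) ^ k"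
        using rM[of k] rS[of k] by (intro M) auto
      then have "quotient_norm V \<pi> N (\<sigma> (r (Suc k)) - \<sigma> (r k)) < (1/2) ^ k"
        using \<sigma>Q[of "r k"] \<sigma>Q[of "r (Suc k)"] by (simp add: ndist_def)
      moreover have "\<sigma> (r (Suc k)) - \<sigma> (r k) \<in> \<pi> ` V"
        using nspace_diff[OF nQ \<sigma>Q \<sigma>Q] by simp
      ultimately show ?thesis using quotient_norm_less by metis
    qed
    then obtain a where a: "\<And>k. a k \<in> V" "\<And>k. \<pi> (a k) = \<sigma> (r (Suc k)) - \<sigma> (r k)"
        "\<And>k. N (a k) < (1/2) ^ k" by metis
    then obtain s C where s: "s \<in> V"
        "\<And>n. \<exists>b\<in>V. \<pi> b = \<pi> s - (\<Sum>k<n. \<pi> (a k)) \<and> N b \<le> C * (1/2) ^ n"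
      using complete[of a] by (meson less_imp_le)
    define l where "l = \<sigma> (r 0) + \<pi> s"
    have lQ: "l \<in> pts ?Q" unfolding l_def using s(1) by (intro nspace_add[OF nQ] \<sigma>Q) simp
    have "ndist ?Q (\<sigma> (r n)) l \<le> C * (1/2) ^ n" for n
    proof -
      obtain b where b: "b \<in> V" "\<pi> b = \<pi> s - (\<Sum>k<n. \<pi> (a k))" "N b \<le> C * (1/2) ^ n"
        using s(2) by blast
      have "(\<Sum>k<n. \<pi> (a k)) = \<sigma> (r n) - \<sigma> (r 0)"
        unfolding a(2) by (rule sum_lessThan_telescope)
      then have "l - \<sigma> (r n) = \<pi> b" by (simp add: l_def b(2))
      then have "nrm ?Q (l - \<sigma> (r n)) \<le> C * (1/2) ^ n"
        using quotient_norm_le[of V N b \<pi>, OF N_nonneg b(1) refl] b(3) by simp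
      then show ?thesis
        using nrm_minus_commute[OF nQ lQ \<sigma>Q[of "r n"]] lQ \<sigma>Q[of "r n"] by (simp add: ndist_def)
    qed
    then have "limitin mtopology (\<sigma> \<circ> r) l sequentially"
      unfolding limit_metric_sequentially
      using lQ \<sigma>Q by (metis comp_apply half_power_eventually_less order_le_less_trans)
    then show ?thesis using MCauchy_convergent_subsequence[OF \<sigma> r] by blast
  qed
  then have mcomplete unfolding mcomplete_def by blast
  with nQ show ?thesis by (simp add: complex_banach_space_def)
qed

text \<open>
  This is Peetre's K-functional with separate weights for the two summands; the weights 1 and 1 give
  the norm of the sum.
\<close>
definition K_functional ::
    "real \<Rightarrow> real \<Rightarrow> ('a::complex_vector) nspace \<Rightarrow> 'a nspace \<Rightarrow> 'a \<Rightarrow> real"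
  where "K_functional a b X0 X1 =
    quotient_norm (pts X0 \<times> pts X1) (\<lambda>(u, v). u + v) (\<lambda>(u, v). a * nrm X0 u + b * nrm X1 v)"

lemma pts_sum_space: "pts (sum_space X0 X1) = (\<lambda>(u, v). u + v) ` (pts X0 \<times> pts X1)"
  by (auto simp: sum_space_def)

lemma sum_space_eq:
  "sum_space X0 X1 = \<lparr>pts = (\<lambda>(u, v). u + v) ` (pts X0 \<times> pts X1), nrm = K_functional 1 1 X0 X1\<rparr>"
proof -
  have "{nrm X0 u + nrm X1 v | u v. u \<in> pts X0 \<and> v \<in> pts X1 \<and> x = u + v} =
      {(case a of (u, v) \<Rightarrow> 1 * nrm X0 u + 1 * nrm X1 v) | a.
        a \<in> pts X0 \<times> pts X1 \<and> (case a of (u, v) \<Rightarrow> u + v) = x}" for x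
    by auto
  then show ?thesis
    unfolding sum_space_def K_functional_def quotient_norm_def by (auto simp: fun_eq_iff)
qed

lemma nrm_sum_space: "nrm (sum_space X0 X1) = K_functional 1 1 X0 X1"
  by (simp add: sum_space_eq)

lemma K_functional_less:
  assumes "x \<in> pts (sum_space X0 X1)" "K_functional a b X0 X1 x < c"
  obtains u v where "u \<in> pts X0" "v \<in> pts X1" "x = u + v" "a * nrm X0 u + b * nrm X1 v < c"
proof -
  obtain p where "p \<in> pts X0 \<times> pts X1" "(\<lambda>(u, v). u + v) p = x"
      "(\<lambda>(u, v). a * nrm X0 u + b * nrm X1 v) p < c"
    by (rule quotient_norm_less[OF assms(1)[unfolded pts_sum_space] assms(2)[unfolded K_functional_def]])
  then show thesis using that[of "fst p" "snd p"] by auto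
qed

context
  fixes X0 X1 :: "('a::complex_vector) nspace"
  assumes X0: "complex_normed_space X0" and X1: "complex_normed_space X1"
begin

lemma K_functional_le:
  assumes "0 \<le> a" "0 \<le> b" "u \<in> pts X0" "v \<in> pts X1"
  shows "K_functional a b X0 X1 (u + v) \<le> a * nrm X0 u + b * nrm X1 v"
  unfolding K_functional_def
  using quotient_norm_le[of "pts X0 \<times> pts X1" "\<lambda>(u, v). a * nrm X0 u + b * nrm X1 v" "(u, v)"
      "\<lambda>(u, v). u + v" "u + v"] assms
  by (auto simp: nrm_nonneg[OF X0] nrm_nonneg[OF X1])

lemma seminorm_on_K_functional:
  assumes "0 \<le> a" "0 \<le> b"
  shows "seminorm_on (pts (sum_space X0 X1)) (K_functional a b X0 X1)"
  unfolding pts_sum_space K_functional_def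
proof (rule seminorm_on_quotient)
  let ?\<pi> = "\<lambda>(u, v). u + v :: 'a" and ?V = "pts X0 \<times> pts X1"
    and ?N = "\<lambda>(u, v). a * nrm X0 u + b * nrm X1 v"
  show "?V \<noteq> {}" using nspace_zero[OF X0] nspace_zero[OF X1] by auto
  show "0 \<le> ?N p" if "p \<in> ?V" for p
    using that assms by (auto simp: nrm_nonneg[OF X0] nrm_nonneg[OF X1])
  fix p q :: "'a \<times> 'a" and t :: complex
  assume p: "p \<in> ?V"
  {
    assume q: "q \<in> ?V"
    have "a * nrm X0 (fst p + fst q) \<le> a * (nrm X0 (fst p) + nrm X0 (fst q))"
      "b * nrm X1 (snd p + snd q) \<le> b * (nrm X1 (snd p) + nrm X1 (snd q))"
      using p q assms by (auto intro!: mult_left_mono nrm_add[OF X0] nrm_add[OF X1])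
    then show "\<exists>c\<in>?V. ?\<pi> c = ?\<pi> p + ?\<pi> q \<and> ?N c \<le> ?N p + ?N q"
      using p q by (intro bexI[of _ "(fst p + fst q, snd p + snd q)"])
        (auto simp: algebra_simps nspace_add[OF X0] nspace_add[OF X1])
  }
  show "\<exists>c\<in>?V. ?\<pi> c = t *\<^sub>C ?\<pi> p \<and> ?N c \<le> cmod t * ?N p"
    using p by (intro bexI[of _ "(t *\<^sub>C fst p, t *\<^sub>C snd p)"])
      (auto simp: algebra_simps scaleC_add_right nspace_scale[OF X0] nspace_scale[OF X1]
        nrm_scale[OF X0] nrm_scale[OF X1])
qed

lemma sum_space_add_mem: "u \<in> pts X0 \<Longrightarrow> v \<in> pts X1 \<Longrightarrow> u + v \<in> pts (sum_space X0 X1)"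
  by (auto simp: pts_sum_space)

lemma pts_subset_sum_space: "pts X0 \<subseteq> pts (sum_space X0 X1)" "pts X1 \<subseteq> pts (sum_space X0 X1)"
  using sum_space_add_mem[OF _ nspace_zero[OF X1]] sum_space_add_mem[OF nspace_zero[OF X0]]
  by (metis add.right_neutral subsetI, metis add.left_neutral subsetI)

lemma nrm_sum_space_le:
  "u \<in> pts X0 \<Longrightarrow> nrm (sum_space X0 X1) u \<le> nrm X0 u"
  "v \<in> pts X1 \<Longrightarrow> nrm (sum_space X0 X1) v \<le> nrm X1 v"
  using K_functional_le[of 1 1 u 0] K_functional_le[of 1 1 0 v]
  by (simp_all add: nrm_sum_space nspace_zero[OF X0] nspace_zero[OF X1] nrm_zero[OF X0] nrm_zero[OF X1])

end

text \<open>
  Definiteness is where the ambient topological vector space enters: if \<open>x = u n + v n\<close> with both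
  summands tending to 0 in norm, they tend to 0 in the ambient topology, so the constant sequence
  \<open>x\<close> converges to 0 there, and limits are unique.
\<close>
lemma complex_banach_space_sum_space:
  assumes "compatible_couple X0 X1"
  shows "complex_banach_space (sum_space X0 X1)"
  unfolding sum_space_eq K_functional_def
proof (rule complex_banach_space_quotient)
  let ?\<pi> = "\<lambda>(u, v). u + v :: 'a" and ?V = "pts X0 \<times> pts X1"
    and ?N = "\<lambda>(u, v). 1 * nrm X0 u + 1 * nrm X1 v"
  have b0: "complex_banach_space X0" and b1: "complex_banach_space X1"
    using assms by (auto simp: compatible_couple_def)
  note X0 = b0[THEN banach_imp_normed] and X1 = b1[THEN banach_imp_normed]
  note nonneg = nrm_nonneg[OF X0] nrm_nonneg[OF X1]
  show "seminorm_on (?\<pi> ` ?V) (quotient_norm ?V ?\<pi> ?N)"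
    using seminorm_on_K_functional[OF X0 X1, of 1 1] by (simp add: pts_sum_space K_functional_def)
  show "0 \<le> ?N p" if "p \<in> ?V" for p
    using that by (auto simp: nonneg)
  show "x = 0" if small: "\<And>\<epsilon>. 0 < \<epsilon> \<Longrightarrow> \<exists>p\<in>?V. ?\<pi> p = x \<and> ?N p < \<epsilon>" for x
  proof -
    obtain T where T: "complex_tvs T" "Hausdorff_space T"
        and c0: "continuous_map (ntop X0) T (\<lambda>x. x)" and c1: "continuous_map (ntop X1) T (\<lambda>x. x)"
      using assms by (auto simp: compatible_couple_def)
    have "\<forall>n. \<exists>p\<in>?V. ?\<pi> p = x \<and> ?N p < inverse (real (Suc n))"
      by (intro allI small) simp
    then obtain p where p: "\<And>n. p n \<in> ?V" "\<And>n. ?\<pi> (p n) = x"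
        "\<And>n. ?N (p n) < inverse (real (Suc n))" by metis
    define u v where "u = (\<lambda>n. fst (p n))" and "v = (\<lambda>n. snd (p n))"
    have uv: "u n \<in> pts X0" "v n \<in> pts X1" "u n + v n = x"
        "nrm X0 (u n) + nrm X1 (v n) < inverse (real (Suc n))" for n
      using p[of n] by (auto simp: u_def v_def split_beta)
    have ev: "\<forall>\<^sub>F n in sequentially. inverse (real (Suc n)) < \<epsilon>" if "0 < \<epsilon>" for \<epsilon>
      using LIMSEQ_inverse_real_of_nat that by (rule order_tendstoD)
    have "nrm X0 (u n) < inverse (real (Suc n))" "nrm X1 (v n) < inverse (real (Suc n))" for n
      using uv(4)[of n] nonneg(1)[OF uv(1)[of n]] nonneg(2)[OF uv(2)[of n]] by auto
    then have "limitin (ntop X0) u 0 sequentially" "limitin (ntop X1) v 0 sequentially"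
      using uv(1,2) by (auto simp: limitin_ntop X0 X1 nspace_zero simp del: of_nat_Suc
          intro: eventually_mono[OF ev] less_trans)
    then have "limitin T u 0 sequentially" "limitin T v 0 sequentially"
      using continuous_map_limit[OF c0, of u] continuous_map_limit[OF c1, of v] by (simp_all add: comp_def)
    then have "limitin (prod_topology T T) (\<lambda>n. (u n, v n)) (0, 0) sequentially"
      by (simp add: limitin_pairwise comp_def)
    then have "limitin T ((\<lambda>(x, y). x + y) \<circ> (\<lambda>n. (u n, v n))) ((\<lambda>(x, y). x + y) (0, 0)) sequentially"
      using T(1) unfolding complex_tvs_def by (blast intro: continuous_map_limit)
    then have l0: "limitin T (\<lambda>n. x) 0 sequentially" by (simp add: comp_def uv(3))
    have "u 0 \<in> topspace T" "v 0 \<in> topspace T"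
      using continuous_map_funspace[OF c0] continuous_map_funspace[OF c1] uv(1,2)[of 0]
      by (auto simp: topspace_ntop X0 X1)
    then have "u 0 + v 0 \<in> topspace T"
      using T(1) by (auto simp: complex_tvs_def intro: cvec.subspace_add)
    then have "limitin T (\<lambda>n. x) x sequentially" by (simp add: uv(3))
    then show "x = 0" using limitin_Hausdorff_unique[OF _ l0 _ T(2)] by simp
  qed
  show "\<exists>s\<in>?V. \<exists>C. \<forall>n. \<exists>b\<in>?V. ?\<pi> b = ?\<pi> s - (\<Sum>k<n. ?\<pi> (p k)) \<and> ?N b \<le> C * (1/2) ^ n"
    if p: "\<And>k. p k \<in> ?V" "\<And>k. ?N (p k) \<le> (1/2) ^ k" for p
  proof -
    define u v where "u = (\<lambda>n. fst (p n))" and "v = (\<lambda>n. snd (p n))"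
    have uv: "u n \<in> pts X0" "v n \<in> pts X1" "nrm X0 (u n) + nrm X1 (v n) \<le> (1/2) ^ n" for n
      using p(1,2)[of n] by (auto simp: u_def v_def split_beta)
    have le: "nrm X0 (u n) \<le> 1 * (1/2) ^ n" "nrm X1 (v n) \<le> 1 * (1/2) ^ n" for n
      using uv(3)[of n] nonneg(1)[OF uv(1)[of n]] nonneg(2)[OF uv(2)[of n]] by auto
    obtain l0 where l0: "l0 \<in> pts X0" "\<And>n. nrm X0 (l0 - sum u {..<n}) \<le> 2 * 1 * (1/2) ^ n"
      by (rule geometric_series_converges[OF b0 uv(1) le(1)]) (rule that; assumption)
    obtain l1 where l1: "l1 \<in> pts X1" "\<And>n. nrm X1 (l1 - sum v {..<n}) \<le> 2 * 1 * (1/2) ^ n"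
      by (rule geometric_series_converges[OF b1 uv(2) le(2)]) (rule that; assumption)
    note l = l0 l1
    have "\<exists>b\<in>?V. ?\<pi> b = ?\<pi> (l0, l1) - (\<Sum>k<n. ?\<pi> (p k)) \<and> ?N b \<le> 4 * (1/2) ^ n" for n
    proof (intro bexI[of _ "(l0 - sum u {..<n}, l1 - sum v {..<n})"] conjI)
      have "(\<Sum>k<n. ?\<pi> (p k)) = sum u {..<n} + sum v {..<n}"
        by (simp add: u_def v_def split_beta sum.distrib)
      then show "?\<pi> (l0 - sum u {..<n}, l1 - sum v {..<n}) = ?\<pi> (l0, l1) - (\<Sum>k<n. ?\<pi> (p k))"
        by simp
      show "?N (l0 - sum u {..<n}, l1 - sum v {..<n}) \<le> 4 * (1/2) ^ n"
        using l(2,4)[of n] by simp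
      show "(l0 - sum u {..<n}, l1 - sum v {..<n}) \<in> ?V"
        using l(1,3) uv by (auto intro!: nspace_diff nspace_sum X0 X1)
    qed
    then show ?thesis using l(1,3) by (intro bexI[of _ "(l0, l1)"] exI[of _ 4]) auto
  qed
qed

section \<open>Holomorphic functions with values in a normed space\<close>

lemma limitin_ntop_add:
  assumes X: "complex_normed_space X" and "limitin (ntop X) f l F" "limitin (ntop X) g m F"
  shows "limitin (ntop X) (\<lambda>w. f w + g w) (l + m) F"
  unfolding limitin_ntop[OF X]
proof (intro conjI allI impI)
  have lm: "l \<in> pts X" "m \<in> pts X" using assms by (auto simp: limitin_ntop[OF X])
  then show "l + m \<in> pts X" by (rule nspace_add[OF X])
  fix \<epsilon> :: real assume "0 < \<epsilon>"
  then have "\<forall>\<^sub>F w in F. f w \<in> pts X \<and> nrm X (f w - l) < \<epsilon> / 2"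
    "\<forall>\<^sub>F w in F. g w \<in> pts X \<and> nrm X (g w - m) < \<epsilon> / 2"
    using assms(2,3) unfolding limitin_ntop[OF X] by (auto dest: half_gt_zero)
  then show "\<forall>\<^sub>F w in F. f w + g w \<in> pts X \<and> nrm X (f w + g w - (l + m)) < \<epsilon>"
  proof eventually_elim
    case (elim w)
    have "nrm X ((f w - l) + (g w - m)) \<le> nrm X (f w - l) + nrm X (g w - m)"
      using elim lm by (intro nrm_add[OF X] nspace_diff[OF X]) auto
    then show ?case using elim nspace_add[OF X] by (auto simp: algebra_simps)
  qed
qed

lemma limitin_ntop_scale:
  assumes X: "complex_normed_space X" and f: "limitin (ntop X) f l F"
  shows "limitin (ntop X) (\<lambda>w. c *\<^sub>C f w) (c *\<^sub>C l) F"
  unfolding limitin_ntop[OF X]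
proof (intro conjI allI impI)
  have l: "l \<in> pts X" using f by (auto simp: limitin_ntop[OF X])
  then show "c *\<^sub>C l \<in> pts X" by (rule nspace_scale[OF X])
  fix \<epsilon> :: real assume e: "0 < \<epsilon>"
  then have "0 < \<epsilon> / (cmod c + 1)" by (simp add: add_nonneg_pos)
  then have "\<forall>\<^sub>F w in F. f w \<in> pts X \<and> nrm X (f w - l) < \<epsilon> / (cmod c + 1)"
    using f unfolding limitin_ntop[OF X] by auto
  then show "\<forall>\<^sub>F w in F. c *\<^sub>C f w \<in> pts X \<and> nrm X (c *\<^sub>C f w - c *\<^sub>C l) < \<epsilon>"
  proof eventually_elim
    case (elim w)
    have "nrm X (c *\<^sub>C f w - c *\<^sub>C l) = cmod c * nrm X (f w - l)"
      using nrm_scale[OF X nspace_diff[OF X _ l], of "f w" c] elim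
      by (simp add: cvec.scale_right_diff_distrib)
    also have "\<dots> \<le> cmod c * (\<epsilon> / (cmod c + 1))"
      using elim by (intro mult_left_mono) auto
    also have "\<dots> < \<epsilon>"
      using e by (simp add: pos_divide_less_eq add_nonneg_pos distrib_left mult.commute)
    finally show ?case using elim nspace_scale[OF X] by auto
  qed
qed

lemma limitin_ntop_sum:
  assumes X: "complex_normed_space X" and "\<And>i. i \<in> I \<Longrightarrow> limitin (ntop X) (f i) (l i) F"
  shows "limitin (ntop X) (\<lambda>w. \<Sum>i\<in>I. f i w) (\<Sum>i\<in>I. l i) F"
  using assms(2)
  by (induction I rule: infinite_finite_induct)
    (auto simp: topspace_ntop[OF X] nspace_zero[OF X] intro!: limitin_ntop_add[OF X])

lemma continuous_map_ntop_iff_limitin: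
  fixes S :: "'b::metric_space set"
  assumes X: "complex_normed_space X"
  shows "continuous_map (top_of_set S) (ntop X) f \<longleftrightarrow>
    (\<forall>z\<in>S. f z \<in> pts X \<and> limitin (ntop X) f (f z) (at z within S))"
proof -
  have "(\<forall>\<epsilon>>0. \<exists>\<delta>>0. \<forall>w\<in>S. dist w z < \<delta> \<longrightarrow> nrm X (f w - f z) < \<epsilon>) \<longleftrightarrow>
      limitin (ntop X) f (f z) (at z within S)" if "f \<in> S \<rightarrow> pts X" "z \<in> S" for z
  proof -
    have "nrm X (f z - f z) = 0" using nrm_zero[OF X] by simp
    then have "0 < \<epsilon> \<Longrightarrow> (\<exists>\<delta>>0. \<forall>w\<in>S. dist w z < \<delta> \<longrightarrow> nrm X (f w - f z) < \<epsilon>) \<longleftrightarrow>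
      (\<forall>\<^sub>F w in at z within S. f w \<in> pts X \<and> nrm X (f w - f z) < \<epsilon>)" for \<epsilon>
      using that unfolding eventually_at by (metis Pi_iff)
    then show ?thesis using that by (auto simp: limitin_ntop[OF X])
  qed
  then show ?thesis
    unfolding continuous_map_top_of_set_ntop[OF X] by (auto simp: Pi_iff)
qed

lemma continuous_map_ntop_add:
  fixes S :: "'b::metric_space set"
  assumes X: "complex_normed_space X" and "continuous_map (top_of_set S) (ntop X) f"
    "continuous_map (top_of_set S) (ntop X) g"
  shows "continuous_map (top_of_set S) (ntop X) (\<lambda>z. f z + g z)"
  using assms(2,3) unfolding continuous_map_ntop_iff_limitin[OF X]
  by (auto intro: limitin_ntop_add[OF X] nspace_add[OF X])

lemma continuous_map_ntop_scale:
  fixes S :: "'b::metric_space set"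
  assumes X: "complex_normed_space X" and "continuous_map (top_of_set S) (ntop X) f"
  shows "continuous_map (top_of_set S) (ntop X) (\<lambda>z. c *\<^sub>C f z)"
  using assms(2) unfolding continuous_map_ntop_iff_limitin[OF X]
  by (auto intro: limitin_ntop_scale[OF X] nspace_scale[OF X])

lemma nspace_holomorphic_on_add:
  assumes X: "complex_normed_space X" and "nspace_holomorphic_on X f S" "nspace_holomorphic_on X g S"
  shows "nspace_holomorphic_on X (\<lambda>z. f z + g z) S"
  unfolding nspace_holomorphic_on_def
proof
  fix z assume "z \<in> S"
  then obtain l m where "limitin (ntop X) (\<lambda>w. inverse (w - z) *\<^sub>C (f w - f z)) l (at z within S)"
      "limitin (ntop X) (\<lambda>w. inverse (w - z) *\<^sub>C (g w - g z)) m (at z within S)"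
    using assms(2,3) unfolding nspace_holomorphic_on_def by blast
  then have "limitin (ntop X) (\<lambda>w. inverse (w - z) *\<^sub>C (f w - f z) + inverse (w - z) *\<^sub>C (g w - g z))
      (l + m) (at z within S)" by (rule limitin_ntop_add[OF X])
  moreover have "inverse (w - z) *\<^sub>C (f w - f z) + inverse (w - z) *\<^sub>C (g w - g z) =
      inverse (w - z) *\<^sub>C (f w + g w - (f z + g z))" for w
    unfolding scaleC_add_right[symmetric] by (simp add: algebra_simps)
  ultimately show "\<exists>l. limitin (ntop X) (\<lambda>w. inverse (w - z) *\<^sub>C (f w + g w - (f z + g z))) l (at z within S)"
    by auto
qed

lemma nspace_holomorphic_on_scale:
  assumes X: "complex_normed_space X" and "nspace_holomorphic_on X f S"
  shows "nspace_holomorphic_on X (\<lambda>z. c *\<^sub>C f z) S"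
  unfolding nspace_holomorphic_on_def
proof
  fix z assume "z \<in> S"
  then obtain l where "limitin (ntop X) (\<lambda>w. inverse (w - z) *\<^sub>C (f w - f z)) l (at z within S)"
    using assms(2) unfolding nspace_holomorphic_on_def by blast
  then have "limitin (ntop X) (\<lambda>w. c *\<^sub>C inverse (w - z) *\<^sub>C (f w - f z)) (c *\<^sub>C l) (at z within S)"
    by (rule limitin_ntop_scale[OF X])
  moreover have "c *\<^sub>C inverse (w - z) *\<^sub>C (f w - f z) =
      inverse (w - z) *\<^sub>C (c *\<^sub>C f w - c *\<^sub>C f z)" for w
    by (simp add: cvec.scale_right_diff_distrib mult.commute)
  ultimately show "\<exists>l. limitin (ntop X) (\<lambda>w. inverse (w - z) *\<^sub>C (c *\<^sub>C f w - c *\<^sub>C f z)) l (at z within S)"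
    by auto
qed

lemma linear_functional_on_diff:
  assumes V: "cvec.subspace V" and f: "linear_functional_on V f" and "x \<in> V" "y \<in> V"
  shows "f (x - y) = f x - f y"
proof -
  have "f (x + (- 1) *\<^sub>C y) = f x + f ((- 1) *\<^sub>C y)" "f ((- 1) *\<^sub>C y) = - 1 * f y"
    using assms cvec.subspace_scale[OF V, of y "- 1"] unfolding linear_functional_on_def by blast+
  then show ?thesis by simp
qed

lemma tendsto_linear_functional:
  assumes X: "complex_normed_space X" and f: "linear_functional_on (pts X) f"
    and bound: "\<And>x. x \<in> pts X \<Longrightarrow> cmod (f x) \<le> C * nrm X x"
    and g: "limitin (ntop X) g l F"
  shows "((\<lambda>w. f (g w)) \<longlongrightarrow> f l) F"
proof (rule tendstoI)
  fix \<epsilon> :: real assume e: "0 < \<epsilon>"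
  have l: "l \<in> pts X" using g by (simp add: limitin_ntop[OF X])
  have "0 < \<epsilon> / (\<bar>C\<bar> + 1)" using e by (simp add: add_nonneg_pos)
  then have "\<forall>\<^sub>F w in F. g w \<in> pts X \<and> nrm X (g w - l) < \<epsilon> / (\<bar>C\<bar> + 1)"
    using g unfolding limitin_ntop[OF X] by auto
  then show "\<forall>\<^sub>F w in F. dist (f (g w)) (f l) < \<epsilon>"
  proof eventually_elim
    case (elim w)
    have d: "g w - l \<in> pts X" using elim l nspace_diff[OF X] by blast
    have "dist (f (g w)) (f l) = cmod (f (g w - l))"
      using linear_functional_on_diff[OF nspace_subspace[OF X] f, of "g w" l] elim l
      by (simp add: dist_norm)
    also have "\<dots> \<le> C * nrm X (g w - l)" using d by (rule bound)
    also have "\<dots> \<le> \<bar>C\<bar> * (\<epsilon> / (\<bar>C\<bar> + 1))"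
      using elim nrm_nonneg[OF X d] by (intro mult_mono) auto
    also have "\<dots> < \<epsilon>" using e by (simp add: field_simps add_nonneg_pos)
    finally show ?case .
  qed
qed

lemma continuous_on_linear_functional:
  fixes S :: "'b::metric_space set"
  assumes X: "complex_normed_space X" and f: "linear_functional_on (pts X) f"
    and bound: "\<And>x. x \<in> pts X \<Longrightarrow> cmod (f x) \<le> C * nrm X x"
    and \<phi>: "continuous_map (top_of_set S) (ntop X) \<phi>"
  shows "continuous_on S (\<lambda>z. f (\<phi> z))"
  unfolding continuous_on_def
proof
  fix z assume "z \<in> S"
  then have "limitin (ntop X) \<phi> (\<phi> z) (at z within S)"
    using \<phi> unfolding continuous_map_ntop_iff_limitin[OF X] by blast
  then show "((\<lambda>w. f (\<phi> w)) \<longlongrightarrow> f (\<phi> z)) (at z within S)"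
    by (intro tendsto_linear_functional[OF X f, of C] bound)
qed

lemma holomorphic_on_linear_functional:
  assumes X: "complex_normed_space X" and f: "linear_functional_on (pts X) f"
    and bound: "\<And>x. x \<in> pts X \<Longrightarrow> cmod (f x) \<le> C * nrm X x"
    and \<phi>: "nspace_holomorphic_on X \<phi> S" "\<And>z. z \<in> S \<Longrightarrow> \<phi> z \<in> pts X"
  shows "(\<lambda>z. f (\<phi> z)) holomorphic_on S"
  unfolding holomorphic_on_def field_differentiable_def
proof
  fix z assume z: "z \<in> S"
  then obtain l where "limitin (ntop X) (\<lambda>w. inverse (w - z) *\<^sub>C (\<phi> w - \<phi> z)) l (at z within S)"
    using \<phi>(1) unfolding nspace_holomorphic_on_def by blast
  then have "((\<lambda>w. f (inverse (w - z) *\<^sub>C (\<phi> w - \<phi> z))) \<longlongrightarrow> f l) (at z within S)"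
    by (intro tendsto_linear_functional[OF X f, of C] bound)
  moreover have "f (inverse (w - z) *\<^sub>C (\<phi> w - \<phi> z)) = (f (\<phi> w) - f (\<phi> z)) / (w - z)" if "w \<in> S" for w
  proof -
    have "f (inverse (w - z) *\<^sub>C (\<phi> w - \<phi> z)) = inverse (w - z) * f (\<phi> w - \<phi> z)"
      using f nspace_diff[OF X \<phi>(2)[OF that] \<phi>(2)[OF z]] unfolding linear_functional_on_def by blast
    then show ?thesis
      using linear_functional_on_diff[OF nspace_subspace[OF X] f \<phi>(2)[OF that] \<phi>(2)[OF z]]
      by (simp add: field_simps)
  qed
  then have "\<forall>\<^sub>F w in at z within S.
      f (inverse (w - z) *\<^sub>C (\<phi> w - \<phi> z)) = (f (\<phi> w) - f (\<phi> z)) / (w - z)"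
    by (auto simp: eventually_at_filter)
  ultimately have "((\<lambda>w. (f (\<phi> w) - f (\<phi> z)) / (w - z)) \<longlongrightarrow> f l) (at z within S)"
    by (rule Lim_transform_eventually)
  then show "\<exists>f'. ((\<lambda>z. f (\<phi> z)) has_field_derivative f') (at z within S)"
    unfolding has_field_derivative_iff by blast
qed

text \<open>
  The Schwarz lemma for \<open>h - h z\<close>, rescaled to the unit disc. The factor 3 instead of 2 yields the
  strict bound which that lemma asks for.
\<close>
lemma Schwarz_ball:
  assumes h: "h holomorphic_on ball z \<rho>" and bound: "\<And>w. w \<in> ball z \<rho> \<Longrightarrow> cmod (h w) \<le> M"
    and "0 < M" "w \<in> ball z \<rho>"
  shows "cmod (h w - h z) \<le> 3 * M / \<rho> * dist w z"
proof -
  have \<rho>: "0 < \<rho>" using assms(4) by (metis ball_empty empty_iff not_less)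
  define k where "k \<xi> = (h (z + of_real \<rho> * \<xi>) - h z) / of_real (3 * M)" for \<xi>
  have in_ball: "z + of_real \<rho> * \<xi> \<in> ball z \<rho>" if "cmod \<xi> < 1" for \<xi>
    using that \<rho> by (simp add: dist_norm norm_mult)
  define \<xi> where "\<xi> = (w - z) / of_real \<rho>"
  have \<xi>: "cmod \<xi> < 1" using assms(4) \<rho> by (simp add: \<xi>_def norm_divide dist_norm norm_minus_commute)
  have "cmod (k \<xi>) \<le> cmod \<xi>"
  proof (rule Schwarz_Lemma(1)[OF _ _ _ \<xi>])
    have "(h \<circ> (\<lambda>\<xi>. z + of_real \<rho> * \<xi>)) holomorphic_on ball 0 1"
      using in_ball by (intro holomorphic_on_compose_gen[OF _ h] holomorphic_intros) auto
    then show "k holomorphic_on ball 0 1"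
      unfolding k_def comp_def using \<open>0 < M\<close> by (intro holomorphic_intros) auto
    show "k 0 = 0" by (simp add: k_def)
    show "cmod (k x) < 1" if "cmod x < 1" for x
    proof -
      have "cmod (h (z + of_real \<rho> * x) - h z) \<le> cmod (h (z + of_real \<rho> * x)) + cmod (h z)"
        by (rule norm_triangle_ineq4)
      also have "\<dots> \<le> M + M" using bound in_ball[OF that] \<rho> by (intro add_mono) auto
      also have "\<dots> < 3 * M" using \<open>0 < M\<close> by simp
      finally show ?thesis using \<open>0 < M\<close> by (simp add: k_def norm_divide norm_mult)
    qed
  qed
  then show ?thesis
    using \<rho> \<open>0 < M\<close> by (simp add: k_def \<xi>_def norm_divide norm_mult dist_norm field_simps)
qed

text \<open>
  A functional that norms the single vector \<open>\<phi> w - \<phi> z\<close> reduces the vector-valued estimate to the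
  scalar one.
\<close>
lemma nspace_Schwarz_ball:
  assumes X: "complex_normed_space X" and \<phi>: "nspace_holomorphic_on X \<phi> A"
    and A: "\<And>w. w \<in> A \<Longrightarrow> \<phi> w \<in> pts X" "ball z \<rho> \<subseteq> A"
    and bound: "\<And>w. w \<in> A \<Longrightarrow> nrm X (\<phi> w) \<le> M" and "0 < M" and w: "w \<in> ball z \<rho>"
  shows "nrm X (\<phi> w - \<phi> z) \<le> 3 * M / \<rho> * dist w z"
proof -
  have "z \<in> ball z \<rho>" using w by (metis ball_empty centre_in_ball empty_iff not_less)
  then have "z \<in> A" "w \<in> A" using A(2) w by blast+
  then have wz: "\<phi> w \<in> pts X" "\<phi> z \<in> pts X" using A(1) by auto
  have "seminorm_on (pts X) (nrm X)" using X by (simp add: complex_normed_space_iff_seminorm_on)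
  then obtain f where f: "linear_functional_on (pts X) f" "\<And>x. x \<in> pts X \<Longrightarrow> cmod (f x) \<le> nrm X x"
      "cmod (f (\<phi> w - \<phi> z)) = nrm X (\<phi> w - \<phi> z)"
    by (rule Hahn_Banach_norming_functional[OF _ nspace_diff[OF X wz]]) (rule that; assumption)
  have "cmod (f (\<phi> w) - f (\<phi> z)) \<le> 3 * M / \<rho> * dist w z"
  proof (rule Schwarz_ball[OF _ _ \<open>0 < M\<close> w])
    have "(\<lambda>z. f (\<phi> z)) holomorphic_on A"
      using f(2) by (intro holomorphic_on_linear_functional[OF X f(1) _ \<phi> A(1), of 1]) auto
    then show "(\<lambda>z. f (\<phi> z)) holomorphic_on ball z \<rho>" using A(2) by (rule holomorphic_on_subset)
    show "cmod (f (\<phi> w)) \<le> M" if "w \<in> ball z \<rho>" for w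
      using f(2)[OF A(1)[of w]] bound[of w] A(2) that by force
  qed
  then show ?thesis
    using f(3) linear_functional_on_diff[OF nspace_subspace[OF X] f(1) wz] by simp
qed

text \<open>
  By the Schwarz estimate the difference quotients at \<open>z\<close> of the \<open>k\<close>-th term are at most
  \<open>3 / \<rho> * (1/2) ^ k\<close>, uniformly near \<open>z\<close>. So are their limits, and the limit at \<open>z\<close> may be taken
  term by term.
\<close>
lemma nspace_holomorphic_on_series:
  assumes X: "complex_banach_space X" and "open A"
    and hol: "\<And>k. nspace_holomorphic_on X (u k) A" and u: "\<And>k w. w \<in> A \<Longrightarrow> u k w \<in> pts X"
    and small: "\<And>k w. w \<in> A \<Longrightarrow> nrm X (u k w) \<le> (1/2) ^ k"
    and \<phi>: "\<And>w. w \<in> A \<Longrightarrow> \<phi> w \<in> pts X"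
    and conv: "\<And>n w. w \<in> A \<Longrightarrow> nrm X (\<phi> w - (\<Sum>k<n. u k w)) \<le> C * (1/2) ^ n"
  shows "nspace_holomorphic_on X \<phi> A"
  unfolding nspace_holomorphic_on_def
proof
  have nX: "complex_normed_space X" using X by (rule banach_imp_normed)
  note mem = nspace_diff[OF nX] nspace_scale[OF nX] nspace_sum[OF nX]
  fix z assume z: "z \<in> A"
  obtain \<rho> where \<rho>: "0 < \<rho>" "ball z \<rho> \<subseteq> A" using \<open>open A\<close> z unfolding open_contains_ball by auto
  define D where "D g w = inverse (w - z) *\<^sub>C (g w - g z)" for g :: "complex \<Rightarrow> 'a" and w
  have DX: "D g w \<in> pts X" if "g w \<in> pts X" "g z \<in> pts X" for g w
    unfolding D_def using that mem by blast
  have "\<forall>k. \<exists>l. limitin (ntop X) (D (u k)) l (at z within A)"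
    using hol z unfolding nspace_holomorphic_on_def D_def by blast
  then obtain L where L: "\<And>k. limitin (ntop X) (D (u k)) (L k) (at z within A)"
    by metis
  have LX: "L k \<in> pts X" for k using L by (simp add: limitin_ntop[OF nX])
  have near: "\<forall>\<^sub>F w in at z within A. w \<in> A \<and> w \<in> ball z \<rho> \<and> w \<noteq> z"
    unfolding eventually_at using \<rho>(1) by (auto simp: dist_commute)
  have nontriv: "at z within A \<noteq> bot" using at_within_open[OF z \<open>open A\<close>] by simp
  have Dle: "nrm X (D (u k) w) \<le> 3 / \<rho> * (1/2) ^ k" if "w \<in> A" "w \<in> ball z \<rho>" "w \<noteq> z" for k w
  proof -
    have "nrm X (D (u k) w) = nrm X (u k w - u k z) / dist w z"
      unfolding D_def using nrm_scale[OF nX mem(1)[OF u[OF that(1)] u[OF z]]]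
      by (simp add: norm_inverse dist_norm divide_inverse mult.commute)
    also have "\<dots> \<le> (3 * (1/2) ^ k / \<rho> * dist w z) / dist w z"
    proof (rule divide_right_mono)
      show "nrm X (u k w - u k z) \<le> 3 * (1/2) ^ k / \<rho> * dist w z"
        by (rule nspace_Schwarz_ball[OF nX hol u \<rho>(2) small _ that(2)]) simp_all
    qed simp
    finally show ?thesis using that(3) by simp
  qed
  have "nrm X (L k) \<le> 3 / \<rho> * (1/2) ^ k" for k
  proof (rule field_le_epsilon)
    fix \<epsilon> :: real assume "0 < \<epsilon>"
    then have "\<forall>\<^sub>F w in at z within A. nrm X (D (u k) w - L k) < \<epsilon>"
      using L[of k] by (auto simp: limitin_ntop[OF nX] eventually_conj_iff)
    with near have "\<forall>\<^sub>F w in at z within A. (w \<in> A \<and> w \<in> ball z \<rho> \<and> w \<noteq> z) \<and> nrm X (D (u k) w - L k) < \<epsilon>"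
      by (rule eventually_conj)
    then obtain w where w: "w \<in> A" "w \<in> ball z \<rho>" "w \<noteq> z" "nrm X (D (u k) w - L k) < \<epsilon>"
      using eventually_happens'[OF nontriv] by blast
    have Dw: "D (u k) w \<in> pts X" using u w(1) z by (intro DX)
    have "nrm X (L k - 0) \<le> nrm X (L k - D (u k) w) + nrm X (D (u k) w - 0)"
      by (intro nrm_diff_triangle nX LX Dw nspace_zero)
    then show "nrm X (L k) \<le> 3 / \<rho> * (1/2) ^ k + \<epsilon>"
      using Dle[OF w(1-3), of k] w(4) nrm_minus_commute[OF nX LX[of k] Dw] by simp
  qed
  then obtain l where l: "l \<in> pts X" "\<And>n. nrm X (l - sum L {..<n}) \<le> 2 * (3 / \<rho>) * (1/2) ^ n"
    using geometric_series_converges[of X L "3 / \<rho>", OF X LX] by blast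
  have tail: "nrm X (D \<phi> w - (\<Sum>k<n. D (u k) w)) \<le> 2 * (3 / \<rho>) * (1/2) ^ n"
    if w: "w \<in> A" "w \<in> ball z \<rho>" "w \<noteq> z" for w n
  proof (rule field_le_epsilon)
    fix \<epsilon> :: real assume e: "0 < \<epsilon>"
    obtain N where N: "\<And>m. N \<le> m \<Longrightarrow> (2 * C / dist w z) * (1/2) ^ m < \<epsilon>"
      using half_power_eventually_less[OF e] by blast
    define m where "m = max N n"
    have S: "(\<Sum>k<m. u k v) \<in> pts X" if "v \<in> A" for v using u that by (intro mem)
    have DS: "(\<Sum>k<j. D (u k) w) \<in> pts X" for j using u w z by (intro mem(3) DX)
    have "D \<phi> w - (\<Sum>k<m. D (u k) w) =
        inverse (w - z) *\<^sub>C ((\<phi> w - (\<Sum>k<m. u k w)) - (\<phi> z - (\<Sum>k<m. u k z)))"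
      unfolding D_def cvec.scale_sum_right[symmetric] cvec.scale_right_diff_distrib[symmetric]
      by (simp add: sum_subtractf algebra_simps)
    then have "nrm X (D \<phi> w - (\<Sum>k<m. D (u k) w)) =
        nrm X ((\<phi> w - (\<Sum>k<m. u k w)) - (\<phi> z - (\<Sum>k<m. u k z))) / dist w z"
      using nrm_scale[OF nX mem(1)[OF mem(1)[OF \<phi>[OF w(1)] S[OF w(1)]] mem(1)[OF \<phi>[OF z] S[OF z]]]]
      by (simp add: norm_inverse dist_norm divide_inverse mult.commute)
    also have "\<dots> \<le> (C * (1/2) ^ m + C * (1/2) ^ m) / dist w z"
      using nrm_diff_le[OF nX mem(1)[OF \<phi>[OF w(1)] S[OF w(1)]] mem(1)[OF \<phi>[OF z] S[OF z]]]
        conv[OF w(1), of m] conv[OF z, of m]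
      by (intro divide_right_mono) auto
    also have "\<dots> \<le> \<epsilon>" using N[of m] by (simp add: m_def field_simps)
    finally have 1: "nrm X (D \<phi> w - (\<Sum>k<m. D (u k) w)) \<le> \<epsilon>" .
    have 2: "nrm X ((\<Sum>k<m. D (u k) w) - (\<Sum>k<n. D (u k) w)) \<le> 2 * (3 / \<rho>) * (1/2) ^ n"
      using u w z Dle[OF w] by (intro nrm_partial_sums_diff nX DX) (auto simp: m_def)
    have "nrm X (D \<phi> w - (\<Sum>k<n. D (u k) w)) \<le>
        nrm X (D \<phi> w - (\<Sum>k<m. D (u k) w)) + nrm X ((\<Sum>k<m. D (u k) w) - (\<Sum>k<n. D (u k) w))"
      using \<phi> w z by (intro nrm_diff_triangle nX DS DX)
    with 1 2 show "nrm X (D \<phi> w - (\<Sum>k<n. D (u k) w)) \<le> 2 * (3 / \<rho>) * (1/2) ^ n + \<epsilon>" by simp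
  qed
  have "limitin (ntop X) (D \<phi>) l (at z within A)"
    unfolding limitin_ntop[OF nX]
  proof (intro conjI allI impI l(1))
    fix \<epsilon> :: real assume "0 < \<epsilon>"
    then have e: "0 < \<epsilon> / 3" by simp
    then obtain n where n: "2 * (3 / \<rho>) * (1/2) ^ n < \<epsilon> / 3"
      using half_power_eventually_less by blast
    have "limitin (ntop X) (\<lambda>w. \<Sum>k<n. D (u k) w) (sum L {..<n}) (at z within A)"
      using L by (intro limitin_ntop_sum nX)
    then have "\<forall>\<^sub>F w in at z within A. nrm X ((\<Sum>k<n. D (u k) w) - sum L {..<n}) < \<epsilon> / 3"
      using e unfolding limitin_ntop[OF nX] eventually_conj_iff by blast
    with near show "\<forall>\<^sub>F w in at z within A. D \<phi> w \<in> pts X \<and> nrm X (D \<phi> w - l) < \<epsilon>"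
    proof eventually_elim
      case (elim w)
      have m: "D \<phi> w \<in> pts X" "(\<Sum>k<n. D (u k) w) \<in> pts X" "sum L {..<n} \<in> pts X"
        using \<phi> u elim z by (auto intro!: DX mem(3) LX)
      have "nrm X (D \<phi> w - l) \<le> nrm X (D \<phi> w - (\<Sum>k<n. D (u k) w)) +
          (nrm X ((\<Sum>k<n. D (u k) w) - sum L {..<n}) + nrm X (sum L {..<n} - l))"
        using nrm_diff_triangle[OF nX m(1,2) l(1)] nrm_diff_triangle[OF nX m(2,3) l(1)] by simp
      moreover have "nrm X (D \<phi> w - (\<Sum>k<n. D (u k) w)) \<le> 2 * (3 / \<rho>) * (1/2) ^ n"
        using elim by (intro tail) auto
      moreover have "nrm X (sum L {..<n} - l) \<le> 2 * (3 / \<rho>) * (1/2) ^ n"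
        using l(2)[of n] nrm_minus_commute[OF nX l(1) m(3)] by simp
      ultimately show ?case using elim n m(1) by linarith
    qed
  qed
  then show "\<exists>l. limitin (ntop X) (\<lambda>w. inverse (w - z) *\<^sub>C (\<phi> w - \<phi> z)) l (at z within A)"
    unfolding D_def by blast
qed

lemma tendsto_nrm:
  assumes X: "complex_normed_space X" and g: "limitin (ntop X) g l F"
  shows "((\<lambda>w. nrm X (g w)) \<longlongrightarrow> nrm X l) F"
proof (rule tendstoI)
  fix \<epsilon> :: real assume "0 < \<epsilon>"
  have l: "l \<in> pts X" using g by (simp add: limitin_ntop[OF X])
  have "\<forall>\<^sub>F w in F. g w \<in> pts X \<and> nrm X (g w - l) < \<epsilon>"
    using g \<open>0 < \<epsilon>\<close> unfolding limitin_ntop[OF X] by blast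
  then show "\<forall>\<^sub>F w in F. dist (nrm X (g w)) (nrm X l) < \<epsilon>"
  proof eventually_elim
    case (elim w)
    have "nrm X (g w) \<le> nrm X (g w - l) + nrm X l" "nrm X l \<le> nrm X (l - g w) + nrm X (g w)"
      using nrm_add[OF X nspace_diff[OF X, of "g w" l] l] nrm_add[OF X nspace_diff[OF X l, of "g w"], of "g w"]
        elim l by auto
    then show ?case
      using elim nrm_minus_commute[OF X l, of "g w"] by (auto simp: dist_real_def)
  qed
qed

lemma limitin_ntop_scaleC_left:
  assumes X: "complex_normed_space X" and g: "(g \<longlongrightarrow> c) F" and y: "y \<in> pts X"
  shows "limitin (ntop X) (\<lambda>w. g w *\<^sub>C y) (c *\<^sub>C y) F"
  unfolding limitin_ntop[OF X]
proof (intro conjI allI impI)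
  show "c *\<^sub>C y \<in> pts X" using y by (rule nspace_scale[OF X])
  fix \<epsilon> :: real assume e: "0 < \<epsilon>"
  have "((\<lambda>w. cmod (g w - c) * nrm X y) \<longlongrightarrow> cmod (c - c) * nrm X y) F"
    using g by (intro tendsto_intros)
  then have "\<forall>\<^sub>F w in F. cmod (g w - c) * nrm X y < \<epsilon>"
    using e by (intro order_tendstoD(2)) auto
  then show "\<forall>\<^sub>F w in F. g w *\<^sub>C y \<in> pts X \<and> nrm X (g w *\<^sub>C y - c *\<^sub>C y) < \<epsilon>"
    by eventually_elim
      (simp add: nspace_scale[OF X y] nrm_scale[OF X y] flip: cvec.scale_left_diff_distrib)
qed

lemma continuous_map_ntop_scaleC_left:
  fixes S :: "'b::metric_space set"
  assumes X: "complex_normed_space X" and "continuous_on S g" and y: "y \<in> pts X"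
  shows "continuous_map (top_of_set S) (ntop X) (\<lambda>z. g z *\<^sub>C y)"
  unfolding continuous_map_ntop_iff_limitin[OF X]
proof (intro ballI conjI nspace_scale[OF X y])
  fix z assume "z \<in> S"
  then have "(g \<longlongrightarrow> g z) (at z within S)" using assms(2) by (simp add: continuous_on_def)
  then show "limitin (ntop X) (\<lambda>z. g z *\<^sub>C y) (g z *\<^sub>C y) (at z within S)"
    by (rule limitin_ntop_scaleC_left[OF X _ y])
qed

lemma nspace_holomorphic_on_scaleC_left:
  assumes X: "complex_normed_space X" and g: "g holomorphic_on S" and y: "y \<in> pts X"
  shows "nspace_holomorphic_on X (\<lambda>z. g z *\<^sub>C y) S"
  unfolding nspace_holomorphic_on_def
proof
  fix z assume "z \<in> S"
  then obtain g' where "((\<lambda>w. (g w - g z) / (w - z)) \<longlongrightarrow> g') (at z within S)"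
    using g unfolding holomorphic_on_def field_differentiable_def has_field_derivative_iff by blast
  then have "limitin (ntop X) (\<lambda>w. ((g w - g z) / (w - z)) *\<^sub>C y) (g' *\<^sub>C y) (at z within S)"
    by (intro limitin_ntop_scaleC_left[OF X _ y])
  moreover have "inverse (w - z) *\<^sub>C (g w *\<^sub>C y - g z *\<^sub>C y) = ((g w - g z) / (w - z)) *\<^sub>C y" for w
    unfolding cvec.scale_left_diff_distrib[symmetric] scaleC_scaleC
    by (rule arg_cong[where f = "\<lambda>a. a *\<^sub>C y"]) (simp add: divide_inverse mult.commute)
  ultimately show "\<exists>l. limitin (ntop X) (\<lambda>w. inverse (w - z) *\<^sub>C (g w *\<^sub>C y - g z *\<^sub>C y)) l (at z within S)"
    by auto
qed

lemma continuous_map_ntop_series: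
  fixes S :: "'b::metric_space set"
  assumes X: "complex_normed_space X" and u: "\<And>k. continuous_map (top_of_set S) (ntop X) (u k)"
    and \<phi>: "\<And>w. w \<in> S \<Longrightarrow> \<phi> w \<in> pts X"
    and conv: "\<And>n w. w \<in> S \<Longrightarrow> nrm X (\<phi> w - (\<Sum>k<n. u k w)) \<le> C * (1/2) ^ n"
  shows "continuous_map (top_of_set S) (ntop X) \<phi>"
proof -
  interpret Metric_space "pts X" "ndist X" by (rule Metric_space_ndist[OF X])
  have uX: "u k w \<in> pts X" if "w \<in> S" for k w
    using u that by (simp add: continuous_map_ntop_iff_limitin[OF X])
  show ?thesis
  proof (rule continuous_map_uniform_limit)
    show "\<forall>\<^sub>F n in sequentially. continuous_map (top_of_set S) (ntop X) (\<lambda>w. \<Sum>k<n. u k w)"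
    proof (rule always_eventually, rule allI)
      fix n show "continuous_map (top_of_set S) (ntop X) (\<lambda>w. \<Sum>k<n. u k w)"
        using continuous_map_ntop_add[OF X _ u]
        by (induction n) (auto simp: topspace_ntop[OF X] nspace_zero[OF X])
    qed
    fix \<epsilon> :: real assume "0 < \<epsilon>"
    then obtain N where N: "\<And>n. N \<le> n \<Longrightarrow> C * (1/2) ^ n < \<epsilon>"
      using half_power_eventually_less by blast
    have "ndist X (\<Sum>k<n. u k w) (\<phi> w) < \<epsilon>" if "N \<le> n" "w \<in> S" for n w
    proof -
      have "(\<Sum>k<n. u k w) \<in> pts X" using uX that by (intro nspace_sum[OF X])
      then show ?thesis
        using conv[OF that(2), of n] N[OF that(1)] \<phi>[OF that(2)]
          nrm_minus_commute[OF X, of "\<phi> w" "\<Sum>k<n. u k w"] by (simp add: ndist_def)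
    qed
    then show "\<forall>\<^sub>F n in sequentially. \<forall>w\<in>topspace (top_of_set S). \<phi> w \<in> pts X \<and> ndist X (\<Sum>k<n. u k w) (\<phi> w) < \<epsilon>"
      using \<phi> by (auto simp: eventually_sequentially)
  qed simp
qed

section \<open>The interpolation spaces\<close>

lemma open_annulus: "open annulus"
proof -
  have eq: "annulus = {z. 1 < cmod z} \<inter> {z. cmod z < exp 1}" by (auto simp: annulus_def)
  show ?thesis unfolding eq by (intro open_Int open_Collect_less continuous_intros)
qed

lemma closure_annulus_bounds:
  assumes "z \<in> closure annulus"
  shows "1 \<le> cmod z" "cmod z \<le> exp 1"
proof -
  have "closure annulus \<subseteq> {z. 1 \<le> cmod z} \<inter> {z. cmod z \<le> exp 1}"
    by (intro closure_minimal closed_Int closed_Collect_le continuous_intros) (auto simp: annulus_def)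
  then show "1 \<le> cmod z" "cmod z \<le> exp 1" using assms by auto
qed

lemma frontier_annulus_cases:
  assumes "z \<in> frontier annulus"
  shows "cmod z = 1 \<or> cmod z = exp 1"
proof -
  have "z \<in> closure annulus" "z \<notin> annulus"
    using assms by (auto simp: frontier_def interior_open[OF open_annulus])
  then show ?thesis using closure_annulus_bounds[of z] by (auto simp: annulus_def)
qed

lemma exp_in_annulus: "0 < \<theta> \<Longrightarrow> \<theta> < 1 \<Longrightarrow> exp (of_real \<theta>) \<in> annulus"
  by (simp add: annulus_def)

context
  fixes X0 X1 :: "('a::complex_vector) nspace"
  assumes compat: "compatible_couple X0 X1"
begin

lemma couple_banach: "complex_banach_space X0" "complex_banach_space X1"
  using compat by (auto simp: compatible_couple_def)

lemma couple_normed: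
  "complex_normed_space X0" "complex_normed_space X1" "complex_normed_space (sum_space X0 X1)"
  using couple_banach complex_banach_space_sum_space[OF compat] by (auto intro: banach_imp_normed)

lemma calderon_functions_mem:
  assumes "\<phi> \<in> calderon_functions X0 X1"
  shows "z \<in> closure annulus \<Longrightarrow> \<phi> z \<in> pts (sum_space X0 X1)"
    and "cmod z = 1 \<Longrightarrow> \<phi> z \<in> pts X0" and "cmod z = exp 1 \<Longrightarrow> \<phi> z \<in> pts X1"
  using assms unfolding calderon_functions_def
  by (auto simp: continuous_map_ntop_iff_limitin couple_normed)

lemma calderon_norm_ge:
  assumes \<phi>: "\<phi> \<in> calderon_functions X0 X1"
  shows "cmod z = 1 \<Longrightarrow> nrm X0 (\<phi> z) \<le> calderon_norm X0 X1 \<phi>"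
    and "cmod z = exp 1 \<Longrightarrow> nrm X1 (\<phi> z) \<le> calderon_norm X0 X1 \<phi>"
proof -
  let ?g = "\<lambda>t. max (nrm X0 (\<phi> (exp (\<i> * of_real t)))) (nrm X1 (\<phi> (exp (1 + \<i> * of_real t))))"
  have c0: "continuous_on {z. cmod z = 1} (\<lambda>z. nrm X0 (\<phi> z))"
    and c1: "continuous_on {z. cmod z = exp 1} (\<lambda>z. nrm X1 (\<phi> z))"
    using \<phi> unfolding calderon_functions_def continuous_on_def
    by (auto simp: continuous_map_ntop_iff_limitin couple_normed intro: tendsto_nrm couple_normed)
  have "continuous_on {0..2 * pi} ?g"
    by (intro continuous_on_max continuous_on_compose2[OF c0] continuous_on_compose2[OF c1] continuous_intros)
      auto
  then have "compact (?g ` {0..2 * pi})" by (intro compact_continuous_image) auto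
  then have bdd: "bdd_above (?g ` {0..2 * pi})" by (intro bounded_imp_bdd_above compact_imp_bounded)
  \<comment> \<open>\<open>Arg2pi z\<close> is the parameter of \<open>z\<close> on either circle\<close>
  have le: "?g (Arg2pi z) \<le> calderon_norm X0 X1 \<phi>" for z
    unfolding calderon_norm_def using bdd Arg2pi[of z] by (intro cSUP_upper) auto
  show "nrm X0 (\<phi> z) \<le> calderon_norm X0 X1 \<phi>" if "cmod z = 1"
    using le[of z] Arg2pi_eq[of z] that by simp
  show "nrm X1 (\<phi> z) \<le> calderon_norm X0 X1 \<phi>" if "cmod z = exp 1"
  proof -
    have "complex_of_real (exp 1) = exp 1" by (metis exp_of_real of_real_1)
    then have "z = exp (1 + \<i> * of_real (Arg2pi z))"
      using Arg2pi_eq[of z] that by (simp add: exp_add)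
    then show ?thesis using le[of z] by simp
  qed
qed

lemma calderon_norm_le:
  assumes "\<And>z. cmod z = 1 \<Longrightarrow> nrm X0 (\<phi> z) \<le> B" "\<And>z. cmod z = exp 1 \<Longrightarrow> nrm X1 (\<phi> z) \<le> B"
  shows "calderon_norm X0 X1 \<phi> \<le> B"
  unfolding calderon_norm_def by (rule cSUP_least) (auto intro!: assms)

lemma calderon_norm_nonneg:
  assumes "\<phi> \<in> calderon_functions X0 X1"
  shows "0 \<le> calderon_norm X0 X1 \<phi>"
  using calderon_norm_ge(1)[OF assms, of 1] nrm_nonneg[OF couple_normed(1) calderon_functions_mem(2)[OF assms, of 1]]
  by simp

lemma calderon_functions_add:
  "\<phi> \<in> calderon_functions X0 X1 \<Longrightarrow> \<psi> \<in> calderon_functions X0 X1 \<Longrightarrow>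
    (\<lambda>z. \<phi> z + \<psi> z) \<in> calderon_functions X0 X1"
  unfolding calderon_functions_def
  by (auto intro: continuous_map_ntop_add nspace_holomorphic_on_add couple_normed)

lemma calderon_functions_scale:
  "\<phi> \<in> calderon_functions X0 X1 \<Longrightarrow> (\<lambda>z. c *\<^sub>C \<phi> z) \<in> calderon_functions X0 X1"
  unfolding calderon_functions_def
  by (auto intro: continuous_map_ntop_scale nspace_holomorphic_on_scale couple_normed)

text \<open>
  A puncture at 0 is allowed in the scalar factor because negative powers of \<open>z\<close> are the factors of
  interest: on the annulus they play the role that the exponentials play for the strip.
\<close>
lemma calderon_functions_scaleC_left:
  assumes g: "g holomorphic_on - {0}" and y: "y \<in> pts X0" "y \<in> pts X1"
  shows "(\<lambda>z. g z *\<^sub>C y) \<in> calderon_functions X0 X1"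
proof -
  have c: "continuous_on S g" if "0 \<notin> S" for S
    using that by (intro continuous_on_subset[OF holomorphic_on_imp_continuous_on[OF g]]) auto
  have "0 \<notin> closure annulus" using closure_annulus_bounds(1)[of 0] by auto
  moreover have "g holomorphic_on annulus"
    using g by (rule holomorphic_on_subset) (auto simp: annulus_def)
  ultimately show ?thesis
    using y pts_subset_sum_space(1)[OF couple_normed(1,2)] unfolding calderon_functions_def
    by (auto intro!: continuous_map_ntop_scaleC_left nspace_holomorphic_on_scaleC_left c couple_normed)
qed

lemma calderon_functions_sum:
  assumes "\<And>k. k \<in> I \<Longrightarrow> \<phi> k \<in> calderon_functions X0 X1"
  shows "(\<lambda>z. \<Sum>k\<in>I. \<phi> k z) \<in> calderon_functions X0 X1"
proof -
  have 0: "(\<lambda>z. 0) \<in> calderon_functions X0 X1"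
    using calderon_functions_scaleC_left[of "\<lambda>_. 0" 0] nspace_zero[OF couple_normed(1)]
      nspace_zero[OF couple_normed(2)] by simp
  show ?thesis
    using assms
    by (induction I rule: infinite_finite_induct) (auto simp: 0 intro: calderon_functions_add)
qed

text \<open>
  The lower estimate for the interpolation norm, in place of a Poisson or Cauchy integral. The left side
  is a seminorm, so some functional \<open>f\<close> below it attains it at \<open>\<phi> z\<close>. Apply the maximum principle on
  the annulus to \<open>(z / w) ^ n * f (\<phi> w)\<close>, which equals \<open>f (\<phi> z)\<close> at \<open>w = z\<close>. The weights of the
  K-functional are just those that cancel the modulus of \<open>(z / w) ^ n\<close> on the two boundary circles.
\<close>
theorem K_functional_le_calderon_norm:
  assumes \<phi>: "\<phi> \<in> calderon_functions X0 X1" and z: "z \<in> closure annulus"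
  shows "K_functional ((1 / cmod z) ^ n) ((exp 1 / cmod z) ^ n) X0 X1 (\<phi> z) \<le> calderon_norm X0 X1 \<phi>"
proof -
  let ?S = "sum_space X0 X1" and ?N = "calderon_norm X0 X1 \<phi>"
  define a b where "a = (1 / cmod z) ^ n" and "b = (exp 1 / cmod z) ^ n"
  have cz: "0 < cmod z" using closure_annulus_bounds(1)[OF z] by linarith
  have ab: "0 < a" "0 < b" using cz by (simp_all add: a_def b_def)
  let ?K = "K_functional a b X0 X1"
  note normed = couple_normed and mem = calderon_functions_mem[OF \<phi>]
  have cont: "continuous_map (top_of_set (closure annulus)) (ntop ?S) \<phi>"
    and hol: "nspace_holomorphic_on ?S \<phi> annulus"
    using \<phi> by (auto simp: calderon_functions_def)
  have sem: "seminorm_on (pts ?S) ?K"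
    using ab by (intro seminorm_on_K_functional normed) auto
  obtain f where f: "linear_functional_on (pts ?S) f" "\<And>x. x \<in> pts ?S \<Longrightarrow> cmod (f x) \<le> ?K x"
      "cmod (f (\<phi> z)) = ?K (\<phi> z)"
    by (rule Hahn_Banach_norming_functional[OF sem mem(1)[OF z]]) (rule that; assumption)
  have K0: "?K x \<le> a * nrm X0 x" if "x \<in> pts X0" for x
    using K_functional_le[OF normed(1,2), of a b x 0] ab that
    by (simp add: nspace_zero normed nrm_zero)
  have K1: "?K x \<le> b * nrm X1 x" if "x \<in> pts X1" for x
    using K_functional_le[OF normed(1,2), of a b 0 x] ab that
    by (simp add: nspace_zero normed nrm_zero)
  have f_le: "cmod (f x) \<le> max a b * nrm ?S x" if x: "x \<in> pts ?S" for x
  proof -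
    have "?K x / max a b \<le> K_functional 1 1 X0 X1 x"
      unfolding K_functional_def[of 1 1]
    proof (rule quotient_norm_ge)
      show "x \<in> (\<lambda>(u, v). u + v) ` (pts X0 \<times> pts X1)" using x by (simp add: pts_sum_space)
      fix p assume p: "p \<in> pts X0 \<times> pts X1" "(case p of (u, v) \<Rightarrow> u + v) = x"
      obtain u v where uv: "p = (u, v)" by (cases p)
      have "?K x \<le> a * nrm X0 u + b * nrm X1 v"
        using K_functional_le[OF normed(1,2), of a b u v] p ab by (auto simp: uv)
      also have "\<dots> \<le> max a b * nrm X0 u + max a b * nrm X1 v"
        using p by (intro add_mono mult_right_mono) (auto simp: uv nrm_nonneg normed)
      finally show "?K x / max a b \<le> (case p of (u, v) \<Rightarrow> 1 * nrm X0 u + 1 * nrm X1 v)"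
        using ab by (simp add: uv field_simps max_def split: if_splits)
    qed
    then show ?thesis
      using f(2)[OF x] ab by (simp add: nrm_sum_space field_simps max_def split: if_splits)
  qed
  define g where "g w = (z / w) ^ n * f (\<phi> w)" for w
  have edge: "cmod (g w) \<le> ?N" if w: "w \<in> frontier annulus" for w
  proof -
    have w': "w \<in> closure annulus" using w by (simp add: frontier_def)
    have gw: "cmod (g w) \<le> (cmod z / cmod w) ^ n * ?K (\<phi> w)"
      using f(2)[OF mem(1)[OF w']] by (simp add: g_def norm_mult norm_power norm_divide mult_left_mono)
    show ?thesis
    proof (cases "cmod w = 1")
      case True
      then have "(cmod z / cmod w) ^ n * ?K (\<phi> w) \<le> cmod z ^ n * (a * nrm X0 (\<phi> w))"
        using K0[OF mem(2)[OF True]] by (simp add: mult_left_mono)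
      also have "\<dots> = nrm X0 (\<phi> w)" using cz by (simp add: a_def power_divide)
      also have "\<dots> \<le> ?N" using True by (rule calderon_norm_ge(1)[OF \<phi>])
      finally show ?thesis using gw by linarith
    next
      case False
      then have w1: "cmod w = exp 1" using frontier_annulus_cases[OF w] by simp
      then have "(cmod z / cmod w) ^ n * ?K (\<phi> w) \<le> (cmod z / exp 1) ^ n * (b * nrm X1 (\<phi> w))"
        using K1[OF mem(3)[OF w1]] by (simp add: mult_left_mono)
      also have "\<dots> = nrm X1 (\<phi> w)" using cz by (simp add: b_def power_divide)
      also have "\<dots> \<le> ?N" using w1 by (rule calderon_norm_ge(2)[OF \<phi>])
      finally show ?thesis using gw by linarith
    qed
  qed
  have "cmod (g z) \<le> ?N"
  proof (cases "z \<in> annulus")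
    case True
    have nz: "w \<noteq> 0" if "w \<in> closure annulus" for w using closure_annulus_bounds(1)[OF that] by auto
    have "(\<lambda>w. f (\<phi> w)) holomorphic_on annulus"
      using f_le mem(1) closure_subset by (intro holomorphic_on_linear_functional[OF normed(3) f(1) _ hol]) auto
    then have "g holomorphic_on interior annulus"
      unfolding g_def interior_open[OF open_annulus]
      using nz closure_subset[of annulus] by (intro holomorphic_intros) auto
    moreover have "continuous_on (closure annulus) (\<lambda>w. f (\<phi> w))"
      using f_le by (intro continuous_on_linear_functional[OF normed(3) f(1) _ cont]) auto
    then have "continuous_on (closure annulus) g"
      unfolding g_def using nz by (intro continuous_intros) auto
    moreover have "bounded annulus" unfolding bounded_iff annulus_def by (auto intro: less_imp_le)
    ultimately show ?thesis using edge True by (rule maximum_modulus_frontier)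
  next
    case False
    with z show ?thesis by (intro edge) (simp add: frontier_def interior_open[OF open_annulus])
  qed
  moreover have "z \<noteq> 0" using cz by auto
  ultimately show ?thesis using f(3) by (simp add: g_def a_def b_def)
qed

text \<open>
  This is the maximum principle for functions with values in the sum.
\<close>
lemma nrm_sum_space_le_calderon_norm:
  assumes "\<phi> \<in> calderon_functions X0 X1" "z \<in> closure annulus"
  shows "nrm (sum_space X0 X1) (\<phi> z) \<le> calderon_norm X0 X1 \<phi>"
  using K_functional_le_calderon_norm[OF assms, of 0] by (simp add: nrm_sum_space)

text \<open>
  By the maximum principle the series converges in the sum uniformly on the closed annulus. On a boundary
  circle it converges in the smaller space, and the limit there is also one in the sum, so that a
  single choice of \<open>\<psi> z\<close> serves all three spaces.
\<close>
lemma calderon_functions_series: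
  assumes \<phi>: "\<And>k. \<phi> k \<in> calderon_functions X0 X1"
    and small: "\<And>k. calderon_norm X0 X1 (\<phi> k) \<le> (1/2) ^ k"
  obtains \<psi> where "\<psi> \<in> calderon_functions X0 X1"
    "\<And>n. calderon_norm X0 X1 (\<lambda>z. \<psi> z - (\<Sum>k<n. \<phi> k z)) \<le> 2 * (1/2) ^ n"
proof -
  let ?S = "sum_space X0 X1"
  note normed = couple_normed and mem = calderon_functions_mem[OF \<phi>]
  note S0 = pts_subset_sum_space[OF normed(1,2)] and S1 = nrm_sum_space_le[OF normed(1,2)]
  have bS: "complex_banach_space ?S" by (rule complex_banach_space_sum_space[OF compat])
  have le0: "nrm X0 (\<phi> k z) \<le> 1 * (1/2) ^ k" if "cmod z = 1" for k z
    using order_trans[OF calderon_norm_ge(1)[OF \<phi> that] small] by simp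
  have le1: "nrm X1 (\<phi> k z) \<le> 1 * (1/2) ^ k" if "cmod z = exp 1" for k z
    using order_trans[OF calderon_norm_ge(2)[OF \<phi> that] small] by simp
  have leS: "nrm ?S (\<phi> k z) \<le> 1 * (1/2) ^ k" if "z \<in> closure annulus" for k z
    using order_trans[OF nrm_sum_space_le_calderon_norm[OF \<phi> that] small] by simp
  define lim where "lim X z l \<longleftrightarrow> l \<in> pts X \<and> (\<forall>n. nrm X (l - (\<Sum>k<n. \<phi> k z)) \<le> 2 * (1/2) ^ n)"
    for X :: "'a nspace" and z l
  have "\<exists>l. (z \<in> closure annulus \<longrightarrow> lim ?S z l) \<and> (cmod z = 1 \<longrightarrow> lim X0 z l) \<and>
      (cmod z = exp 1 \<longrightarrow> lim X1 z l)" for z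
  proof -
    consider "cmod z = 1" | "cmod z = exp 1" | "cmod z \<noteq> 1" "cmod z \<noteq> exp 1" "z \<in> closure annulus"
      | "cmod z \<noteq> 1" "cmod z \<noteq> exp 1" "z \<notin> closure annulus" by blast
    then show ?thesis
    proof cases
      case 1
      obtain l where l: "l \<in> pts X0" "\<And>n. nrm X0 (l - (\<Sum>k<n. \<phi> k z)) \<le> 2 * 1 * (1/2) ^ n"
        by (rule geometric_series_converges[OF couple_banach(1) mem(2)[OF 1] le0[OF 1]]) (rule that; assumption)
      have "l - (\<Sum>k<n. \<phi> k z) \<in> pts X0" for n
        using l(1) mem(2)[OF 1] by (intro nspace_diff nspace_sum normed)
      then have "lim X0 z l" "lim ?S z l"
        using l S0(1) order_trans[OF S1(1) l(2)] by (auto simp: lim_def)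
      then show ?thesis using 1 by (intro exI[of _ l]) simp
    next
      case 2
      obtain l where l: "l \<in> pts X1" "\<And>n. nrm X1 (l - (\<Sum>k<n. \<phi> k z)) \<le> 2 * 1 * (1/2) ^ n"
        by (rule geometric_series_converges[OF couple_banach(2) mem(3)[OF 2] le1[OF 2]]) (rule that; assumption)
      have "l - (\<Sum>k<n. \<phi> k z) \<in> pts X1" for n
        using l(1) mem(3)[OF 2] by (intro nspace_diff nspace_sum normed)
      then have "lim X1 z l" "lim ?S z l"
        using l S0(2) order_trans[OF S1(2) l(2)] by (auto simp: lim_def)
      then show ?thesis using 2 by (intro exI[of _ l]) simp
    next
      case 3
      obtain l where "l \<in> pts ?S" "\<And>n. nrm ?S (l - (\<Sum>k<n. \<phi> k z)) \<le> 2 * 1 * (1/2) ^ n"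
        by (rule geometric_series_converges[OF bS mem(1)[OF 3(3)] leS[OF 3(3)]]) (rule that; assumption)
      then have "lim ?S z l" by (simp add: lim_def)
      then show ?thesis using 3 by blast
    qed auto
  qed
  then obtain \<psi> where \<psi>: "\<And>z. z \<in> closure annulus \<Longrightarrow> lim ?S z (\<psi> z)"
      "\<And>z. cmod z = 1 \<Longrightarrow> lim X0 z (\<psi> z)" "\<And>z. cmod z = exp 1 \<Longrightarrow> lim X1 z (\<psi> z)"
    by metis
  have sub: "z \<in> closure annulus" if "z \<in> annulus" for z using that closure_subset by blast
  have \<psi>F: "\<psi> \<in> calderon_functions X0 X1"
    unfolding calderon_functions_def
  proof (intro CollectI conjI)
    show "continuous_map (top_of_set (closure annulus)) (ntop ?S) \<psi>"
      using \<phi> \<psi>(1) by (intro continuous_map_ntop_series[OF normed(3), of _ \<phi> \<psi> 2])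
        (auto simp: calderon_functions_def lim_def)
    show "continuous_map (top_of_set {z. cmod z = 1}) (ntop X0) \<psi>"
      using \<phi> \<psi>(2) by (intro continuous_map_ntop_series[OF normed(1), of _ \<phi> \<psi> 2])
        (auto simp: calderon_functions_def lim_def)
    show "continuous_map (top_of_set {z. cmod z = exp 1}) (ntop X1) \<psi>"
      using \<phi> \<psi>(3) by (intro continuous_map_ntop_series[OF normed(2), of _ \<phi> \<psi> 2])
        (auto simp: calderon_functions_def lim_def)
    show "nspace_holomorphic_on ?S \<psi> annulus"
    proof (rule nspace_holomorphic_on_series[OF bS open_annulus, of \<phi> _ 2])
      show "nspace_holomorphic_on ?S (\<phi> k) annulus" for k
        using \<phi> by (auto simp: calderon_functions_def)
      show "nrm ?S (\<phi> k w) \<le> (1/2) ^ k" if "w \<in> annulus" for k w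
        using leS[OF sub[OF that]] by simp
    qed (use mem(1) \<psi>(1) sub in \<open>auto simp: lim_def\<close>)
  qed
  moreover have "calderon_norm X0 X1 (\<lambda>z. \<psi> z - (\<Sum>k<n. \<phi> k z)) \<le> 2 * (1/2) ^ n" for n
    using \<psi>(2,3) by (intro calderon_norm_le) (auto simp: lim_def)
  ultimately show thesis by (rule that)
qed

lemma calderon_space_eq:
  "calderon_space X0 X1 \<theta> =
    \<lparr>pts = (\<lambda>\<phi>. \<phi> (exp (of_real \<theta>))) ` calderon_functions X0 X1,
     nrm = quotient_norm (calderon_functions X0 X1) (\<lambda>\<phi>. \<phi> (exp (of_real \<theta>))) (calderon_norm X0 X1)\<rparr>"
  unfolding calderon_space_def quotient_norm_def by auto

context
  fixes \<theta> :: real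
  assumes \<theta>: "0 < \<theta>" "\<theta> < 1"
begin

lemma complex_banach_space_calderon_space: "complex_banach_space (calderon_space X0 X1 \<theta>)"
  unfolding calderon_space_eq
proof (rule complex_banach_space_quotient)
  let ?F = "calderon_functions X0 X1" and ?N = "calderon_norm X0 X1"
    and ?p = "exp (of_real \<theta>) :: complex"
  note normed = couple_normed and mem = calderon_functions_mem
  show nonneg: "0 \<le> ?N \<phi>" if "\<phi> \<in> ?F" for \<phi> using that by (rule calderon_norm_nonneg)
  show "seminorm_on ((\<lambda>\<phi>. \<phi> ?p) ` ?F) (quotient_norm ?F (\<lambda>\<phi>. \<phi> ?p) ?N)"
  proof (rule seminorm_on_quotient[OF _ nonneg])
    show "?F \<noteq> {}" using calderon_functions_sum[of "{}"] by auto
    show "\<exists>\<xi>\<in>?F. \<xi> ?p = \<phi> ?p + \<psi> ?p \<and> ?N \<xi> \<le> ?N \<phi> + ?N \<psi>" if "\<phi> \<in> ?F" "\<psi> \<in> ?F" for \<phi> \<psi>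
    proof -
      have "nrm X0 (\<phi> z + \<psi> z) \<le> ?N \<phi> + ?N \<psi>" if z: "cmod z = 1" for z
        using nrm_add[OF normed(1) mem(2)[OF \<open>\<phi> \<in> ?F\<close> z] mem(2)[OF \<open>\<psi> \<in> ?F\<close> z]]
          calderon_norm_ge(1)[OF \<open>\<phi> \<in> ?F\<close> z] calderon_norm_ge(1)[OF \<open>\<psi> \<in> ?F\<close> z] by linarith
      moreover have "nrm X1 (\<phi> z + \<psi> z) \<le> ?N \<phi> + ?N \<psi>" if z: "cmod z = exp 1" for z
        using nrm_add[OF normed(2) mem(3)[OF \<open>\<phi> \<in> ?F\<close> z] mem(3)[OF \<open>\<psi> \<in> ?F\<close> z]]
          calderon_norm_ge(2)[OF \<open>\<phi> \<in> ?F\<close> z] calderon_norm_ge(2)[OF \<open>\<psi> \<in> ?F\<close> z] by linarith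
      ultimately have "?N (\<lambda>z. \<phi> z + \<psi> z) \<le> ?N \<phi> + ?N \<psi>" by (rule calderon_norm_le)
      then show ?thesis using calderon_functions_add[OF that] by (intro bexI[of _ "\<lambda>z. \<phi> z + \<psi> z"]) auto
    qed
    show "\<exists>\<xi>\<in>?F. \<xi> ?p = c *\<^sub>C \<phi> ?p \<and> ?N \<xi> \<le> cmod c * ?N \<phi>" if \<phi>: "\<phi> \<in> ?F" for c \<phi>
    proof -
      have "?N (\<lambda>z. c *\<^sub>C \<phi> z) \<le> cmod c * ?N \<phi>"
        by (rule calderon_norm_le)
          (use mem[OF \<phi>] calderon_norm_ge[OF \<phi>] in \<open>auto simp: nrm_scale normed intro!: mult_left_mono\<close>)
      then show ?thesis using calderon_functions_scale[OF \<phi>] by (intro bexI[of _ "\<lambda>z. c *\<^sub>C \<phi> z"]) auto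
    qed
  qed
  show "x = 0" if small: "\<And>\<epsilon>. 0 < \<epsilon> \<Longrightarrow> \<exists>\<phi>\<in>?F. \<phi> ?p = x \<and> ?N \<phi> < \<epsilon>" for x
  proof -
    let ?S = "sum_space X0 X1"
    have p: "?p \<in> closure annulus" using exp_in_annulus[OF \<theta>] closure_subset by blast
    have x: "x \<in> pts ?S" using small[of 1] mem(1)[OF _ p] by auto
    have "nrm ?S x < \<epsilon>" if "0 < \<epsilon>" for \<epsilon>
      using small[OF that] nrm_sum_space_le_calderon_norm[OF _ p] by fastforce
    then have "nrm ?S x \<le> 0" by (meson dense_ge less_imp_le)
    then show ?thesis using nrm_nonneg[OF normed(3) x] nrm_eq_0[OF normed(3) x] by simp
  qed
  show "\<exists>\<psi>\<in>?F. \<exists>C. \<forall>n. \<exists>\<xi>\<in>?F. \<xi> ?p = \<psi> ?p - (\<Sum>k<n. \<phi> k ?p) \<and> ?N \<xi> \<le> C * (1/2) ^ n"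
    if \<phi>: "\<And>k. \<phi> k \<in> ?F" "\<And>k. ?N (\<phi> k) \<le> (1/2) ^ k" for \<phi>
  proof -
    obtain \<psi> where \<psi>: "\<psi> \<in> ?F" "\<And>n. ?N (\<lambda>z. \<psi> z - (\<Sum>k<n. \<phi> k z)) \<le> 2 * (1/2) ^ n"
      by (rule calderon_functions_series[OF \<phi>]) (rule that; assumption)
    have "(\<lambda>z. \<psi> z + (- 1) *\<^sub>C (\<Sum>k<n. \<phi> k z)) \<in> ?F" for n
      by (intro calderon_functions_add calderon_functions_scale calderon_functions_sum \<psi>(1) \<phi>(1))
    then have "(\<lambda>z. \<psi> z - (\<Sum>k<n. \<phi> k z)) \<in> ?F" for n by (simp add: scaleC_one)
    then have "\<exists>\<xi>\<in>?F. \<xi> ?p = \<psi> ?p - (\<Sum>k<n. \<phi> k ?p) \<and> ?N \<xi> \<le> 2 * (1/2) ^ n" for n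
      using \<psi>(2)[of n] by (intro bexI[of _ "\<lambda>z. \<psi> z - (\<Sum>k<n. \<phi> k z)"]) auto
    then show ?thesis using \<psi>(1) by blast
  qed
qed

text \<open>
  The upper estimate for the interpolation norm: \<open>y\<close> is the value at \<open>exp \<theta>\<close> of the function
  \<open>(exp \<theta> / z) ^ n y\<close>. As \<open>n\<close> grows the weight of the norm of \<open>X1\<close> tends to 0.
\<close>
lemma calderon_space_mem_and_nrm_le:
  assumes y: "y \<in> pts X0" "y \<in> pts X1"
  shows "y \<in> pts (calderon_space X0 X1 \<theta>)"
    and "nrm (calderon_space X0 X1 \<theta>) y \<le> max (exp \<theta> ^ n * nrm X0 y) (exp (\<theta> - 1) ^ n * nrm X1 y)"
proof -
  let ?p = "exp (of_real \<theta>) :: complex"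
  define \<phi> where "\<phi> z = (?p / z) ^ n *\<^sub>C y" for z
  have "(\<lambda>z. (?p / z) ^ n) holomorphic_on - {0}" by (intro holomorphic_intros) auto
  then have \<phi>: "\<phi> \<in> calderon_functions X0 X1"
    unfolding \<phi>_def using y by (rule calderon_functions_scaleC_left)
  have \<phi>p: "\<phi> ?p = y" by (simp add: \<phi>_def scaleC_one)
  with \<phi> show "y \<in> pts (calderon_space X0 X1 \<theta>)" by (force simp: calderon_space_eq)
  have "nrm (calderon_space X0 X1 \<theta>) y \<le> calderon_norm X0 X1 \<phi>"
    using \<phi> \<phi>p calderon_norm_nonneg by (auto simp: calderon_space_eq intro: quotient_norm_le)
  also have "\<dots> \<le> max (exp \<theta> ^ n * nrm X0 y) (exp (\<theta> - 1) ^ n * nrm X1 y)"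
    by (rule calderon_norm_le)
      (simp_all add: \<phi>_def nrm_scale[OF couple_normed(1) y(1)] nrm_scale[OF couple_normed(2) y(2)]
        norm_power norm_divide exp_diff)
  finally show "nrm (calderon_space X0 X1 \<theta>) y \<le> max (exp \<theta> ^ n * nrm X0 y) (exp (\<theta> - 1) ^ n * nrm X1 y)" .
qed

lemma ex_weight_small:
  assumes "0 < (\<epsilon>::real)"
  obtains n where "exp (\<theta> - 1) ^ n * M < \<epsilon>"
proof -
  have "(\<lambda>n. exp (\<theta> - 1) ^ n * M) \<longlonglongrightarrow> 0 * M"
    using \<theta> by (intro tendsto_intros LIMSEQ_power_zero) simp
  then have "\<forall>\<^sub>F n in sequentially. exp (\<theta> - 1) ^ n * M < \<epsilon>"
    using assms by (intro order_tendstoD(2)) auto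
  then show thesis using that by (auto simp: eventually_sequentially)
qed

text \<open>
  On sets bounded in \<open>X1\<close>, convergence in \<open>X0\<close> implies convergence in the interpolation space: first
  choose \<open>n\<close> so large that the \<open>X1\<close>-term is negligible, then \<open>\<delta>\<close> against the \<open>X0\<close>-weight.
\<close>
lemma calderon_space_nrm_small:
  assumes "0 < \<epsilon>"
  obtains \<delta> where "0 < \<delta>"
    "\<And>y. y \<in> pts X0 \<Longrightarrow> y \<in> pts X1 \<Longrightarrow> nrm X0 y < \<delta> \<Longrightarrow> nrm X1 y \<le> M \<Longrightarrow>
      nrm (calderon_space X0 X1 \<theta>) y < \<epsilon>"
proof -
  obtain n where n: "exp (\<theta> - 1) ^ n * M < \<epsilon>" using ex_weight_small[OF assms] by blast
  show thesis
  proof (rule that[of "\<epsilon> / exp \<theta> ^ n"])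
    show "0 < \<epsilon> / exp \<theta> ^ n" using assms by simp
    fix y assume y: "y \<in> pts X0" "y \<in> pts X1" "nrm X0 y < \<epsilon> / exp \<theta> ^ n" "nrm X1 y \<le> M"
    have "exp \<theta> ^ n * nrm X0 y < \<epsilon>" using y(3) by (simp add: field_simps)
    moreover have "exp (\<theta> - 1) ^ n * nrm X1 y \<le> exp (\<theta> - 1) ^ n * M"
      using y(4) by (intro mult_left_mono) auto
    ultimately show "nrm (calderon_space X0 X1 \<theta>) y < \<epsilon>"
      using calderon_space_mem_and_nrm_le(2)[OF y(1,2), of n] n by linarith
  qed
qed

lemma calderon_space_in_sum_space:
  assumes x: "x \<in> pts (calderon_space X0 X1 \<theta>)"
  shows "x \<in> pts (sum_space X0 X1)"
    and "nrm (sum_space X0 X1) x \<le> nrm (calderon_space X0 X1 \<theta>) x"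
proof -
  have p: "exp (of_real \<theta>) \<in> closure annulus" using exp_in_annulus[OF \<theta>] closure_subset by blast
  show "x \<in> pts (sum_space X0 X1)"
    using x calderon_functions_mem(1)[OF _ p] by (auto simp: calderon_space_eq)
  show "nrm (sum_space X0 X1) x \<le> nrm (calderon_space X0 X1 \<theta>) x"
    using x nrm_sum_space_le_calderon_norm[OF _ p]
    by (auto simp: calderon_space_eq intro!: quotient_norm_ge) (metis)
qed

text \<open>
  A bounded set of the interpolation space lies in the sum of a bounded set of \<open>X0\<close> and an arbitrarily
  small ball of \<open>X1\<close>: the weight \<open>exp (1 - \<theta>) ^ n\<close> of the K-functional on \<open>X1\<close> grows with \<open>n\<close>.
\<close>
lemma calderon_space_decompose:
  assumes "0 < \<eta>"
  obtains C where "\<And>x. x \<in> pts (calderon_space X0 X1 \<theta>) \<Longrightarrow> nrm (calderon_space X0 X1 \<theta>) x < R \<Longrightarrow>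
    \<exists>u\<in>pts X0. \<exists>v\<in>pts X1. x = u + v \<and> nrm X0 u \<le> C \<and> nrm X1 v \<le> \<eta>"
proof -
  let ?p = "exp (of_real \<theta>) :: complex"
  have p: "?p \<in> closure annulus" using exp_in_annulus[OF \<theta>] closure_subset by blast
  obtain n where n: "exp (\<theta> - 1) ^ n * R < \<eta>" using ex_weight_small[OF assms] by blast
  show thesis
  proof (rule that[of "exp \<theta> ^ n * R"])
    fix x assume x: "x \<in> pts (calderon_space X0 X1 \<theta>)" "nrm (calderon_space X0 X1 \<theta>) x < R"
    then obtain \<phi> where \<phi>: "\<phi> \<in> calderon_functions X0 X1" "\<phi> ?p = x" "calderon_norm X0 X1 \<phi> < R"
      using quotient_norm_less[of x "\<lambda>\<phi>. \<phi> ?p" "calderon_functions X0 X1" "calderon_norm X0 X1" R]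
      by (auto simp: calderon_space_eq)
    have "K_functional ((1 / exp \<theta>) ^ n) ((exp 1 / exp \<theta>) ^ n) X0 X1 x < R"
      using K_functional_le_calderon_norm[OF \<phi>(1) p, of n] \<phi>(2,3) by simp
    then obtain u v where uv: "u \<in> pts X0" "v \<in> pts X1" "x = u + v"
        "(1 / exp \<theta>) ^ n * nrm X0 u + (exp 1 / exp \<theta>) ^ n * nrm X1 v < R"
      by (rule K_functional_less[OF calderon_space_in_sum_space(1)[OF x(1)]]) (rule that; assumption)
    have "0 \<le> (1 / exp \<theta>) ^ n * nrm X0 u" "0 \<le> (exp 1 / exp \<theta>) ^ n * nrm X1 v"
      using nrm_nonneg[OF couple_normed(1) uv(1)] nrm_nonneg[OF couple_normed(2) uv(2)] by auto
    then have le: "(1 / exp \<theta>) ^ n * nrm X0 u \<le> R" "(exp 1 / exp \<theta>) ^ n * nrm X1 v \<le> R"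
      using uv(4) by linarith+
    have "nrm X0 u \<le> exp \<theta> ^ n * R" using le(1) by (simp add: power_divide field_simps)
    moreover have "nrm X1 v \<le> exp (\<theta> - 1) ^ n * R"
      using le(2) by (simp add: power_divide field_simps exp_diff)
    ultimately show "\<exists>u\<in>pts X0. \<exists>v\<in>pts X1. x = u + v \<and> nrm X0 u \<le> exp \<theta> ^ n * R \<and> nrm X1 v \<le> \<eta>"
      using uv n by (intro bexI[OF _ uv(1)] bexI[OF _ uv(2)]) auto
  qed
qed

end

end

section \<open>Homogeneous polynomials and polarization\<close>

lemma multilinear_map_zero:
  assumes A: "multilinear_map m V W A" and V: "cvec.subspace V"
    and x: "x \<in> {..<m} \<rightarrow>\<^sub>E V" and i: "i < m"
  shows "A (x(i := 0)) = 0"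
proof -
  have "A (x(i := 0 *\<^sub>C 0)) = 0 *\<^sub>C A (x(i := 0))"
    using A x i cvec.subspace_0[OF V] unfolding multilinear_map_def by blast
  then show ?thesis by simp
qed

lemma multilinear_map_sum:
  assumes A: "multilinear_map m V W A" and V: "cvec.subspace V"
    and x: "x \<in> {..<m} \<rightarrow>\<^sub>E V" and i: "i < m" and w: "\<And>j. j \<in> S \<Longrightarrow> w j \<in> V"
  shows "A (x(i := \<Sum>j\<in>S. w j)) = (\<Sum>j\<in>S. A (x(i := w j)))"
  using w
proof (induction S rule: infinite_finite_induct)
  case (insert j S)
  have "sum w S \<in> V" "w j \<in> V" using insert cvec.subspace_sum[OF V, of S w] by auto
  then have "A (x(i := w j + sum w S)) = A (x(i := w j)) + A (x(i := sum w S))"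
    using A x i unfolding multilinear_map_def by blast
  moreover have "A (x(i := sum w S)) = (\<Sum>j\<in>S. A (x(i := w j)))"
    using insert.prems by (intro insert.IH) auto
  ultimately show ?case by (simp only: sum.insert[OF insert.hyps])
qed (simp_all add: multilinear_map_zero[OF A V x i])

text \<open>
  The slots are expanded one after the other; the entries \<open>y\<close> of the slots not yet treated vary during
  the induction, since slot \<open>n\<close> holds the full sum while the earlier ones are expanded.
\<close>
lemma multilinear_map_expand_first:
  assumes A: "multilinear_map m V W A" and V: "cvec.subspace V"
    and w: "\<And>j. j \<in> S \<Longrightarrow> w j \<in> V" and "n \<le> m" and "y \<in> {..<m} \<rightarrow>\<^sub>E V"
  shows "A (\<lambda>i\<in>{..<m}. if i < n then \<Sum>j\<in>S. w j else y i) =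
    (\<Sum>k\<in>{..<n} \<rightarrow>\<^sub>E S. A (\<lambda>i\<in>{..<m}. if i < n then w (k i) else y i))"
  using \<open>n \<le> m\<close> \<open>y \<in> {..<m} \<rightarrow>\<^sub>E V\<close>
proof (induction n arbitrary: y)
  case (Suc n)
  have n: "n < m" using Suc.prems by simp
  have s: "sum w S \<in> V" using cvec.subspace_sum[OF V, of S w] w by simp
  define G where "G k = (\<lambda>i\<in>{..<m}. if i < n then w (k i) else y i)" for k
  have G: "G k \<in> {..<m} \<rightarrow>\<^sub>E V" if "k \<in> {..<n} \<rightarrow>\<^sub>E S" for k
    using that Suc.prems w by (auto simp: G_def PiE_iff)
  have ys: "y(n := sum w S) \<in> {..<m} \<rightarrow>\<^sub>E V"
    using Suc.prems(2) s n by (auto simp: PiE_iff extensional_def)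
  have "A (\<lambda>i\<in>{..<m}. if i < Suc n then sum w S else y i) =
      A (\<lambda>i\<in>{..<m}. if i < n then sum w S else (y(n := sum w S)) i)"
    by (intro arg_cong[where f = A] restrict_ext) (auto simp: less_Suc_eq)
  also have "\<dots> = (\<Sum>k\<in>{..<n} \<rightarrow>\<^sub>E S. A (\<lambda>i\<in>{..<m}. if i < n then w (k i) else (y(n := sum w S)) i))"
    using n by (intro Suc.IH ys) simp
  also have "\<dots> = (\<Sum>k\<in>{..<n} \<rightarrow>\<^sub>E S. A ((G k)(n := sum w S)))"
  proof (intro sum.cong refl arg_cong[where f = A])
    fix k
    show "(\<lambda>i\<in>{..<m}. if i < n then w (k i) else (y(n := sum w S)) i) = (G k)(n := sum w S)"
      using n by (auto simp: G_def fun_eq_iff)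
  qed
  also have "\<dots> = (\<Sum>k\<in>{..<n} \<rightarrow>\<^sub>E S. \<Sum>j\<in>S. A ((G k)(n := w j)))"
  proof (intro sum.cong refl)
    fix k assume k: "k \<in> {..<n} \<rightarrow>\<^sub>E S"
    show "A ((G k)(n := sum w S)) = (\<Sum>j\<in>S. A ((G k)(n := w j)))"
      by (rule multilinear_map_sum[OF A V G[OF k] n w])
  qed
  also have "\<dots> = (\<Sum>(j, k)\<in>S \<times> ({..<n} \<rightarrow>\<^sub>E S). A ((G k)(n := w j)))"
    by (subst sum.swap) (rule sum.cartesian_product)
  also have "\<dots> = (\<Sum>(j, k)\<in>S \<times> ({..<n} \<rightarrow>\<^sub>E S).
      A (\<lambda>i\<in>{..<m}. if i < Suc n then w ((k(n := j)) i) else y i))"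
  proof (intro sum.cong refl)
    have "(G k)(n := w j) = (\<lambda>i\<in>{..<m}. if i < Suc n then w ((k(n := j)) i) else y i)" for j k
      using n by (auto simp: G_def fun_eq_iff less_Suc_eq)
    then show "(case p of (j, k) \<Rightarrow> A ((G k)(n := w j))) =
        (case p of (j, k) \<Rightarrow> A (\<lambda>i\<in>{..<m}. if i < Suc n then w ((k(n := j)) i) else y i))" for p
      by (simp only: split_beta)
  qed
  also have "\<dots> = (\<Sum>k\<in>{..<Suc n} \<rightarrow>\<^sub>E S. A (\<lambda>i\<in>{..<m}. if i < Suc n then w (k i) else y i))"
    unfolding lessThan_Suc PiE_insert_eq
    by (subst sum.reindex[OF inj_combinator]) (auto simp: comp_def case_prod_unfold intro!: sum.cong)
  finally show ?case .
qed simp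

lemma multilinear_map_expand:
  assumes A: "multilinear_map m V W A" and V: "cvec.subspace V" and w: "\<And>j. j \<in> S \<Longrightarrow> w j \<in> V"
  shows "A (\<lambda>i\<in>{..<m}. \<Sum>j\<in>S. w j) = (\<Sum>k\<in>{..<m} \<rightarrow>\<^sub>E S. A (\<lambda>i\<in>{..<m}. w (k i)))"
proof -
  have r: "(\<lambda>i\<in>{..<m}. if i < m then g i else h i) = (\<lambda>i\<in>{..<m}. g i)" for g h :: "nat \<Rightarrow> 'a"
    by auto
  have "(\<lambda>i\<in>{..<m}. 0) \<in> {..<m} \<rightarrow>\<^sub>E V" using cvec.subspace_0[OF V] by auto
  from multilinear_map_expand_first[OF A V w order_refl this] show ?thesis
    unfolding r .
qed

lemma homogeneous_polynomial_scale:
  assumes P: "homogeneous_polynomial m V W P" and V: "cvec.subspace V" and x: "x \<in> V"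
  shows "P (c *\<^sub>C x) = c ^ m *\<^sub>C P x"
proof -
  obtain A where A: "multilinear_map m V W A" "\<And>x. x \<in> V \<Longrightarrow> P x = A (\<lambda>i\<in>{..<m}. x)"
    using P unfolding homogeneous_polynomial_def by blast
  have cx: "c *\<^sub>C x \<in> V" using V x by (rule cvec.subspace_scale)
  have "A (\<lambda>i\<in>{..<m}. if i < n then c *\<^sub>C x else x) = c ^ n *\<^sub>C A (\<lambda>i\<in>{..<m}. x)" if "n \<le> m" for n
    using that
  proof (induction n)
    case (Suc n)
    define y where "y = (\<lambda>i\<in>{..<m}. if i < n then c *\<^sub>C x else x)"
    have y: "y \<in> {..<m} \<rightarrow>\<^sub>E V" using x cx by (auto simp: y_def)
    have n: "n < m" using Suc.prems by simp
    have "(\<lambda>i\<in>{..<m}. if i < Suc n then c *\<^sub>C x else x) = y(n := c *\<^sub>C x)" "y(n := x) = y"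
      using n by (auto simp: y_def fun_eq_iff less_Suc_eq)
    moreover have "A (y(n := c *\<^sub>C x)) = c *\<^sub>C A (y(n := x))"
      using A(1) y n x unfolding multilinear_map_def by blast
    moreover have "A y = c ^ n *\<^sub>C A (\<lambda>i\<in>{..<m}. x)"
      unfolding y_def using Suc.prems by (intro Suc.IH) simp
    ultimately show ?case by (simp only: scaleC_scaleC power_Suc)
  qed (simp add: scaleC_one)
  moreover have "(\<lambda>i\<in>{..<m}. if i < m then c *\<^sub>C x else x) = (\<lambda>i\<in>{..<m}. c *\<^sub>C x)" by auto
  ultimately show ?thesis using A(2)[OF x] A(2)[OF cx] by (metis order_refl)
qed

lemma homogeneous_polynomial_subset:
  assumes "homogeneous_polynomial m V W P" "V' \<subseteq> V"
  shows "homogeneous_polynomial m V' W P"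
proof -
  obtain A where A: "multilinear_map m V W A" "\<forall>x\<in>V. P x = A (\<lambda>i\<in>{..<m}. x)"
    using assms(1) unfolding homogeneous_polynomial_def by blast
  have "x \<in> {..<m} \<rightarrow>\<^sub>E V" if "x \<in> {..<m} \<rightarrow>\<^sub>E V'" for x
    using that assms(2) by (auto simp: PiE_iff)
  then have "multilinear_map m V' W A"
    using A(1) subsetD[OF assms(2)] unfolding multilinear_map_def by simp
  then show ?thesis
    using A(2) assms(2) unfolding homogeneous_polynomial_def by blast
qed

text \<open>
  Symmetrizing a multilinear map that represents \<open>P\<close> leaves its diagonal unchanged, and the result is an
  alternating sum of values of \<open>P\<close>. For the latter, expand each value \<open>P (\<Sum>i\<in>S. x i)\<close> into the terms
  \<open>A (x \<circ> k)\<close> with \<open>k\<close> mapping into \<open>S\<close>. A self-map \<open>k\<close> of the index set is then counted with the sum of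
  the signs of all \<open>S\<close> that contain its range, which vanishes unless \<open>k\<close> is onto, and so a permutation.
  Both descriptions of \<open>B\<close> are needed: the first shows that \<open>B\<close> is multilinear, the second that its
  values stay in every subspace that contains the values of \<open>P\<close>, and that bounds for \<open>P\<close> bound \<open>B\<close>.
\<close>
theorem polarization:
  assumes P: "homogeneous_polynomial m V W P" and V: "cvec.subspace V"
  obtains B where
    "\<And>W'. cvec.subspace W' \<Longrightarrow> P ` V \<subseteq> W' \<Longrightarrow> multilinear_map m V W' B"
    "\<And>x. x \<in> V \<Longrightarrow> P x = B (\<lambda>i\<in>{..<m}. x)"
    "\<And>x. x \<in> {..<m} \<rightarrow>\<^sub>E V \<Longrightarrow>
      B x = inverse (fact m) *\<^sub>C (\<Sum>S\<in>Pow {..<m}. (- 1) ^ (m + card S) *\<^sub>C P (\<Sum>i\<in>S. x i))"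
proof -
  obtain A where A: "multilinear_map m V W A" "\<And>x. x \<in> V \<Longrightarrow> P x = A (\<lambda>i\<in>{..<m}. x)"
    using P unfolding homogeneous_polynomial_def by blast
  define U where "U = {..<m}"
  have U: "finite U" "card U = m" by (simp_all add: U_def)
  define K where "K = {k \<in> U \<rightarrow>\<^sub>E U. inj_on k U}"
  have finE: "finite (U \<rightarrow>\<^sub>E U)" using U by (intro finite_PiE) auto
  have "card K = prod ((-) m) {0..<m}"
    unfolding K_def using card_inj_on_subset_funcset[OF U(1,1) subset_refl] by (simp add: U)
  then have cardK: "of_nat (card K) = (fact m :: complex)" by (simp add: fact_prod_rev)
  define B where "B x = inverse (fact m) *\<^sub>C (\<Sum>k\<in>K. A (\<lambda>i\<in>U. x (k i)))" for x
  have formula: "B x = inverse (fact m) *\<^sub>C (\<Sum>S\<in>Pow U. (- 1) ^ (m + card S) *\<^sub>C P (\<Sum>i\<in>S. x i))"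
    if x: "x \<in> U \<rightarrow>\<^sub>E V" for x
  proof -
    define G where "G k = A (\<lambda>i\<in>U. x (k i))" for k
    have expand: "P (\<Sum>i\<in>S. x i) = (\<Sum>k\<in>{k. k \<in> U \<rightarrow>\<^sub>E U \<and> k ` U \<subseteq> S}. G k)" if S: "S \<in> Pow U" for S
    proof -
      have xS: "x j \<in> V" if "j \<in> S" for j using x S that by auto
      have "P (\<Sum>i\<in>S. x i) = A (\<lambda>i\<in>U. \<Sum>j\<in>S. x j)"
        using A(2)[OF cvec.subspace_sum[OF V, of S x]] xS by (simp add: U_def)
      also have "\<dots> = (\<Sum>k\<in>U \<rightarrow>\<^sub>E S. G k)"
        using multilinear_map_expand[OF A(1) V xS] by (simp add: U_def G_def)
      also have "U \<rightarrow>\<^sub>E S = {k. k \<in> U \<rightarrow>\<^sub>E U \<and> k ` U \<subseteq> S}"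
        using S by (auto simp: PiE_iff extensional_def)
      finally show ?thesis .
    qed
    \<comment> \<open>among the sets between a proper subset and \<open>U\<close>, as many are even as odd\<close>
    have signs: "(\<Sum>S\<in>{S. S \<in> Pow U \<and> k ` U \<subseteq> S}. (- 1) ^ (m + card S)) = (if inj_on k U then 1 else 0 :: complex)"
      if k: "k \<in> U \<rightarrow>\<^sub>E U" for k
    proof (cases "inj_on k U")
      case True
      have "k ` U \<subseteq> U" using k by auto
      then have "k ` U = U" using True U(1) by (intro endo_inj_surj)
      then have "{S. S \<in> Pow U \<and> k ` U \<subseteq> S} = {U}" by auto
      then show ?thesis using True U by (simp add: power_add[symmetric] flip: mult_2)
    next
      case False
      then have "k ` U \<noteq> U" using U(1) eq_card_imp_inj_on by metis
      moreover have "k ` U \<subseteq> U" using k by auto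
      ultimately have sub: "k ` U \<subset> U" by blast
      have "card {S. S \<subseteq> U \<and> k ` U \<subseteq> S \<and> even (card S)} = card {S. S \<subseteq> U \<and> k ` U \<subseteq> S \<and> odd (card S)}"
        using card_subsupersets_even_odd[OF U(1) sub] .
      then have "(\<Sum>S\<in>{S. S \<in> Pow U \<and> k ` U \<subseteq> S}. (- 1) ^ card S) = (0 :: complex)"
        using U(1) by (intro sum_alternating_cancels) (auto simp: conj_assoc)
      then show ?thesis using False by (simp add: power_add flip: sum_distrib_left)
    qed
    have "(\<Sum>S\<in>Pow U. (- 1) ^ (m + card S) *\<^sub>C P (\<Sum>i\<in>S. x i)) =
        (\<Sum>S\<in>Pow U. \<Sum>k\<in>{k. k \<in> U \<rightarrow>\<^sub>E U \<and> k ` U \<subseteq> S}. (- 1) ^ (m + card S) *\<^sub>C G k)"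
      by (intro sum.cong refl) (simp add: expand cvec.scale_sum_right)
    also have "\<dots> = (\<Sum>k\<in>U \<rightarrow>\<^sub>E U. \<Sum>S\<in>{S. S \<in> Pow U \<and> k ` U \<subseteq> S}. (- 1) ^ (m + card S) *\<^sub>C G k)"
      using U(1) finE by (intro sum.swap_restrict) auto
    also have "\<dots> = (\<Sum>k\<in>U \<rightarrow>\<^sub>E U. (if inj_on k U then 1 else 0) *\<^sub>C G k)"
      by (intro sum.cong refl) (simp only: cvec.scale_sum_left[symmetric] signs)
    also have "\<dots> = (\<Sum>k\<in>K. G k)"
      unfolding K_def sum.inter_filter[OF finE] by (intro sum.cong) (auto simp: scaleC_one)
    finally show ?thesis by (simp add: B_def G_def)
  qed
  have "multilinear_map m V W' B" if W': "cvec.subspace W'" "P ` V \<subseteq> W'" for W'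
    unfolding multilinear_map_def U_def[symmetric]
  proof (intro ballI conjI allI impI)
    fix x assume x: "x \<in> U \<rightarrow>\<^sub>E V"
    have "P (\<Sum>i\<in>S. x i) \<in> W'" if S: "S \<in> Pow U" for S
    proof -
      have "(\<Sum>i\<in>S. x i) \<in> V" using x S by (intro cvec.subspace_sum[OF V]) auto
      then show ?thesis using W'(2) by blast
    qed
    then show "B x \<in> W'"
      unfolding formula[OF x]
      by (intro cvec.subspace_scale[OF W'(1)] cvec.subspace_sum[OF W'(1)])
    fix i assume i: "i < m"
    \<comment> \<open>changing entry \<open>i\<close> of \<open>x\<close> changes only the slot that \<open>k\<close> maps to \<open>i\<close>\<close>
    have upd: "\<exists>j<m. \<forall>u. (\<lambda>l\<in>U. (x(i := u)) (k l)) = (\<lambda>l\<in>U. x (k l))(j := u)" if k: "k \<in> K" for k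
    proof -
      have inj: "inj_on k U" and "k ` U \<subseteq> U" using k by (auto simp: K_def)
      then have "k ` U = U" using U(1) by (intro endo_inj_surj)
      moreover have "i \<in> U" using i by (simp add: U_def)
      ultimately obtain j where j: "j \<in> U" "k j = i" by (metis imageE)
      have "k l = i \<longleftrightarrow> l = j" if "l \<in> U" for l using inj j that by (auto dest: inj_onD)
      then have "(\<lambda>l\<in>U. (x(i := u)) (k l)) = (\<lambda>l\<in>U. x (k l))(j := u)" for u
        using j(1) by (auto simp: fun_eq_iff)
      then show ?thesis using j(1) by (auto simp: U_def)
    qed
    have xk: "(\<lambda>l\<in>U. x (k l)) \<in> {..<m} \<rightarrow>\<^sub>E V" if k: "k \<in> K" for k
      using k x by (auto simp: U_def K_def PiE_iff)
    show "B (x(i := u + v)) = B (x(i := u)) + B (x(i := v))" if uv: "u \<in> V" "v \<in> V" for u v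
    proof -
      have "A (\<lambda>l\<in>U. (x(i := u + v)) (k l)) = A (\<lambda>l\<in>U. (x(i := u)) (k l)) + A (\<lambda>l\<in>U. (x(i := v)) (k l))"
        if k: "k \<in> K" for k
      proof -
        obtain j where j: "j < m" "\<And>u. (\<lambda>l\<in>U. (x(i := u)) (k l)) = (\<lambda>l\<in>U. x (k l))(j := u)"
          using upd[OF k] by blast
        show ?thesis unfolding j(2) using A(1) xk[OF k] j(1) uv unfolding multilinear_map_def by blast
      qed
      then show ?thesis by (simp add: B_def sum.distrib scaleC_add_right cong: sum.cong)
    qed
    show "B (x(i := c *\<^sub>C u)) = c *\<^sub>C B (x(i := u))" if u: "u \<in> V" for c u
    proof -
      have "A (\<lambda>l\<in>U. (x(i := c *\<^sub>C u)) (k l)) = c *\<^sub>C A (\<lambda>l\<in>U. (x(i := u)) (k l))"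
        if k: "k \<in> K" for k
      proof -
        obtain j where j: "j < m" "\<And>u. (\<lambda>l\<in>U. (x(i := u)) (k l)) = (\<lambda>l\<in>U. x (k l))(j := u)"
          using upd[OF k] by blast
        show ?thesis unfolding j(2) using A(1) xk[OF k] j(1) u unfolding multilinear_map_def by blast
      qed
      then show ?thesis
        by (simp add: B_def mult.commute flip: cvec.scale_sum_right cong: sum.cong)
    qed
  qed
  moreover have "P x = B (\<lambda>i\<in>{..<m}. x)" if x: "x \<in> V" for x
  proof -
    have "A (\<lambda>i\<in>U. (\<lambda>i\<in>U. x) (k i)) = P x" if k: "k \<in> K" for k
    proof -
      have "(\<lambda>i\<in>U. (\<lambda>i\<in>U. x) (k i)) = (\<lambda>i\<in>U. x)" using k by (auto simp: K_def fun_eq_iff)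
      then show ?thesis using A(2)[OF x] by (simp add: U_def)
    qed
    then have "B (\<lambda>i\<in>U. x) = inverse (fact m) *\<^sub>C (\<Sum>k\<in>K. 1 *\<^sub>C P x)"
      by (simp add: B_def scaleC_one)
    also have "\<dots> = (inverse (fact m) * of_nat (card K)) *\<^sub>C P x"
      unfolding cvec.scale_sum_left[symmetric] by (simp add: scaleC_scaleC)
    finally show ?thesis by (simp add: cardK scaleC_one U_def)
  qed
  ultimately show thesis using that formula unfolding U_def by blast
qed

text \<open>
  A multilinear map that represents \<open>P\<close> on the diagonal may leave \<open>W'\<close> elsewhere; the polarized one does
  not.
\<close>
corollary homogeneous_polynomial_codomain:
  assumes "homogeneous_polynomial m V W P" "cvec.subspace V" "cvec.subspace W'" "P ` V \<subseteq> W'"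
  shows "homogeneous_polynomial m V W' P"
proof -
  obtain B where "\<And>W'. cvec.subspace W' \<Longrightarrow> P ` V \<subseteq> W' \<Longrightarrow> multilinear_map m V W' B"
    "\<And>x. x \<in> V \<Longrightarrow> P x = B (\<lambda>i\<in>{..<m}. x)"
    using polarization[OF assms(1,2)] by metis
  then show ?thesis unfolding homogeneous_polynomial_def using assms(3,4) by blast
qed

lemma homogeneous_polynomial_bounded:
  assumes X: "complex_normed_space X" and Y: "complex_normed_space Y"
    and P: "homogeneous_polynomial m (pts X) (pts Y) P" and cont: "continuous_map (ntop X) (ntop Y) P"
  obtains M where "\<And>x. x \<in> pts X \<Longrightarrow> nrm X x \<le> R \<Longrightarrow> nrm Y (P x) \<le> M"
proof -
  have PY: "P x \<in> pts Y" if "x \<in> pts X" for x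
    using cont that by (auto simp: continuous_map_ntop_ntop[OF X Y])
  obtain \<delta> where \<delta>: "0 < \<delta>" "\<And>x. x \<in> pts X \<Longrightarrow> nrm X x < \<delta> \<Longrightarrow> nrm Y (P x - P 0) < 1"
    using cont nspace_zero[OF X] zero_less_one unfolding continuous_map_ntop_ntop[OF X Y]
    by (metis diff_zero)
  define c where "c = \<delta> / (\<bar>R\<bar> + 1)"
  have c: "0 < c" using \<delta>(1) by (simp add: c_def add_nonneg_pos)
  show thesis
  proof (rule that[of "inverse (c ^ m) * (1 + nrm Y (P 0))"])
    fix x assume x: "x \<in> pts X" "nrm X x \<le> R"
    have cx: "of_real c *\<^sub>C x \<in> pts X" using x(1) by (rule nspace_scale[OF X])
    have "nrm X (of_real c *\<^sub>C x) = c * nrm X x" using nrm_scale[OF X x(1)] c by simp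
    also have "\<dots> \<le> c * R" using x(2) c by (intro mult_left_mono) auto
    also have "\<dots> < \<delta>" using \<delta>(1) by (auto simp: c_def divide_simps add_nonneg_pos)
    finally have "nrm Y (P (of_real c *\<^sub>C x) - P 0) < 1" using \<delta>(2) cx by blast
    then have "nrm Y (P (of_real c *\<^sub>C x)) \<le> 1 + nrm Y (P 0)"
      using nrm_add[OF Y nspace_diff[OF Y PY[OF cx] PY[OF nspace_zero[OF X]]] PY[OF nspace_zero[OF X]]]
      by simp
    moreover have "nrm Y (P (of_real c *\<^sub>C x)) = c ^ m * nrm Y (P x)"
      using homogeneous_polynomial_scale[OF P nspace_subspace[OF X] x(1)] nrm_scale[OF Y PY[OF x(1)]] c
      by (simp add: norm_power)
    ultimately show "nrm Y (P x) \<le> inverse (c ^ m) * (1 + nrm Y (P 0))"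
      using c by (simp add: field_simps)
  qed
qed

text \<open>
  The polarized map \<open>B\<close> is bounded on bounded sets because \<open>P\<close> is. Replacing \<open>x\<close> by \<open>x + h\<close> in one slot
  after the other writes \<open>P (x + h) - P x\<close> as \<open>m\<close> values of \<open>B\<close> with one entry \<open>h\<close>, and this entry is
  \<open>\<eta>\<close> times a vector of norm at most 1.
\<close>
lemma homogeneous_polynomial_uniformly_continuous:
  assumes X: "complex_normed_space X" and Y: "complex_normed_space Y"
    and P: "homogeneous_polynomial m (pts X) (pts Y) P" and cont: "continuous_map (ntop X) (ntop Y) P"
    and \<epsilon>: "0 < \<epsilon>"
  obtains \<eta> where "0 < \<eta>" "\<And>x h. x \<in> pts X \<Longrightarrow> h \<in> pts X \<Longrightarrow> nrm X x \<le> R \<Longrightarrow> nrm X h \<le> \<eta> \<Longrightarrow>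
    nrm Y (P (x + h) - P x) \<le> \<epsilon>"
proof -
  note V = nspace_subspace[OF X]
  have PY: "P x \<in> pts Y" if "x \<in> pts X" for x
    using cont that by (auto simp: continuous_map_ntop_ntop[OF X Y])
  obtain B where B: "\<And>W'. cvec.subspace W' \<Longrightarrow> P ` pts X \<subseteq> W' \<Longrightarrow> multilinear_map m (pts X) W' B"
      "\<And>x. x \<in> pts X \<Longrightarrow> P x = B (\<lambda>i\<in>{..<m}. x)"
      "\<And>x. x \<in> {..<m} \<rightarrow>\<^sub>E pts X \<Longrightarrow>
        B x = inverse (fact m) *\<^sub>C (\<Sum>S\<in>Pow {..<m}. (- 1) ^ (m + card S) *\<^sub>C P (\<Sum>i\<in>S. x i))"
    by (rule polarization[OF P V]) (rule that; assumption)
  have ml: "multilinear_map m (pts X) (pts Y) B"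
    using PY by (intro B(1) nspace_subspace[OF Y]) auto
  have BY: "B x \<in> pts Y" if "x \<in> {..<m} \<rightarrow>\<^sub>E pts X" for x
    using ml that unfolding multilinear_map_def by blast
  define R' where "R' = \<bar>R\<bar> + 1"
  obtain M where M: "\<And>x. x \<in> pts X \<Longrightarrow> nrm X x \<le> real m * R' \<Longrightarrow> nrm Y (P x) \<le> M"
    by (rule homogeneous_polynomial_bounded[OF X Y P cont]) (rule that; assumption)
  define M' where "M' = inverse (fact m) * (2 ^ m * M)"
  have BM: "nrm Y (B x) \<le> M'" if x: "x \<in> {..<m} \<rightarrow>\<^sub>E pts X" "\<And>i. i < m \<Longrightarrow> nrm X (x i) \<le> R'" for x
  proof -
    have P1: "(\<Sum>i\<in>S. x i) \<in> pts X" "nrm Y (P (\<Sum>i\<in>S. x i)) \<le> M" if S: "S \<in> Pow {..<m}" for S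
    proof -
      have xi: "x i \<in> pts X" "nrm X (x i) \<le> R'" if "i \<in> S" for i using x S that by auto
      show 1: "(\<Sum>i\<in>S. x i) \<in> pts X" using xi by (intro nspace_sum[OF X])
      have "nrm X (\<Sum>i\<in>S. x i) \<le> (\<Sum>i\<in>S. nrm X (x i))" using xi by (intro nrm_sum[OF X])
      also have "\<dots> \<le> real (card S) * R'" using sum_bounded_above[of S "\<lambda>i. nrm X (x i)" R'] xi by simp
      also have "\<dots> \<le> real m * R'"
        using S card_mono[of "{..<m}" S] by (intro mult_right_mono) (auto simp: R'_def)
      finally show "nrm Y (P (\<Sum>i\<in>S. x i)) \<le> M" using 1 M by blast
    qed
    have mem: "(- 1) ^ (m + card S) *\<^sub>C P (\<Sum>i\<in>S. x i) \<in> pts Y" if "S \<in> Pow {..<m}" for S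
      using P1(1)[OF that] by (intro nspace_scale[OF Y] PY)
    have "nrm Y (\<Sum>S\<in>Pow {..<m}. (- 1) ^ (m + card S) *\<^sub>C P (\<Sum>i\<in>S. x i)) \<le>
        (\<Sum>S\<in>Pow {..<m}. nrm Y ((- 1) ^ (m + card S) *\<^sub>C P (\<Sum>i\<in>S. x i)))"
      using mem by (intro nrm_sum[OF Y])
    also have "\<dots> \<le> (\<Sum>S\<in>Pow {..<m}. M)"
      by (intro sum_mono) (simp add: nrm_scale[OF Y PY[OF P1(1)]] norm_power P1(2))
    also have "\<dots> = 2 ^ m * M" by (simp add: card_Pow)
    finally have "cmod (inverse (fact m)) * nrm Y (\<Sum>S\<in>Pow {..<m}. (- 1) ^ (m + card S) *\<^sub>C P (\<Sum>i\<in>S. x i)) \<le>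
        cmod (inverse (fact m)) * (2 ^ m * M)" by (intro mult_left_mono) auto
    moreover have "(\<Sum>S\<in>Pow {..<m}. (- 1) ^ (m + card S) *\<^sub>C P (\<Sum>i\<in>S. x i)) \<in> pts Y"
      by (intro nspace_sum[OF Y] mem)
    ultimately show ?thesis
      unfolding B(3)[OF x(1)] M'_def by (simp only: nrm_scale[OF Y] norm_inverse norm_fact)
  qed
  have M'0: "0 \<le> M'"
    using order_trans[OF nrm_nonneg[OF Y BY] BM, of "\<lambda>i\<in>{..<m}. 0"] nspace_zero[OF X]
    by (auto simp: nrm_zero[OF X] R'_def)
  define \<eta> where "\<eta> = min 1 (\<epsilon> / (real m * M' + 1))"
  have den: "0 < real m * M' + 1" using M'0 by (simp add: add_nonneg_pos)
  have \<eta>: "0 < \<eta>" "\<eta> \<le> 1" "real m * (\<eta> * M') \<le> \<epsilon>"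
  proof -
    show "0 < \<eta>" "\<eta> \<le> 1" using \<epsilon> den by (auto simp: \<eta>_def)
    have "\<eta> * (real m * M') \<le> \<eta> * (real m * M' + 1)" using \<open>0 < \<eta>\<close> by simp
    also have "\<dots> \<le> \<epsilon> / (real m * M' + 1) * (real m * M' + 1)"
      using den by (intro mult_right_mono) (auto simp: \<eta>_def)
    also have "\<dots> = \<epsilon>" using den by simp
    finally show "real m * (\<eta> * M') \<le> \<epsilon>" by (simp add: mult_ac)
  qed
  show thesis
  proof (rule that[OF \<eta>(1)])
    fix x h assume x: "x \<in> pts X" "nrm X x \<le> R" and h: "h \<in> pts X" "nrm X h \<le> \<eta>"
    have xh: "x + h \<in> pts X" "nrm X (x + h) \<le> R'" "nrm X x \<le> R'"
      using nspace_add[OF X x(1) h(1)] nrm_add[OF X x(1) h(1)] x(2) h(2) \<eta>(2) by (auto simp: R'_def)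
    define h' where "h' = of_real (1 / \<eta>) *\<^sub>C h"
    have "nrm X h' = 1 / \<eta> * nrm X h" using \<eta>(1) nrm_scale[OF X h(1)] by (simp add: h'_def norm_divide)
    also have "\<dots> \<le> 1" using h(2) \<eta>(1) by (simp add: divide_le_eq)
    also have "\<dots> \<le> R'" by (simp add: R'_def)
    finally have h': "h' \<in> pts X" "nrm X h' \<le> R'" "h = of_real \<eta> *\<^sub>C h'"
      using nspace_scale[OF X h(1)] \<eta>(1) by (auto simp: h'_def scaleC_scaleC scaleC_one simp flip: of_real_mult)
    define y where "y j = (\<lambda>i\<in>{..<m}. if i < j then x + h else x)" for j
    have y: "y j \<in> {..<m} \<rightarrow>\<^sub>E pts X" for j using x(1) xh(1) by (auto simp: y_def)
    have step: "nrm Y (B (y (Suc j)) - B (y j)) \<le> \<eta> * M'" if j: "j < m" for j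
    proof -
      have "y (Suc j) = (y j)(j := x + h)" "y j = (y j)(j := x)"
        using j by (auto simp: y_def fun_eq_iff less_Suc_eq)
      moreover have "B ((y j)(j := x + h)) = B ((y j)(j := x)) + B ((y j)(j := h))"
        "B ((y j)(j := of_real \<eta> *\<^sub>C h')) = of_real \<eta> *\<^sub>C B ((y j)(j := h'))"
        using ml y[of j] j x(1) h(1) h'(1) unfolding multilinear_map_def by blast+
      ultimately have eq: "B (y (Suc j)) - B (y j) = of_real \<eta> *\<^sub>C B ((y j)(j := h'))"
        using h'(3) by (metis add_diff_cancel_left')
      have yh: "(y j)(j := h') \<in> {..<m} \<rightarrow>\<^sub>E pts X"
        using y[of j] h'(1) j by (auto simp: PiE_iff extensional_def)
      have "nrm Y (B ((y j)(j := h'))) \<le> M'"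
        using yh xh(2,3) h'(2) by (intro BM) (auto simp: y_def)
      then show ?thesis
        unfolding eq using nrm_scale[OF Y BY[OF yh]] \<eta>(1) by (simp add: mult_left_mono)
    qed
    have "y m = (\<lambda>i\<in>{..<m}. x + h)" "y 0 = (\<lambda>i\<in>{..<m}. x)"
      by (auto simp: y_def fun_eq_iff)
    then have "P (x + h) - P x = (\<Sum>j<m. B (y (Suc j)) - B (y j))"
      using B(2)[OF xh(1)] B(2)[OF x(1)] sum_lessThan_telescope[of "\<lambda>j. B (y j)" m] by simp
    also have "nrm Y \<dots> \<le> (\<Sum>j<m. nrm Y (B (y (Suc j)) - B (y j)))"
      using BY[OF y] by (intro nrm_sum[OF Y] nspace_diff[OF Y])
    also have "\<dots> \<le> (\<Sum>j<m. \<eta> * M')" by (intro sum_mono step) simp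
    also have "\<dots> \<le> \<epsilon>" using \<eta>(3) by simp
    finally show "nrm Y (P (x + h) - P x) \<le> \<epsilon>" .
  qed
qed

section \<open>Compact polynomials\<close>

lemma relatively_compact_imp_finite_net:
  assumes Y: "complex_normed_space Y" and S: "S \<subseteq> pts Y"
    and "compactin (ntop Y) (ntop Y closure_of S)" and "0 < \<epsilon>"
  obtains K where "finite K" "K \<subseteq> S" "\<And>s. s \<in> S \<Longrightarrow> \<exists>k\<in>K. nrm Y (s - k) < \<epsilon>"
proof -
  interpret Metric_space "pts Y" "ndist Y" by (rule Metric_space_ndist[OF Y])
  have "mtotally_bounded S" using assms(3) S by (rule compact_closure_of_imp_mtotally_bounded)
  then have "\<exists>K. finite K \<and> K \<subseteq> S \<and> S \<subseteq> (\<Union>k\<in>K. mball k \<epsilon>)"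
    using \<open>0 < \<epsilon>\<close> unfolding mtotally_bounded_def by simp
  then obtain K where K: "finite K" "K \<subseteq> S" "S \<subseteq> (\<Union>k\<in>K. mball k \<epsilon>)"
    by blast
  have "\<exists>k\<in>K. nrm Y (s - k) < \<epsilon>" if "s \<in> S" for s
    using K(3) that in_nball[OF Y] by blast
  with K(1,2) show thesis by (rule that)
qed

lemma relatively_compact_if_finite_nets:
  assumes Y: "complex_banach_space Y" and S: "S \<subseteq> pts Y"
    and net: "\<And>\<epsilon>. 0 < \<epsilon> \<Longrightarrow> \<exists>K. finite K \<and> K \<subseteq> pts Y \<and> (\<forall>s\<in>S. \<exists>k\<in>K. nrm Y (s - k) < \<epsilon>)"
  shows "compactin (ntop Y) (ntop Y closure_of S)"
proof -
  have nY: "complex_normed_space Y" using Y by (rule banach_imp_normed)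
  interpret Metric_space "pts Y" "ndist Y" by (rule Metric_space_ndist[OF nY])
  have "mtotally_bounded S"
    unfolding mtotally_bounded_def
  proof (intro allI impI)
    fix \<epsilon> :: real assume "0 < \<epsilon>"
    then obtain K where K: "finite K" "K \<subseteq> pts Y" "\<And>s. s \<in> S \<Longrightarrow> \<exists>k\<in>K. nrm Y (s - k) < \<epsilon> / 2"
      using net[of "\<epsilon> / 2"] by auto
    define c where "c k = (SOME s. s \<in> S \<and> nrm Y (s - k) < \<epsilon> / 2)" for k
    define K' where "K' = {k \<in> K. \<exists>s\<in>S. nrm Y (s - k) < \<epsilon> / 2}"
    have c: "c k \<in> S" "nrm Y (c k - k) < \<epsilon> / 2" if "k \<in> K'" for k
      using someI_ex[of "\<lambda>s. s \<in> S \<and> nrm Y (s - k) < \<epsilon> / 2"] that by (auto simp: c_def K'_def)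
    show "\<exists>K. finite K \<and> K \<subseteq> S \<and> S \<subseteq> (\<Union>x\<in>K. mball x \<epsilon>)"
    proof (intro exI[of _ "c ` K'"] conjI subsetI)
      show "finite (c ` K')" using K(1) by (simp add: K'_def)
      show "x \<in> S" if "x \<in> c ` K'" for x using c(1) that by blast
      fix s assume s: "s \<in> S"
      then obtain k where k: "k \<in> K" "nrm Y (s - k) < \<epsilon> / 2" using K(3) by blast
      then have k': "k \<in> K'" using s by (auto simp: K'_def)
      have Ys: "s \<in> pts Y" "k \<in> pts Y" "c k \<in> pts Y" using s k(1) K(2) S c(1)[OF k'] by auto
      have "nrm Y (s - c k) < \<epsilon>"
        using nrm_diff_triangle[OF nY Ys] nrm_minus_commute[OF nY Ys(2,3)] k(2) c(2)[OF k'] by simp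
      then show "s \<in> (\<Union>x\<in>c ` K'. mball x \<epsilon>)"
        using k' Ys in_nball[OF nY] by blast
    qed
  qed
  moreover have mcomplete using Y by (simp add: complex_banach_space_def)
  ultimately show ?thesis by (simp add: mtotally_bounded_eq_compact_closure_of)
qed

text \<open>
  Homogeneity scales a finite net for the image of a small ball around 0 to one for the image of any
  ball.
\<close>
lemma compact_homogeneous_polynomial_net_on_ball:
  assumes X: "complex_normed_space X" and Y: "complex_normed_space Y"
    and P: "compact_homogeneous_polynomial m X Y P" and "0 < \<epsilon>"
  obtains K where "finite K" "K \<subseteq> pts Y"
    "\<And>x. x \<in> pts X \<Longrightarrow> nrm X x \<le> R \<Longrightarrow> \<exists>k\<in>K. nrm Y (P x - k) < \<epsilon>"
proof -
  have hom: "homogeneous_polynomial m (pts X) (pts Y) P"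
    using P by (simp add: compact_homogeneous_polynomial_def)
  have PY: "P x \<in> pts Y" if "x \<in> pts X" for x
  proof -
    obtain A where A: "multilinear_map m (pts X) (pts Y) A" "\<And>x. x \<in> pts X \<Longrightarrow> P x = A (\<lambda>i\<in>{..<m}. x)"
      using hom unfolding homogeneous_polynomial_def by blast
    have "(\<lambda>i\<in>{..<m}. x) \<in> {..<m} \<rightarrow>\<^sub>E pts X" using that by auto
    then show ?thesis using A(1) A(2)[OF that] unfolding multilinear_map_def by simp
  qed
  obtain r where r: "0 < r" "compactin (ntop Y) (ntop Y closure_of (P ` nball X 0 r))"
    using P nspace_zero[OF X] unfolding compact_homogeneous_polynomial_def by blast
  define c where "c = r / (\<bar>R\<bar> + 1)"
  have c: "0 < c" using r(1) by (simp add: c_def add_nonneg_pos)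
  have "P ` nball X 0 r \<subseteq> pts Y" using PY in_nball[OF X] by blast
  moreover have "0 < c ^ m * \<epsilon>" using c \<open>0 < \<epsilon>\<close> by simp
  ultimately obtain K where K: "finite K" "K \<subseteq> P ` nball X 0 r"
      "\<And>s. s \<in> P ` nball X 0 r \<Longrightarrow> \<exists>k\<in>K. nrm Y (s - k) < c ^ m * \<epsilon>"
    using relatively_compact_imp_finite_net[OF Y _ r(2)] by metis
  have KY: "K \<subseteq> pts Y" using K(2) \<open>P ` nball X 0 r \<subseteq> pts Y\<close> by blast
  define d where "d = inverse (complex_of_real c ^ m)"
  have d: "cmod d = inverse (c ^ m)" using c by (simp add: d_def norm_inverse norm_power)
  show thesis
  proof (rule that[of "(\<lambda>k. d *\<^sub>C k) ` K"])
    show "finite ((\<lambda>k. d *\<^sub>C k) ` K)" using K(1) by simp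
    show "(\<lambda>k. d *\<^sub>C k) ` K \<subseteq> pts Y" using KY nspace_scale[OF Y] by blast
    fix x assume x: "x \<in> pts X" "nrm X x \<le> R"
    have cx: "of_real c *\<^sub>C x \<in> pts X" using x(1) by (rule nspace_scale[OF X])
    have "nrm X (of_real c *\<^sub>C x) = c * nrm X x" using nrm_scale[OF X x(1)] c by simp
    also have "\<dots> \<le> c * R" using x(2) c by (intro mult_left_mono) auto
    also have "\<dots> < r" using r(1) by (auto simp: c_def divide_simps add_nonneg_pos)
    finally have "of_real c *\<^sub>C x \<in> nball X 0 r"
      using cx nspace_zero[OF X] by (simp add: in_nball[OF X])
    then obtain k where k: "k \<in> K" "nrm Y (P (of_real c *\<^sub>C x) - k) < c ^ m * \<epsilon>" using K(3) by blast
    have kY: "k \<in> pts Y" using k(1) KY by blast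
    have "P x = d *\<^sub>C P (of_real c *\<^sub>C x)"
      using homogeneous_polynomial_scale[OF hom nspace_subspace[OF X] x(1)] c
      by (simp add: d_def scaleC_scaleC scaleC_one)
    then have "P x - d *\<^sub>C k = d *\<^sub>C (P (of_real c *\<^sub>C x) - k)"
      by (simp only: cvec.scale_right_diff_distrib)
    then have "nrm Y (P x - d *\<^sub>C k) = inverse (c ^ m) * nrm Y (P (of_real c *\<^sub>C x) - k)"
      using nrm_scale[OF Y nspace_diff[OF Y PY[OF cx] kY]] d by simp
    also have "\<dots> < inverse (c ^ m) * (c ^ m * \<epsilon>)"
      using k(2) c by (intro mult_strict_left_mono) auto
    also have "\<dots> = \<epsilon>" using c by simp
    finally show "\<exists>k\<in>(\<lambda>k. d *\<^sub>C k) ` K. nrm Y (P x - k) < \<epsilon>" using k(1) by blast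
  qed
qed

text \<open>
  The couple \<open>(Y, Y)\<close> stands for \<open>Y\<close>: splitting a vector cannot reduce its norm, by the triangle
  inequality.
\<close>
lemma ntop_sum_space_same:
  assumes Y: "complex_normed_space Y"
  shows "pts (sum_space Y Y) = pts Y" "ntop (sum_space Y Y) = ntop Y"
proof -
  show p: "pts (sum_space Y Y) = pts Y"
    using pts_subset_sum_space(1)[OF Y Y] nspace_add[OF Y] by (auto simp: pts_sum_space)
  have "nrm (sum_space Y Y) y = nrm Y y" if y: "y \<in> pts Y" for y
  proof (rule antisym[OF nrm_sum_space_le(1)[OF Y Y y]])
    show "nrm Y y \<le> nrm (sum_space Y Y) y"
      unfolding nrm_sum_space K_functional_def
    proof (rule quotient_norm_ge)
      show "y \<in> (\<lambda>(u, v). u + v) ` (pts Y \<times> pts Y)" using y p by (simp add: pts_sum_space)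
    qed (auto simp: nrm_add[OF Y])
  qed
  then have "ndist (sum_space Y Y) = ndist Y"
    using nspace_diff[OF Y] by (auto simp: ndist_def p fun_eq_iff)
  then show "ntop (sum_space Y Y) = ntop Y" by (simp add: p)
qed

text \<open>
  Near \<open>x\<close> the differences of values of \<open>P\<close> have norm at most 2 in \<open>Y1\<close>, by continuity, so a
  \<open>\<delta>\<close>-net in \<open>Y0\<close> consisting of values of \<open>P\<close> is an \<open>\<epsilon>\<close>-net in the interpolation space. Completeness
  of the latter is essential: limits in \<open>Y0\<close> of values of \<open>P\<close> need not belong to \<open>Y1\<close>.
\<close>
theorem compact_into_calderon_space:
  assumes compat: "compatible_couple Y0 Y1" and nX: "complex_normed_space X"
    and \<theta>: "0 < \<theta>" "\<theta> < 1"
    and P1: "continuous_map (ntop X) (ntop Y1) P"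
    and P0: "compact_homogeneous_polynomial m X Y0 P" "continuous_map (ntop X) (ntop Y0) P"
  shows "compact_homogeneous_polynomial m X (calderon_space Y0 Y1 \<theta>) P"
  unfolding compact_homogeneous_polynomial_def
proof (intro conjI ballI)
  let ?Y = "calderon_space Y0 Y1 \<theta>"
  note Y = couple_normed[OF compat]
  have bY: "complex_banach_space ?Y" using compat \<theta> by (rule complex_banach_space_calderon_space)
  then have nY: "complex_normed_space ?Y" by (rule banach_imp_normed)
  have PY: "P x \<in> pts Y0" "P x \<in> pts Y1" if "x \<in> pts X" for x
    using P0(2) P1 that by (auto simp: continuous_map_ntop_ntop nX Y)
  have PYt: "P x \<in> pts ?Y" if "x \<in> pts X" for x
    using calderon_space_mem_and_nrm_le(1)[OF compat \<theta> PY[OF that]] .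
  show "homogeneous_polynomial m (pts X) (pts ?Y) P"
    using P0(1) PYt unfolding compact_homogeneous_polynomial_def
    by (auto intro: homogeneous_polynomial_codomain nspace_subspace nX nY)
  fix x assume x: "x \<in> pts X"
  obtain r0 where r0: "0 < r0" "compactin (ntop Y0) (ntop Y0 closure_of (P ` nball X x r0))"
    using P0(1) x unfolding compact_homogeneous_polynomial_def by blast
  obtain r1 where r1: "0 < r1" "\<And>y. y \<in> pts X \<Longrightarrow> nrm X (y - x) < r1 \<Longrightarrow> nrm Y1 (P y - P x) < 1"
    using P1 x zero_less_one unfolding continuous_map_ntop_ntop[OF nX Y(2)] by blast
  define r where "r = min r0 r1"
  have ball: "y \<in> pts X" "y \<in> nball X x r0" "nrm Y1 (P y - P x) < 1" if "y \<in> nball X x r" for y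
    using that r1(2)[of y] by (auto simp: in_nball[OF nX] r_def)
  have "compactin (ntop ?Y) (ntop ?Y closure_of (P ` nball X x r))"
  proof (rule relatively_compact_if_finite_nets[OF bY])
    show "P ` nball X x r \<subseteq> pts ?Y" using PYt ball(1) by blast
    fix \<epsilon> :: real assume "0 < \<epsilon>"
    then obtain \<delta> where \<delta>: "0 < \<delta>" "\<And>y. y \<in> pts Y0 \<Longrightarrow> y \<in> pts Y1 \<Longrightarrow> nrm Y0 y < \<delta> \<Longrightarrow>
        nrm Y1 y \<le> 2 \<Longrightarrow> nrm ?Y y < \<epsilon>"
      by (rule calderon_space_nrm_small[OF compat \<theta>]) (rule that; assumption)
    have sub: "P ` nball X x r0 \<subseteq> pts Y0" using PY(1) in_nball[OF nX] by blast
    have "ntop Y0 closure_of (P ` nball X x r) \<subseteq> ntop Y0 closure_of (P ` nball X x r0)"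
      using ball(2) by (intro closure_of_mono) blast
    then have "compactin (ntop Y0) (ntop Y0 closure_of (P ` nball X x r))"
      by (rule closed_compactin[OF r0(2) _ closedin_closure_of])
    moreover have "P ` nball X x r \<subseteq> pts Y0" using PY(1) ball(1) by blast
    ultimately obtain K where K: "finite K" "K \<subseteq> P ` nball X x r"
        "\<And>s. s \<in> P ` nball X x r \<Longrightarrow> \<exists>k\<in>K. nrm Y0 (s - k) < \<delta>"
      using relatively_compact_imp_finite_net[OF Y(1) _ _ \<delta>(1)] by metis
    have "\<exists>k\<in>K. nrm ?Y (P y - k) < \<epsilon>" if y: "y \<in> nball X x r" for y
    proof -
      obtain k where k: "k \<in> K" "nrm Y0 (P y - k) < \<delta>" using K(3) y by blast
      then obtain y' where y': "y' \<in> nball X x r" "k = P y'" using K(2) by blast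
      note mem = PY[OF ball(1)[OF y]] PY[OF ball(1)[OF y'(1)]] PY[OF x]
      have "nrm Y1 (P y - P y') \<le> nrm Y1 (P y - P x) + nrm Y1 (P x - P y')"
        using mem by (intro nrm_diff_triangle Y)
      also have "\<dots> \<le> 2"
        using ball(3)[OF y] ball(3)[OF y'(1)] nrm_minus_commute[OF Y(2) mem(6,4)] by simp
      finally have "nrm ?Y (P y - k) < \<epsilon>"
        using k(2) mem unfolding y'(2) by (intro \<delta>(2) nspace_diff Y)
      with k(1) show ?thesis by blast
    qed
    moreover have "K \<subseteq> pts ?Y" using K(2) PYt ball(1) by blast
    ultimately show "\<exists>K. finite K \<and> K \<subseteq> pts ?Y \<and> (\<forall>s\<in>P ` nball X x r. \<exists>k\<in>K. nrm ?Y (s - k) < \<epsilon>)"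
      using K(1) by blast
  qed
  moreover have "0 < r" using r0(1) r1(1) by (simp add: r_def)
  ultimately show "\<exists>r>0. compactin (ntop ?Y) (ntop ?Y closure_of (P ` nball X x r))" by blast
qed

text \<open>
  On a bounded set of the interpolation space write \<open>y = u + v\<close> with \<open>u\<close> bounded in \<open>X0\<close> and \<open>v\<close>
  small in \<open>X1\<close>. Then \<open>P y\<close> is close to \<open>P u\<close>, and the values \<open>P u\<close> have a finite net. The bound for \<open>u\<close>
  in \<open>X0\<close> grows as \<open>v\<close> is made smaller, but \<open>P\<close> only has to be uniformly continuous on bounded sets of
  the sum, where \<open>y\<close> has norm at most \<open>R\<close> throughout.
\<close>
theorem compact_from_calderon_space:
  assumes compat: "compatible_couple X0 X1" and Y: "complex_banach_space Y"
    and \<theta>: "0 < \<theta>" "\<theta> < 1"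
    and hom: "homogeneous_polynomial m (pts (sum_space X0 X1)) (pts Y) P"
    and cont: "continuous_map (ntop (sum_space X0 X1)) (ntop Y) P"
    and P0: "compact_homogeneous_polynomial m X0 Y P"
  shows "compact_homogeneous_polynomial m (calderon_space X0 X1 \<theta>) Y P"
  unfolding compact_homogeneous_polynomial_def
proof (intro conjI ballI)
  let ?X = "calderon_space X0 X1 \<theta>" and ?S = "sum_space X0 X1"
  have nY: "complex_normed_space Y" using Y by (rule banach_imp_normed)
  note X = couple_normed[OF compat]
  have nX: "complex_normed_space ?X"
    using complex_banach_space_calderon_space[OF compat \<theta>] by (rule banach_imp_normed)
  note XS = calderon_space_in_sum_space[OF compat \<theta>]
  have PY: "P x \<in> pts Y" if "x \<in> pts ?S" for x
    using cont that by (auto simp: continuous_map_ntop_ntop X(3) nY)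
  show "homogeneous_polynomial m (pts ?X) (pts Y) P"
    using hom XS(1) by (intro homogeneous_polynomial_subset[OF hom]) blast
  fix x assume x: "x \<in> pts ?X"
  define R where "R = nrm ?X x + 1"
  have ball: "y \<in> pts ?X" "nrm ?X y < R" if "y \<in> nball ?X x 1" for y
  proof -
    show y: "y \<in> pts ?X" using that by (simp add: in_nball[OF nX])
    show "nrm ?X y < R"
      using nrm_add[OF nX nspace_diff[OF nX y x] x] that by (simp add: in_nball[OF nX] R_def)
  qed
  have "compactin (ntop Y) (ntop Y closure_of (P ` nball ?X x 1))"
  proof (rule relatively_compact_if_finite_nets[OF Y])
    show "P ` nball ?X x 1 \<subseteq> pts Y" using PY XS(1) ball(1) by blast
    fix \<epsilon> :: real assume "0 < \<epsilon>"
    then have e: "0 < \<epsilon> / 2" by simp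
    obtain \<eta> where \<eta>: "0 < \<eta>" "\<And>u h. u \<in> pts ?S \<Longrightarrow> h \<in> pts ?S \<Longrightarrow> nrm ?S u \<le> R \<Longrightarrow> nrm ?S h \<le> \<eta> \<Longrightarrow>
        nrm Y (P (u + h) - P u) \<le> \<epsilon> / 2"
      by (rule homogeneous_polynomial_uniformly_continuous[OF X(3) nY hom cont e]) (rule that; assumption)
    obtain C where C: "\<And>y. y \<in> pts ?X \<Longrightarrow> nrm ?X y < R \<Longrightarrow>
        \<exists>u\<in>pts X0. \<exists>v\<in>pts X1. y = u + v \<and> nrm X0 u \<le> C \<and> nrm X1 v \<le> \<eta>"
      by (rule calderon_space_decompose[OF compat \<theta> \<eta>(1)]) (rule that; assumption)
    obtain K where K: "finite K" "K \<subseteq> pts Y"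
        "\<And>u. u \<in> pts X0 \<Longrightarrow> nrm X0 u \<le> C \<Longrightarrow> \<exists>k\<in>K. nrm Y (P u - k) < \<epsilon> / 2"
      by (rule compact_homogeneous_polynomial_net_on_ball[OF X(1) nY P0 e]) (rule that; assumption)
    have "\<exists>k\<in>K. nrm Y (P y - k) < \<epsilon>" if "y \<in> nball ?X x 1" for y
    proof -
      note y = ball[OF that]
      obtain u v where uv: "u \<in> pts X0" "v \<in> pts X1" "y = u + v" "nrm X0 u \<le> C" "nrm X1 v \<le> \<eta>"
        using C[OF y] by blast
      obtain k where k: "k \<in> K" "nrm Y (P u - k) < \<epsilon> / 2" using K(3)[OF uv(1,4)] by blast
      have yS: "y \<in> pts ?S" and uS: "u \<in> pts ?S" and vS: "v \<in> pts ?S"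
        using XS(1)[OF y(1)] uv(1,2) pts_subset_sum_space[OF X(1,2)] by auto
      have "nrm ?S (- v) \<le> \<eta>"
        using nrm_scale[OF X(3) vS, of "- 1"] nrm_sum_space_le(2)[OF X(1,2) uv(2)] uv(5) by simp
      moreover have "- v \<in> pts ?S" using nspace_scale[OF X(3) vS, of "- 1"] by simp
      moreover have "nrm ?S y \<le> R" using XS(2)[OF y(1)] y(2) by linarith
      ultimately have "nrm Y (P (y + - v) - P y) \<le> \<epsilon> / 2" using yS by (intro \<eta>(2))
      then have "nrm Y (P y - P u) \<le> \<epsilon> / 2"
        using nrm_minus_commute[OF nY PY[OF uS] PY[OF yS]] by (simp add: uv(3))
      moreover have "k \<in> pts Y" using k(1) K(2) by blast
      ultimately have "nrm Y (P y - k) < \<epsilon>"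
        using nrm_diff_triangle[OF nY PY[OF yS] PY[OF uS], of k] k(2) by simp
      with k(1) show ?thesis by blast
    qed
    with K(1,2) show "\<exists>K. finite K \<and> K \<subseteq> pts Y \<and> (\<forall>s\<in>P ` nball ?X x 1. \<exists>k\<in>K. nrm Y (s - k) < \<epsilon>)"
      by blast
  qed
  then show "\<exists>r>0. compactin (ntop Y) (ntop Y closure_of (P ` nball ?X x r))"
    using zero_less_one by blast
qed

theorem theorem4p4:
  fixes X0 X1 :: "('a::complex_vector) nspace"
    and Y0 Y1 :: "('b::complex_vector) nspace"
    and X :: "('c::complex_vector) nspace"
    and Y :: "('d::complex_vector) nspace"
    and m :: nat
    and \<theta> :: real
  assumes "compatible_couple X0 X1"
    and "compatible_couple Y0 Y1"
    and "complex_banach_space X"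
    and "complex_banach_space Y"
    and "0 < \<theta>"
    and "\<theta> < 1"
  shows "(\<forall>P \<in> couple_polynomials m X X Y0 Y1.
            compact_homogeneous_polynomial m X Y0 P \<longrightarrow>
            compact_homogeneous_polynomial m X (calderon_space Y0 Y1 \<theta>) P) \<and>
         (\<forall>P \<in> couple_polynomials m X0 X1 Y Y.
            compact_homogeneous_polynomial m X0 Y P \<longrightarrow>
            compact_homogeneous_polynomial m (calderon_space X0 X1 \<theta>) Y P)"
proof (intro conjI ballI impI)
  fix P assume "P \<in> couple_polynomials m X X Y0 Y1" "compact_homogeneous_polynomial m X Y0 P"
  then show "compact_homogeneous_polynomial m X (calderon_space Y0 Y1 \<theta>) P"
    using assms banach_imp_normed[OF assms(3)]
    by (intro compact_into_calderon_space) (auto simp: couple_polynomials_def)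
next
  fix P assume P: "P \<in> couple_polynomials m X0 X1 Y Y" "compact_homogeneous_polynomial m X0 Y P"
  have "homogeneous_polynomial m (pts (sum_space X0 X1)) (pts Y) P"
    "continuous_map (ntop (sum_space X0 X1)) (ntop Y) P"
    using P(1) ntop_sum_space_same[OF banach_imp_normed[OF assms(4)]] by (auto simp: couple_polynomials_def)
  then show "compact_homogeneous_polynomial m (calderon_space X0 X1 \<theta>) Y P"
    using assms P(2) by (intro compact_from_calderon_space)
qed

end
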